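(* Let $p$ be a prime and let $G$ be a finite $p$-solvable group. Then the number of $p$-chief factors in a chief series for $G$ is at most the number of nonprincipal $\mathbb{Q}_p$-valued irreducible (complex) characters of $G$. Furthermore, if $G$ is a finite solvable group, then the number of factors in a chief series for $G$ is less than or equal to the number of nonprincipal $\mathbb{Q}_{pp}$-valued irreducible characters of $G$.
   Context: All groups are finite and characters are ordinary complex characters. For a prime $p$, $\mathbb{Q}_p$ denotes (not the $p$-adic numbers but) the subfield of $\mathbb{C}$ obtained by adjoining to $\mathbb{Q}$ all $p^a$-th roots of unity for all positive integers $a$. A character $\chi$ of $G$ is $\mathbb{Q}_p$-valued if $\chi(g) \in \mathbb{Q}_p$ for all $g \in G$; it is $\mathbb{Q}_{pp}$-valued if there exists a prime $q$ (depending on $\chi$) such that $\chi$ is $\mathbb{Q}_q$-valued. A $p$-chief factor is a (nontrivial) chief factor of $G$ that is a $p$-group. Nonprincipal means different from the principal character $1_G$. *)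

theory Defs
  imports
    "HOL-Algebra.Solvable_Groups"
    "HOL-Algebra.Generated_Fields"
    "HOL-Computational_Algebra.Primes"
    "HOL.Complex"
    "Jordan_Normal_Form.Matrix"
    "Jordan_Normal_Form.VS_Connect"
begin

section \<open>Complex characters\<close>

definition GL :: "nat \<Rightarrow> complex mat monoid" where
  "GL n = units_of (ring_mat TYPE(complex) n ())"

definition representation :: "('a, 'b) monoid_scheme \<Rightarrow> nat \<Rightarrow> ('a \<Rightarrow> complex mat) \<Rightarrow> bool" where
  "representation G n \<rho> \<longleftrightarrow> \<rho> \<in> hom G (GL n)"

text \<open>The theory \<open>VS_Connect\<close> hides the short name \<open>subspace\<close>; the notion meant here is that of a
  linear subspace of the space of column vectors of length \<open>n\<close>.\<close>

definition invariant_subspace ::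
  "('a, 'b) monoid_scheme \<Rightarrow> nat \<Rightarrow> ('a \<Rightarrow> complex mat) \<Rightarrow> complex vec set \<Rightarrow> bool" where
  "invariant_subspace G n \<rho> W \<longleftrightarrow>
     VectorSpace.subspace class_ring W (module_vec TYPE(complex) n) \<and>
     (\<forall>g\<in>carrier G. \<forall>w\<in>W. \<rho> g *\<^sub>v w \<in> W)"

definition irreducible_representation ::
  "('a, 'b) monoid_scheme \<Rightarrow> nat \<Rightarrow> ('a \<Rightarrow> complex mat) \<Rightarrow> bool" where
  "irreducible_representation G n \<rho> \<longleftrightarrow>
     representation G n \<rho> \<and> 0 < n \<and>
     (\<forall>W. invariant_subspace G n \<rho> W \<longrightarrow> W = {0\<^sub>v n} \<or> W = carrier_vec n)"

definition mat_trace :: "complex mat \<Rightarrow> complex" where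
  "mat_trace A = (\<Sum>i<dim_row A. A $$ (i, i))"

text \<open>Characters are functions on \<open>carrier G\<close>. They are represented extensionally (constantly
  \<open>undefined\<close> off the carrier), so that equality of HOL functions is equality of characters and
  characters can be counted by \<open>card\<close>.\<close>

definition afforded_character ::
  "('a, 'b) monoid_scheme \<Rightarrow> ('a \<Rightarrow> complex mat) \<Rightarrow> 'a \<Rightarrow> complex" where
  "afforded_character G \<rho> = (\<lambda>g\<in>carrier G. mat_trace (\<rho> g))"

definition Irr :: "('a, 'b) monoid_scheme \<Rightarrow> ('a \<Rightarrow> complex) set" where
  "Irr G = {afforded_character G \<rho> | \<rho> n. irreducible_representation G n \<rho>}"

definition principal_character :: "('a, 'b) monoid_scheme \<Rightarrow> 'a \<Rightarrow> complex" where
  "principal_character G = (\<lambda>g\<in>carrier G. 1)"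

section \<open>Fields of values\<close>

definition Qp :: "nat \<Rightarrow> complex set" where
  "Qp p = generate_field class_ring (\<rat> \<union> {z. \<exists>a>0. z ^ (p ^ a) = 1})"

definition Qp_valued :: "('a, 'b) monoid_scheme \<Rightarrow> nat \<Rightarrow> ('a \<Rightarrow> complex) \<Rightarrow> bool" where
  "Qp_valued G p \<chi> \<longleftrightarrow> (\<forall>g\<in>carrier G. \<chi> g \<in> Qp p)"

definition Qpp_valued :: "('a, 'b) monoid_scheme \<Rightarrow> ('a \<Rightarrow> complex) \<Rightarrow> bool" where
  "Qpp_valued G \<chi> \<longleftrightarrow> (\<exists>q::nat. Factorial_Ring.prime q \<and> Qp_valued G q \<chi>)"

section \<open>Chief series and p-solvability\<close>

definition factor_group :: "('a, 'b) monoid_scheme \<Rightarrow> 'a set \<Rightarrow> 'a set \<Rightarrow> 'a set monoid" where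
  "factor_group G M N = (G\<lparr>carrier := M\<rparr>) Mod N"

definition p_group :: "nat \<Rightarrow> ('a, 'b) monoid_scheme \<Rightarrow> bool" where
  "p_group p H \<longleftrightarrow> group H \<and> (\<exists>k. Coset.order H = p ^ k)"

text \<open>An infinite group has \<open>order\<close> 0, so the divisibility condition also forces finiteness.\<close>

definition p'_group :: "nat \<Rightarrow> ('a, 'b) monoid_scheme \<Rightarrow> bool" where
  "p'_group p H \<longleftrightarrow> group H \<and> \<not> p dvd Coset.order H"

text \<open>Series are ascending lists from the trivial subgroup to \<open>G\<close>; all terms are normal in \<open>G\<close>.\<close>

definition normal_series :: "('a, 'b) monoid_scheme \<Rightarrow> 'a set list \<Rightarrow> bool" where
  "normal_series G Ns \<longleftrightarrow>
     Ns \<noteq> [] \<and> hd Ns = {\<one>\<^bsub>G\<^esub>} \<and> last Ns = carrier G \<and>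
     (\<forall>N\<in>set Ns. N \<lhd> G) \<and>
     (\<forall>i. Suc i < length Ns \<longrightarrow> Ns ! i \<subseteq> Ns ! Suc i)"

definition p_solvable :: "nat \<Rightarrow> ('a, 'b) monoid_scheme \<Rightarrow> bool" where
  "p_solvable p G \<longleftrightarrow>
     (\<exists>Ns. normal_series G Ns \<and>
       (\<forall>i. Suc i < length Ns \<longrightarrow>
          p_group p (factor_group G (Ns ! Suc i) (Ns ! i)) \<or>
          p'_group p (factor_group G (Ns ! Suc i) (Ns ! i))))"

text \<open>\<open>M / N\<close> is a minimal normal subgroup of \<open>G / N\<close>.\<close>

definition chief_factor :: "('a, 'b) monoid_scheme \<Rightarrow> 'a set \<Rightarrow> 'a set \<Rightarrow> bool" where
  "chief_factor G M N \<longleftrightarrow>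
     M \<lhd> G \<and> N \<lhd> G \<and> N \<subset> M \<and>
     (\<forall>L. L \<lhd> G \<and> N \<subseteq> L \<and> L \<subseteq> M \<longrightarrow> L = N \<or> L = M)"

definition p_chief_factor :: "nat \<Rightarrow> ('a, 'b) monoid_scheme \<Rightarrow> 'a set \<Rightarrow> 'a set \<Rightarrow> bool" where
  "p_chief_factor p G M N \<longleftrightarrow> chief_factor G M N \<and> p_group p (factor_group G M N)"

definition chief_series :: "('a, 'b) monoid_scheme \<Rightarrow> 'a set list \<Rightarrow> bool" where
  "chief_series G Ns \<longleftrightarrow>
     normal_series G Ns \<and>
     (\<forall>i. Suc i < length Ns \<longrightarrow> chief_factor G (Ns ! Suc i) (Ns ! i))"

text \<open>Factors are counted by their position in the series.\<close>

definition num_chief_factors :: "'a set list \<Rightarrow> nat" where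
  "num_chief_factors Ns = card {i. Suc i < length Ns}"

definition num_p_chief_factors :: "nat \<Rightarrow> ('a, 'b) monoid_scheme \<Rightarrow> 'a set list \<Rightarrow> nat" where
  "num_p_chief_factors p G Ns =
     card {i. Suc i < length Ns \<and> p_chief_factor p G (Ns ! Suc i) (Ns ! i)}"

end

theory Submission
  imports
    Defs
    "HOL-Algebra.Group_Action"
    "HOL-Algebra.Sylow"
    "HOL-Algebra.SndIsomorphismGrp"
    "HOL-Number_Theory.Cong"
    "HOL-Computational_Algebra.Fundamental_Theorem_Algebra"
    "Jordan_Normal_Form.Schur_Decomposition"
begin

text \<open>
  For every \<open>p\<close>-chief factor \<open>M / N\<close> of a \<open>p\<close>-solvable group \<open>G\<close> there is an irreducible character with
  values in \<open>K = Qp p\<close> whose kernel contains \<open>N\<close> but not \<open>M\<close>; characters belonging to different factors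
  of a chief series are distinct. Such a character comes from an idempotent \<open>e\<close> of the group algebra
  with coefficients in \<open>K\<close> such that \<open>e g e\<close> is a multiple of \<open>e\<close> for all \<open>g\<close>: the left ideal generated by
  \<open>e\<close> is simple, and its character is read off the coefficients of \<open>e\<close>.

  The idempotent is found by Clifford theory inside the group algebra. One starts with a nontrivial
  character of \<open>M / N\<close> and maintains a twisted group algebra of a section \<open>T / N\<close> whose cocycle takes
  \<open>p\<close>-power roots of unity as values. Let \<open>M / N\<close> now be a normal subgroup of \<open>T / N\<close> which is a
  \<open>p'\<close>-group or a minimal normal \<open>p\<close>-subgroup. If the cocycle splits on \<open>M\<close>, one cuts down by the
  idempotent of a linear character of \<open>M\<close> and passes to its stabilizer. Otherwise the part over \<open>M / N\<close>
  is a matrix algebra \<open>B\<close> of \<open>p\<close>-power degree, and one passes to the centralizer of \<open>B\<close>, a twisted group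
  algebra of \<open>T / M\<close>. Its cocycle can again be normalized by a determinant argument: elements of
  order prime to \<open>p\<close> are treated by Bezout's identity, and \<open>p\<close>-elements by a monomial basis.
\<close>

section \<open>Sections of finite groups\<close>

text \<open>The obstacle is the field: the usual ways of removing a cocycle adjoin roots of unity
  that \<open>K\<close> need not contain. The p-power roots of unity do lie in \<open>K\<close>, and
  every p-power root of such a number is again one. The passage to the centralizer of
  \<open>B\<close> endangers this: conjugation by a group element is inner on \<open>B\<close>, but
  the implementing unit is only determined up to a scalar of \<open>K\<close>. The determinant of
  the scalar \<open>c\<close> on \<open>B\<close> is \<open>c ^ (p ^ k)\<close>, so two units that
  implement the same automorphism and have determinants in \<mu> differ by a scalar in \<mu>. Units
  of this kind are closed under products, which reduces their existence to elements of p-power order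
  and elements of order prime to p. No case lies between splitting and a matrix algebra: the
  elements of \<open>M\<close> that commute with \<open>M\<close> in the twisted algebra form a
  normal subgroup of \<open>T\<close>, which by minimality is \<open>N\<close> or \<open>M\<close>.
  In the solvable case each chief factor is a q-group for its own prime q, and the comparison of
  kernels still separates characters that belong to different primes.\<close>

lemma (in group_action) p_group_fixed_points:
  assumes p: "Factorial_Ring.prime p" and o: "Coset.order G = p ^ k"
    and "finite F" "F \<subseteq> E" "\<And>g x. g \<in> carrier G \<Longrightarrow> x \<in> F \<Longrightarrow> \<phi> g x \<in> F"
  shows "[card {x\<in>F. \<forall>g\<in>carrier G. \<phi> g x = x} = card F] (mod p)"
  using assms(3-)
proof (induction rule: finite_psubset_induct)
  case (psubset F)
  show ?case
  proof (cases "\<forall>x\<in>F. \<forall>g\<in>carrier G. \<phi> g x = x")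
    case True
    then have "{x\<in>F. \<forall>g\<in>carrier G. \<phi> g x = x} = F" by auto
    then show ?thesis by simp
  next
    case False
    then obtain x where x: "x \<in> F" "\<not> (\<forall>g\<in>carrier G. \<phi> g x = x)" by auto
    then have xE: "x \<in> E" using psubset by auto
    let ?O = "orbit G \<phi> x"
    have OF: "?O \<subseteq> F" using psubset(4) x(1) by (auto simp: orbit_def)
    have xO: "x \<in> ?O" using orbit_refl xE by blast
    have fin: "finite ?O" using OF psubset(1) finite_subset by blast
    \<comment> \<open>The orbit is not a single point and its size divides \<open>p ^ k\<close>, so
      that removing it changes neither the fixed points nor \<open>card F\<close> modulo p.\<close>
    have "card ?O dvd p ^ k"
      using orbit_stabilizer_theorem[OF xE] o by (metis dvd_triv_left)
    moreover have "card ?O \<noteq> 1"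
    proof
      assume "card ?O = 1"
      then have "?O = {x}" using xO by (metis card_1_singletonE singletonD)
      then show False using x(2) by (auto simp: orbit_def)
    qed
    ultimately have pO: "p dvd card ?O"
      using p by (metis divides_primepow_nat dvd_power gr0I power_0)
    have "?O \<noteq> {}" using xO by auto
    have inv: "\<phi> g y \<in> F - ?O" if "g \<in> carrier G" "y \<in> F - ?O" for g y
    proof -
      have yE: "y \<in> E" "\<phi> g y \<in> E" using that psubset(3) psubset(4) by auto
      have "\<phi> g y \<notin> ?O"
      proof
        assume a: "\<phi> g y \<in> ?O"
        have "\<phi> g y \<in> orbit G \<phi> y" using that by (auto simp: orbit_def)
        then have "y \<in> orbit G \<phi> (\<phi> g y)" using orbit_sym[of y "\<phi> g y"] yE by auto
        then have "y \<in> ?O" using orbit_trans[of x "\<phi> g y" y] a yE xE by auto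
        then show False using that by simp
      qed
      then show ?thesis using psubset(4) that by auto
    qed
    have IH: "[card {y\<in>F - ?O. \<forall>g\<in>carrier G. \<phi> g y = y} = card (F - ?O)] (mod p)"
      using psubset(2)[of "F - ?O"] xO x(1) psubset(3) inv by blast
    have "{y\<in>F. \<forall>g\<in>carrier G. \<phi> g y = y} = {y\<in>F - ?O. \<forall>g\<in>carrier G. \<phi> g y = y}"
    proof -
      have "\<not> (\<forall>g\<in>carrier G. \<phi> g y = y)" if "y \<in> ?O" for y
      proof
        assume a: "\<forall>g\<in>carrier G. \<phi> g y = y"
        have "x \<in> orbit G \<phi> y"
          using orbit_sym[of x y] that xE OF psubset(3) by auto
        then have "x = y" using a by (auto simp: orbit_def)
        then show False using a x(2) by auto
      qed
      then show ?thesis by auto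
    qed
    moreover have "card F = card (F - ?O) + card ?O"
      using OF fin psubset(1) by (simp add: card_Diff_subset card_mono)
    moreover obtain c where "card ?O = p * c" using pO by blast
    ultimately show ?thesis using IH unfolding cong_def by simp
  qed
qed

lemma (in group_action) p_group_second_fixed_point:
  assumes p: "Factorial_Ring.prime p" and o: "Coset.order G = p ^ k"
    and F: "finite F" "F \<subseteq> E" "\<And>g x. g \<in> carrier G \<Longrightarrow> x \<in> F \<Longrightarrow> \<phi> g x \<in> F"
    and d: "p dvd card F" and x0: "x0 \<in> F" "\<And>g. g \<in> carrier G \<Longrightarrow> \<phi> g x0 = x0"
  shows "\<exists>x\<in>F. x \<noteq> x0 \<and> (\<forall>g\<in>carrier G. \<phi> g x = x)"
proof (rule ccontr)
  assume "\<not> ?thesis"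
  then have "{x\<in>F. \<forall>g\<in>carrier G. \<phi> g x = x} = {x0}" using x0 by auto
  then have "[1 = card F] (mod p)"
    using p_group_fixed_points[OF p o F] by simp
  then have "[0 = 1] (mod p)" using d by (metis cong_0_iff cong_sym cong_trans)
  then show False using p by (simp add: cong_def prime_nat_iff)
qed

section \<open>Relative normal subgroups, indices and exponents of sections\<close>

context group
begin

text \<open>The sections T / N vary during the induction. Stating normality inside one ambient group
  keeps all products and inverses in \<open>G\<close>; quotient groups appear only inside a few
  proofs.\<close>

definition normal_in :: "'a set \<Rightarrow> 'a set \<Rightarrow> bool" where
  "normal_in N T \<longleftrightarrow> subgroup N G \<and> subgroup T G \<and> N \<subseteq> T \<and>
     (\<forall>t\<in>T. \<forall>n\<in>N. t \<otimes> n \<otimes> inv t \<in> N)"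

lemma normal_inD:
  assumes "normal_in N T"
  shows "subgroup N G" "subgroup T G" "N \<subseteq> T" "\<And>t n. t \<in> T \<Longrightarrow> n \<in> N \<Longrightarrow> t \<otimes> n \<otimes> inv t \<in> N"
  using assms by (auto simp: normal_in_def)

lemma normal_in_iff_normal:
  "normal_in N T \<longleftrightarrow> subgroup T G \<and> N \<lhd> (G\<lparr>carrier := T\<rparr>)"
proof
  assume a: "normal_in N T"
  note d = normal_inD[OF a]
  interpret T: group "G\<lparr>carrier := T\<rparr>" using d(2) by (rule subgroup_imp_group)
  have "subgroup N (G\<lparr>carrier := T\<rparr>)"
    by (rule subgroup_incl[OF d(1,2,3)])
  then show "subgroup T G \<and> N \<lhd> (G\<lparr>carrier := T\<rparr>)"
    using d by (auto simp: T.normal_inv_iff m_inv_consistent)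
next
  assume a: "subgroup T G \<and> N \<lhd> (G\<lparr>carrier := T\<rparr>)"
  interpret T: group "G\<lparr>carrier := T\<rparr>" using a by (auto intro: subgroup_imp_group)
  have s: "subgroup N (G\<lparr>carrier := T\<rparr>)" using a by (simp add: normal_imp_subgroup)
  then have "subgroup N G" using a incl_subgroup by blast
  moreover have "N \<subseteq> T" using subgroup.subset[OF s] by simp
  ultimately show "normal_in N T"
    using a by (auto simp: normal_in_def T.normal_inv_iff m_inv_consistent)
qed

lemma normal_in_mono: "normal_in N T \<Longrightarrow> subgroup M G \<Longrightarrow> N \<subseteq> M \<Longrightarrow> M \<subseteq> T \<Longrightarrow> normal_in N M"
  unfolding normal_in_def by blast

lemma normal_in_carrier_iff: "normal_in N (carrier G) \<longleftrightarrow> N \<lhd> G"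
proof -
  have eq: "G\<lparr>carrier := carrier G\<rparr> = G" by simp
  show ?thesis unfolding normal_in_iff_normal eq using subgroup_self by blast
qed

lemma inv_cancel:
  assumes "g \<in> carrier G" "z \<in> carrier G" shows "g \<otimes> (inv g \<otimes> z) = z" "inv g \<otimes> (g \<otimes> z) = z"
proof -
  have "g \<otimes> (inv g \<otimes> z) = g \<otimes> inv g \<otimes> z" using m_assoc[of g "inv g" z] assms by (simp only: inv_closed)
  then show "g \<otimes> (inv g \<otimes> z) = z" using assms by (simp only: r_inv l_one)
  have "inv g \<otimes> (g \<otimes> z) = inv g \<otimes> g \<otimes> z" using m_assoc[of "inv g" g z] assms by (simp only: inv_closed)
  then show "inv g \<otimes> (g \<otimes> z) = z" using assms by (simp only: l_inv l_one)
qed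

lemma card_rcosets_mult:
  assumes "normal_in N M" "finite M"
  shows "card (rcosets\<^bsub>G\<lparr>carrier := M\<rparr>\<^esub> N) * card N = card M"
proof -
  interpret M: group "G\<lparr>carrier := M\<rparr>" by (rule subgroup_imp_group[OF normal_inD(2)[OF assms(1)]])
  have "subgroup N (G\<lparr>carrier := M\<rparr>)" 
    by (rule subgroup_incl[OF normal_inD(1,2,3)[OF assms(1)]])
  then show ?thesis using M.lagrange by (simp add: Coset.order_def)
qed

lemma normal_in_card_dvd:
  assumes "normal_in N M" "finite M"
  shows "card N dvd card M"
  using card_rcosets_mult[OF assms] by (metis dvd_triv_right)

lemma r_coset_in_sub: "N #>\<^bsub>G\<lparr>carrier := M\<rparr>\<^esub> x = N #> x"
  by (simp add: r_coset_def)

lemma normal_in_quot_pow: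
  assumes "normal_in N M" "x \<in> M"
  shows "(N #> x) [^]\<^bsub>G\<lparr>carrier := M\<rparr> Mod N\<^esub> (k::nat) = N #> (x [^] k)"
proof -
  interpret M: group "G\<lparr>carrier := M\<rparr>" by (rule subgroup_imp_group[OF normal_inD(2)[OF assms(1)]])
  interpret N: normal N "G\<lparr>carrier := M\<rparr>" using assms normal_in_iff_normal by blast
  have "(N #>\<^bsub>G\<lparr>carrier := M\<rparr>\<^esub> x) [^]\<^bsub>G\<lparr>carrier := M\<rparr> Mod N\<^esub> k
     = N #>\<^bsub>G\<lparr>carrier := M\<rparr>\<^esub> (x [^]\<^bsub>G\<lparr>carrier := M\<rparr>\<^esub> k)"
  proof (induction k)
    case 0
    then show ?case using subgroup.subset[OF normal_inD(1)[OF assms(1)]]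
      by (simp add: FactGroup_def coset_mult_one)
  next
    case (Suc k)
    then show ?case using assms(2) M.nat_pow_closed[of x k]
      using N.rcos_sum[of "x [^]\<^bsub>G\<lparr>carrier := M\<rparr>\<^esub> k" x]
      by (simp add: FactGroup_def r_coset_in_sub set_mult_def)
  qed
  then show ?thesis by (simp add: r_coset_in_sub nat_pow_consistent[symmetric])
qed

lemma coset_eq_self_iff:
  assumes "subgroup N G" "x \<in> carrier G"
  shows "N #> x = N \<longleftrightarrow> x \<in> N"
  using assms coset_join1 coset_join2 subgroup.subset
  by (metis subgroup.rcos_const is_group)

lemma normal_in_pow_index:
  assumes nm: "normal_in N M" and fin: "finite M" and c: "card M = r * card N" and x: "x \<in> M"
  shows "x [^] r \<in> N"
proof -
  interpret M: group "G\<lparr>carrier := M\<rparr>" by (rule subgroup_imp_group[OF normal_inD(2)[OF nm]])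
  interpret N: normal N "G\<lparr>carrier := M\<rparr>" using nm normal_in_iff_normal by blast
  interpret Q: group "G\<lparr>carrier := M\<rparr> Mod N" by (rule N.factorgroup_is_group)
  have N0: "card N > 0" using nm fin normal_inD(1,3)[OF nm] subgroup.one_closed finite_subset
    by (metis card_gt_0_iff empty_iff)
  have "Coset.order (G\<lparr>carrier := M\<rparr> Mod N) = r"
    using card_rcosets_mult[OF nm fin] c N0 by (simp add: Coset.order_def FactGroup_def)
  moreover have xQ: "N #> x \<in> carrier (G\<lparr>carrier := M\<rparr> Mod N)"
    using x by (auto simp: FactGroup_def RCOSETS_def r_coset_def)
  ultimately have "(N #> x) [^]\<^bsub>G\<lparr>carrier := M\<rparr> Mod N\<^esub> r = \<one>\<^bsub>G\<lparr>carrier := M\<rparr> Mod N\<^esub>"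
    using Q.pow_order_eq_1 by blast
  then have "N #> (x [^] r) = N"
    using normal_in_quot_pow[OF nm x] by (simp add: FactGroup_def)
  then show ?thesis
    using coset_eq_self_iff normal_inD[OF nm] x subgroup.mem_carrier nat_pow_closed by metis
qed

text \<open>Cauchy's theorem for M / N, obtained from Sylow's theorem with exponent 1 and read back
  in \<open>G\<close>.\<close>

lemma normal_in_cauchy:
  assumes nm: "normal_in N M" and fin: "finite M" and q: "Factorial_Ring.prime q"
    and d: "q * card N dvd card M"
  shows "\<exists>x\<in>M - N. x [^] q \<in> N"
proof -
  interpret M: group "G\<lparr>carrier := M\<rparr>" by (rule subgroup_imp_group[OF normal_inD(2)[OF nm]])
  interpret N: normal N "G\<lparr>carrier := M\<rparr>" using nm normal_in_iff_normal by blast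
  let ?Q = "G\<lparr>carrier := M\<rparr> Mod N"
  interpret Q: group ?Q by (rule N.factorgroup_is_group)
  have N0: "card N > 0" using nm fin normal_inD(1,3)[OF nm] subgroup.one_closed finite_subset
    by (metis card_gt_0_iff empty_iff)
  have oQ: "Coset.order ?Q * card N = card M"
    using card_rcosets_mult[OF nm fin] by (simp add: Coset.order_def FactGroup_def)
  then have "q dvd Coset.order ?Q" using d N0 by (metis nat_mult_dvd_cancel1 mult.commute)
  then obtain m where m: "Coset.order ?Q = q ^ 1 * m" by auto
  have "Coset.order ?Q > 0" using oQ fin N0 normal_inD[OF nm]
    by (metis card_gt_0_iff empty_iff gr0I mult_zero_left subgroup.one_closed)
  then have "finite (carrier ?Q)" using Q.order_gt_0_iff_finite by blast
  then obtain H where H: "subgroup H ?Q" "card H = q ^ 1"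
    using sylow_thm[OF q Q.group_axioms m] by blast
  have "card H > 1" using H q prime_gt_1_nat by simp
  then have "\<not> H \<subseteq> {\<one>\<^bsub>?Q\<^esub>}"
    using card_mono[of "{\<one>\<^bsub>?Q\<^esub>}" H] by auto
  then obtain X where X: "X \<in> H" "X \<noteq> \<one>\<^bsub>?Q\<^esub>" by blast
  have XQ: "X \<in> carrier ?Q" using X H(1) by (simp add: subgroup.mem_carrier)
  then obtain x where x: "x \<in> M" "X = N #> x"
    by (auto simp: FactGroup_def RCOSETS_def r_coset_def)
  have xc: "x \<in> carrier G" using x normal_inD[OF nm] subgroup.mem_carrier by metis
  interpret HQ: group "?Q\<lparr>carrier := H\<rparr>" by (rule Q.subgroup_imp_group[OF H(1)])
  have "X [^]\<^bsub>?Q\<lparr>carrier := H\<rparr>\<^esub> q = \<one>\<^bsub>?Q\<^esub>"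
    using HQ.pow_order_eq_1[of X] X(1) H(2) by (simp add: Coset.order_def)
  then have "X [^]\<^bsub>?Q\<^esub> q = \<one>\<^bsub>?Q\<^esub>" using Q.nat_pow_consistent by simp
  then have "N #> (x [^] q) = N"
    using normal_in_quot_pow[OF nm x(1)] x(2) by (simp add: FactGroup_def)
  then have "x [^] q \<in> N" using coset_eq_self_iff normal_inD[OF nm] xc nat_pow_closed by metis
  moreover have "x \<notin> N"
    using X(2) x(2) coset_eq_self_iff[of N x] normal_inD[OF nm] xc by (auto simp: FactGroup_def)
  ultimately show ?thesis using x by blast
qed

lemma pow_coprime_mem:
  assumes H: "subgroup H G" and x: "x \<in> carrier G" and "x [^] (a::nat) \<in> H" "x [^] (b::nat) \<in> H" "coprime a b"
  shows "x \<in> H"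
proof -
  obtain u v :: int where uv: "u * int a + v * int b = 1"
    using bezout_int[of "int a" "int b"] assms(5) by auto
  have *: "(x [^] (n::nat)) [^] (i::int) = x [^] (i * int n)" for n i
    using x int_pow_pow[of x "int n" i] by (simp add: int_pow_int mult.commute)
  have "x = x [^] (u * int a + v * int b)" using uv x by simp
  also have "\<dots> = (x [^] a) [^] u \<otimes> (x [^] b) [^] v"
    using x by (simp add: * int_pow_mult)
  also have "\<dots> \<in> H"
    by (intro subgroup.m_closed[OF H] subgroup_int_pow_closed[OF H] assms)
  finally show ?thesis .
qed

text \<open>If another prime q divided the index, Cauchy's theorem would give an element outside
  \<open>N\<close> whose q-th power and some p-power power lie in \<open>N\<close>; Bezout then puts
  the element itself into \<open>N\<close>.\<close>

lemma card_p_power_index: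
  assumes nm: "normal_in N M" and fin: "finite M" and p: "Factorial_Ring.prime p"
    and el: "\<And>x. x \<in> M \<Longrightarrow> \<exists>k. x [^] (p ^ k :: nat) \<in> N"
  shows "\<exists>k. card M = p ^ k * card N"
proof -
  have sub: "subgroup N G" using nm normal_inD by blast
  obtain r where r: "card M = r * card N"
    using normal_in_card_dvd[OF nm fin] by (metis dvdE mult.commute)
  have M0: "card M > 0"
    by (metis card_gt_0_iff empty_iff fin normal_inD(2)[OF nm] subgroup.one_closed)
  then have r0: "r \<noteq> 0" using r by auto
  have "q = p" if q: "Factorial_Ring.prime q" "q dvd r" for q
  proof (rule ccontr)
    assume ne: "q \<noteq> p"
    obtain x where x: "x \<in> M" "x \<notin> N" "x [^] q \<in> N"
      using normal_in_cauchy[OF nm fin q(1)] r q by (auto simp: mult_dvd_mono)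
    have xc: "x \<in> carrier G" using x normal_inD[OF nm] subgroup.mem_carrier by metis
    obtain k where "x [^] (p ^ k :: nat) \<in> N" using el x by blast
    moreover have "coprime q (p ^ k)" using q(1) p ne by (simp add: primes_coprime)
    ultimately have "x \<in> N" using pow_coprime_mem[OF sub xc x(3)] by blast
    then show False using x by simp
  qed
  moreover have "\<not> is_unit p" using p not_prime_unit by blast
  then obtain s where s: "r = p ^ multiplicity p r * s" "\<not> p dvd s"
    using multiplicity_decompose'[OF r0] by blast
  ultimately have "s = 1"
    by (metis dvd_mult dvd_refl dvd_trans prime_factor_nat)
  then show ?thesis using r s by (metis mult_1_right)
qed

lemma pow_mem_cong:
  assumes nm: "normal_in N T" and x: "x \<in> T" and n: "n \<in> N"
  shows "(n \<otimes> x) [^] (m::nat) \<in> N \<longleftrightarrow> x [^] m \<in> N"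
proof -
  note d = normal_inD[OF nm]
  have c: "x \<in> carrier G" "n \<in> carrier G" "n \<otimes> x \<in> T"
    using d x n by (auto simp: subgroup.mem_carrier subgroup.m_closed subsetD)
  have eq: "N #> (n \<otimes> x) = N #> x"
    using c n d(1) by (metis coset_mult_assoc rcos_self subgroup.rcos_const subgroup.subset is_group)
  have "N #> ((n \<otimes> x) [^] m) = N #> (x [^] m)"
    using normal_in_quot_pow[OF nm c(3), of m] normal_in_quot_pow[OF nm x, of m] eq by simp
  then show ?thesis
    using coset_eq_self_iff[OF d(1)] c nat_pow_closed m_closed by metis
qed

lemma normal_in_set_mult:
  assumes N: "normal_in N T" and D: "normal_in D T"
  shows "normal_in (N <#> D) T"
proof -
  interpret T: group "G\<lparr>carrier := T\<rparr>" by (rule subgroup_imp_group[OF normal_inD(2)[OF N]])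
  have "N <#>\<^bsub>G\<lparr>carrier := T\<rparr>\<^esub> D \<lhd> G\<lparr>carrier := T\<rparr>"
    using N D unfolding normal_in_iff_normal by (intro T.normal_subgroup_set_mult_closed) auto
  then show ?thesis using N D by (simp add: normal_in_iff_normal set_mult_def)
qed

lemma set_mult_superset:
  assumes "subgroup N G" "subgroup D G"
  shows "N \<subseteq> N <#> D" "D \<subseteq> N <#> D"
  using assms subgroup.one_closed subgroup.mem_carrier
  by (force simp: set_mult_def)+

text \<open>Here \<open>m\<close> is an exponent and not the index. For the product
  \<open>N <#> D\<close> below, it is the exponent that is easy to control.\<close>

lemma index_type:
  assumes nm: "normal_in N M" and fin: "finite M" and p: "Factorial_Ring.prime p"
    and el: "\<And>y. y \<in> M \<Longrightarrow> y [^] (m::nat) \<in> N" and m: "m = p ^ l \<or> coprime p m"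
  shows "\<exists>r. card M = r * card N \<and> ((\<exists>k. r = p ^ k) \<or> coprime p r)"
  using m
proof
  assume "m = p ^ l"
  then show ?thesis using card_p_power_index[OF nm fin p] el by blast
next
  assume c: "coprime p m"
  obtain r where r: "card M = r * card N"
    using normal_in_card_dvd[OF nm fin] by (metis dvdE mult.commute)
  have "\<not> p dvd r"
  proof
    assume "p dvd r"
    then obtain x where x: "x \<in> M" "x \<notin> N" "x [^] p \<in> N"
      using normal_in_cauchy[OF nm fin p] r by (auto simp: mult_dvd_mono)
    have "x \<in> N"
      using pow_coprime_mem[OF normal_inD(1)[OF nm] _ x(3) el[OF x(1)] c] x(1) normal_inD(2)[OF nm]
      by (simp add: subgroup.mem_carrier)
    then show False using x by simp
  qed
  then have "coprime p r" using p by (simp add: prime_imp_coprime)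
  then show ?thesis using r by blast
qed

lemma normal_in_Int:
  assumes "subgroup T G" "D \<lhd> G"
  shows "normal_in (T \<inter> D) T"
proof -
  have "subgroup D G" using assms by (simp add: normal_imp_subgroup)
  then have "subgroup (T \<inter> D) G" using assms(1) subgroups_Inter_pair by blast
  moreover have "t \<otimes> x \<otimes> inv t \<in> T \<inter> D" if "t \<in> T" "x \<in> T \<inter> D" for t x
    using that assms normal_inv_iff[of D] subgroup.m_closed subgroup.m_inv_closed
    by (auto simp: subgroup.mem_carrier intro!: subgroup.m_closed subgroup.m_inv_closed)
  ultimately show ?thesis using assms by (auto simp: normal_in_def)
qed

text \<open>Let i be least such that \<open>T \<inter> Ns ! i\<close> is not contained in
  \<open>N\<close>. The preceding term meets \<open>T\<close> inside \<open>N\<close>, so the index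
  of consecutive terms is an exponent of \<open>D = T \<inter> Ns ! i\<close> modulo
  \<open>N\<close>, and \<open>M = N <#> D\<close> inherits its type.\<close>

lemma p_solvable_step:
  assumes fin: "finite (carrier G)" and p: "Factorial_Ring.prime p" and ps: "p_solvable p G"
    and nm: "normal_in N T" and ne: "N \<noteq> T"
  shows "\<exists>M. normal_in M T \<and> N \<subset> M \<and> (\<exists>r. card M = r * card N \<and> ((\<exists>k. r = p ^ k) \<or> coprime p r))"
proof -
  note d = normal_inD[OF nm]
  obtain Ns where Ns: "normal_series G Ns"
    "\<And>i. Suc i < length Ns \<Longrightarrow> p_group p (factor_group G (Ns ! Suc i) (Ns ! i)) \<or>
          p'_group p (factor_group G (Ns ! Suc i) (Ns ! i))"
    using ps by (auto simp: p_solvable_def)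
  have l: "length Ns > 0" using Ns(1) by (simp add: normal_series_def)
  have TG: "T \<subseteq> carrier G" using d(2) subgroup.subset by blast
  have last: "Ns ! (length Ns - 1) = carrier G"
    using Ns(1) l unfolding normal_series_def by (metis last_conv_nth)
  have ex: "length Ns - 1 < length Ns \<and> \<not> T \<inter> Ns ! (length Ns - 1) \<subseteq> N"
    using TG last d ne l by auto
  define i where "i = (LEAST i. i < length Ns \<and> \<not> T \<inter> Ns ! i \<subseteq> N)"
  have i: "i < length Ns" "\<not> T \<inter> Ns ! i \<subseteq> N"
    using LeastI[of "\<lambda>i. i < length Ns \<and> \<not> T \<inter> Ns ! i \<subseteq> N", OF ex] by (auto simp: i_def)
  have "Ns ! 0 = {\<one>}" using Ns(1) l unfolding normal_series_def by (metis hd_conv_nth)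
  then have "T \<inter> Ns ! 0 \<subseteq> N" using d(1) subgroup.one_closed by auto
  then obtain j where j: "i = Suc j" using i by (cases i) auto
  have Tj: "T \<inter> Ns ! j \<subseteq> N"
    using not_less_Least[of j "\<lambda>i. i < length Ns \<and> \<not> T \<inter> Ns ! i \<subseteq> N"] i j
    by (auto simp: i_def[symmetric])
  have Nn: "Ns ! i \<lhd> G" "Ns ! j \<lhd> G" "Ns ! j \<subseteq> Ns ! i"
    using Ns(1) i j by (auto simp: normal_series_def)
  have nji: "normal_in (Ns ! j) (Ns ! i)"
    using Nn by (metis normal_in_carrier_iff normal_in_mono normal_imp_subgroup subgroup.subset)
  have fi: "finite (Ns ! i)"
    using Nn fin by (meson finite_subset normal_imp_subgroup subgroup.subset)
  define m where "m = card (rcosets\<^bsub>G\<lparr>carrier := Ns ! i\<rparr>\<^esub> (Ns ! j))"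
  have om: "Coset.order (factor_group G (Ns ! i) (Ns ! j)) = m"
    by (simp add: Coset.order_def factor_group_def FactGroup_def m_def)
  have cm: "card (Ns ! i) = m * card (Ns ! j)"
    using card_rcosets_mult[OF nji fi] by (simp add: m_def)
  have "(\<exists>l. m = p ^ l) \<or> coprime p m"
    using Ns(2)[of j] i j om p by (auto simp: p_group_def p'_group_def prime_imp_coprime)
  then obtain l where ml: "m = p ^ l \<or> coprime p m" by blast
  define D where "D = T \<inter> Ns ! i"
  have D: "normal_in D T" unfolding D_def using d(2) Nn(1) by (rule normal_in_Int)
  have Dm: "x [^] m \<in> N" if "x \<in> D" for x
  proof -
    have "x [^] m \<in> Ns ! j" using normal_in_pow_index[OF nji fi cm] that by (simp add: D_def)
    moreover have "x [^] m \<in> T" using that subgroup_int_pow_closed[OF d(2), of x "int m"]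
      by (simp add: D_def int_pow_int)
    ultimately show ?thesis using Tj by blast
  qed
  define M where "M = N <#> D"
  have M: "normal_in M T" unfolding M_def by (rule normal_in_set_mult[OF nm D])
  have sup: "N \<subseteq> M" "D \<subseteq> M"
    using set_mult_superset[OF d(1) normal_inD(1)[OF D]] by (auto simp: M_def)
  have NM: "normal_in N M" using normal_in_mono[OF nm normal_inD(1)[OF M] sup(1)] normal_inD(3)[OF M] by blast
  have "y [^] m \<in> N" if y: "y \<in> M" for y
  proof -
    obtain n x where nx: "y = n \<otimes> x" "n \<in> N" "x \<in> D" using y unfolding M_def set_mult_def by blast
    then show ?thesis using pow_mem_cong[OF nm _ nx(2), of x m] Dm normal_inD(3)[OF D] by auto
  qed
  moreover have "finite M" using finite_subset[OF normal_inD(3)[OF M]] finite_subset[OF TG fin] by simp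
  ultimately have "\<exists>r. card M = r * card N \<and> ((\<exists>k. r = p ^ k) \<or> coprime p r)"
    using index_type[OF NM _ p _ ml] by blast
  moreover have "N \<noteq> M" using i sup(2) by (auto simp: D_def)
  ultimately show ?thesis using M sup by blast
qed

text \<open>A nontrivial p-group acts on itself by conjugation; the identity is fixed, hence so is a
  second element, which is central in M / N.\<close>

lemma normal_in_center:
  assumes nm: "normal_in N M" and fin: "finite M" and p: "Factorial_Ring.prime p"
    and c: "card M = p ^ k * card N" and ne: "N \<noteq> M"
  shows "\<exists>x\<in>M - N. \<forall>h\<in>M. h \<otimes> x \<otimes> inv h \<otimes> inv x \<in> N"
proof -
  note d = normal_inD[OF nm]
  interpret M: group "G\<lparr>carrier := M\<rparr>" by (rule subgroup_imp_group[OF normal_inD(2)[OF nm]])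
  interpret N: normal N "G\<lparr>carrier := M\<rparr>" using nm normal_in_iff_normal by blast
  let ?Q = "G\<lparr>carrier := M\<rparr> Mod N"
  interpret Q: group ?Q by (rule N.factorgroup_is_group)
  have mult: "(N #> x) \<otimes>\<^bsub>?Q\<^esub> (N #> y) = N #> (x \<otimes> y)" if "x \<in> M" "y \<in> M" for x y
    using N.rcos_sum[of x y] that by (simp add: FactGroup_def r_coset_in_sub set_mult_def)
  have N0: "card N > 0" using nm fin normal_inD(1,3)[OF nm] subgroup.one_closed finite_subset
    by (metis card_gt_0_iff empty_iff)
  have o: "Coset.order ?Q = p ^ k"
    using card_rcosets_mult[OF nm fin] c N0 by (simp add: Coset.order_def FactGroup_def)
  have k: "k \<noteq> 0"
  proof
    assume "k = 0"
    then have "card M = card N" using c by simp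
    then show False using ne card_subset_eq[OF fin d(3)] by simp
  qed
  have fQ: "finite (carrier ?Q)"
    using o p Q.order_gt_0_iff_finite by (metis prime_gt_0_nat zero_less_power)
  interpret A: group_action ?Q "carrier ?Q" "\<lambda>g. \<lambda>h\<in>carrier ?Q. g \<otimes>\<^bsub>?Q\<^esub> h \<otimes>\<^bsub>?Q\<^esub> inv\<^bsub>?Q\<^esub> g"
    by (rule Q.action_by_conjugation)
  \<comment> \<open>The name keeps the quotient opaque, so that the simplifier uses its group laws
    instead of unfolding cosets.\<close>
  define Q where "Q = ?Q"
  have gQ: "group Q" using Q.group_axioms by (simp add: Q_def)
  have "p dvd card (carrier ?Q)" using o k by (simp add: Coset.order_def)
  then have "\<exists>X\<in>carrier ?Q. X \<noteq> \<one>\<^bsub>?Q\<^esub> \<and> (\<forall>g\<in>carrier ?Q. (\<lambda>h\<in>carrier ?Q. g \<otimes>\<^bsub>?Q\<^esub> h \<otimes>\<^bsub>?Q\<^esub> inv\<^bsub>?Q\<^esub> g) X = X)"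
    using A.p_group_second_fixed_point[OF p o fQ, of "\<one>\<^bsub>?Q\<^esub>"] gQ
    unfolding Q_def[symmetric] by (simp add: group.is_monoid group.inv_closed monoid.m_closed group.r_inv monoid.one_closed monoid.r_one)
  then obtain X where X: "X \<in> carrier ?Q" "X \<noteq> \<one>\<^bsub>?Q\<^esub>"
    "\<And>g. g \<in> carrier ?Q \<Longrightarrow> g \<otimes>\<^bsub>?Q\<^esub> X \<otimes>\<^bsub>?Q\<^esub> inv\<^bsub>?Q\<^esub> g = X"
    unfolding Q_def[symmetric] by auto
  obtain x where x: "x \<in> M" "X = N #> x"
    using X(1) by (auto simp: FactGroup_def RCOSETS_def r_coset_def)
  have xc: "x \<in> carrier G" using x d subgroup.mem_carrier by metis
  have "h \<otimes> x \<otimes> inv h \<otimes> inv x \<in> N" if h: "h \<in> M" for h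
  proof -
    have hc: "h \<in> carrier G" using h d subgroup.mem_carrier by metis
    have hQ: "N #> h \<in> carrier ?Q"
      using h by (auto simp: FactGroup_def RCOSETS_def r_coset_def)
    then have "(N #> h) \<otimes>\<^bsub>?Q\<^esub> X = X \<otimes>\<^bsub>?Q\<^esub> (N #> h)"
      using X(1) X(3)[OF hQ] by (metis Q.inv_solve_right Q.m_closed)
    then have "N #> (h \<otimes> x) = N #> (x \<otimes> h)" using mult x h by simp
    then have "(h \<otimes> x) \<otimes> inv (x \<otimes> h) \<in> N"
      using d(1) xc hc
      by (metis subgroup.rcos_module_imp is_group m_closed rcos_self)
    then show ?thesis using xc hc by (simp add: inv_mult_group m_assoc)
  qed
  moreover have "x \<notin> N"
    using X(2) x(2) coset_eq_self_iff[OF d(1) xc] by (auto simp: FactGroup_def)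
  ultimately show ?thesis using x by blast
qed

lemma conj_mult:
  "g \<in> carrier G \<Longrightarrow> x \<in> carrier G \<Longrightarrow> y \<in> carrier G \<Longrightarrow>
   g \<otimes> (x \<otimes> y) \<otimes> inv g = (g \<otimes> x \<otimes> inv g) \<otimes> (g \<otimes> y \<otimes> inv g)"
  by (simp add: m_assoc inv_solve_left)

lemma conj_nat_pow_mem:
  assumes t: "t \<in> carrier G" and C: "C \<subseteq> carrier G" and c: "\<And>c. c \<in> C \<Longrightarrow> t \<otimes> c \<otimes> inv t \<in> C"
    and x: "x \<in> C"
  shows "t [^] (k::nat) \<otimes> x \<otimes> inv (t [^] k) \<in> C"
  using x
proof (induction k arbitrary: x)
  case 0
  then show ?case using C by auto
next
  case (Suc k)
  have xc: "x \<in> carrier G" using Suc C by auto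
  have "t [^] Suc k \<otimes> x \<otimes> inv (t [^] Suc k) = t [^] k \<otimes> (t \<otimes> x \<otimes> inv t) \<otimes> inv (t [^] k)"
    using t xc by (simp add: m_assoc inv_mult_group)
  then show ?case using Suc c by simp
qed

text \<open>The cyclic p-group generated by \<open>t\<close> permutes the cosets of \<open>A\<close>
  in \<open>C\<close>, whose number is a positive power of p. It fixes \<open>A\<close>, hence
  another coset. The action is that on all subsets of the group, restricted to these cosets.\<close>

lemma p_element_fixes_coset:
  assumes finG: "finite (carrier G)" and nm: "normal_in A C" and p: "Factorial_Ring.prime p"
    and cC: "card C = p ^ j * card A" and ne: "A \<noteq> C"
    and t: "t \<in> carrier G" "t [^] (p ^ a :: nat) = \<one>"
    and tC: "\<And>c. c \<in> C \<Longrightarrow> t \<otimes> c \<otimes> inv t \<in> C" and tA: "\<And>c. c \<in> A \<Longrightarrow> t \<otimes> c \<otimes> inv t \<in> A"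
  shows "\<exists>x\<in>C - A. t \<otimes> x \<otimes> inv t \<otimes> inv x \<in> A"
proof -
  note d = normal_inD[OF nm]
  have sub: "A \<subseteq> carrier G" "C \<subseteq> carrier G" using subgroup.subset[OF d(1)] subgroup.subset[OF d(2)] by auto
  have fin: "finite C" "finite A" using sub finG finite_subset by auto
  let ?P = "generate G {t}"
  have P: "?P = {t [^] k | k. k \<in> (UNIV :: nat set)}"
    by (rule generate_pow_on_finite_carrier[OF finG t(1)])
  have sP: "subgroup ?P G" using generate_is_subgroup t by simp
  have gC: "g \<otimes> c \<otimes> inv g \<in> C" if "g \<in> ?P" "c \<in> C" for g c
    using that P conj_nat_pow_mem[OF t(1) sub(2) tC] by auto
  have gA: "g \<otimes> c \<otimes> inv g \<in> A" if "g \<in> ?P" "c \<in> A" for g c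
    using that P conj_nat_pow_mem[OF t(1) sub(1) tA] by auto
  define \<phi> where "\<phi> = (\<lambda>g. \<lambda>H \<in> {H. H \<subseteq> carrier G}. g <# H #> (inv g))"
  interpret G: group_action G "{H. H \<subseteq> carrier G}" \<phi>
    unfolding \<phi>_def by (rule action_by_conjugation_on_power_set)
  interpret A: group_action "G\<lparr>carrier := ?P\<rparr>" "{H. H \<subseteq> carrier G}" \<phi>
    by (rule G.induced_action[OF sP])
  have "card ?P = ord t" using generate_pow_card[OF t(1)] by simp
  moreover have "ord t dvd p ^ a" using t pow_eq_id by simp
  ultimately obtain b where o: "Coset.order (G\<lparr>carrier := ?P\<rparr>) = p ^ b"
    using p by (auto simp: Coset.order_def divides_primepow_nat)
  let ?F = "rcosets\<^bsub>G\<lparr>carrier := C\<rparr>\<^esub> A"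
  have F: "?F = (\<lambda>c. A #> c) ` C" by (auto simp: RCOSETS_def r_coset_def)
  have Fsub: "?F \<subseteq> {H. H \<subseteq> carrier G}" using sub by (auto simp: F r_coset_def)
  have phi: "\<phi> g (A #> c) = A #> (g \<otimes> c \<otimes> inv g)" if g: "g \<in> ?P" and c: "c \<in> C" for g c
  proof -
    have gc: "g \<in> carrier G" "c \<in> carrier G" using g c sub sP subgroup.mem_carrier by auto
    have ig: "inv g \<in> ?P" using g sP by (simp add: subgroup.m_inv_closed)
    have "A #> c \<subseteq> carrier G" using gc sub by (auto simp: r_coset_def)
    then have "\<phi> g (A #> c) = {g \<otimes> (x \<otimes> c) \<otimes> inv g | x. x \<in> A}"
      by (auto simp: \<phi>_def l_coset_def r_coset_def)
    also have "\<dots> = A #> (g \<otimes> c \<otimes> inv g)"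
    proof (intro equalityI subsetI)
      fix y assume "y \<in> {g \<otimes> (x \<otimes> c) \<otimes> inv g | x. x \<in> A}"
      then obtain x where x: "x \<in> A" "y = g \<otimes> (x \<otimes> c) \<otimes> inv g" by auto
      then have "y = (g \<otimes> x \<otimes> inv g) \<otimes> (g \<otimes> c \<otimes> inv g)"
        using conj_mult[of g x c] gc sub by auto
      then show "y \<in> A #> (g \<otimes> c \<otimes> inv g)" using gA[OF g x(1)] by (auto simp: r_coset_def)
    next
      fix y assume "y \<in> A #> (g \<otimes> c \<otimes> inv g)"
      then obtain x where x: "x \<in> A" "y = x \<otimes> (g \<otimes> c \<otimes> inv g)" by (auto simp: r_coset_def)
      define x' where "x' = inv g \<otimes> x \<otimes> g"
      have xc: "x \<in> carrier G" using x sub by auto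
      have x': "x' \<in> A" using gA[OF ig x(1)] gc by (simp add: x'_def)
      have "y = g \<otimes> (x' \<otimes> c) \<otimes> inv g"
        using gc xc by (simp add: x x'_def m_assoc inv_cancel)
      then show "y \<in> {g \<otimes> (x \<otimes> c) \<otimes> inv g | x. x \<in> A}" using x' by blast
    qed
    finally show ?thesis .
  qed
  have A0: "card A > 0" using fin d(1) subgroup.one_closed by (metis card_gt_0_iff empty_iff)
  have "j \<noteq> 0"
  proof
    assume "j = 0"
    then have "card A = card C" using cC by simp
    then show False using ne card_subset_eq[OF fin(1) d(3)] by simp
  qed
  have "card ?F * card A = p ^ j * card A" using card_rcosets_mult[OF nm fin(1)] cC by argo
  then have "card ?F = p ^ j" using A0 mult_right_cancel[of "card A" "card ?F"] by blast
  then have pd: "p dvd card ?F" using \<open>j \<noteq> 0\<close> by (metis dvd_power gr0I)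
  have A1: "A \<in> ?F"
    unfolding F using coset_mult_one[OF sub(1)] subgroup.one_closed[OF d(2)] by (metis image_eqI)
  have "\<exists>X\<in>?F. X \<noteq> A \<and> (\<forall>g\<in>carrier (G\<lparr>carrier := ?P\<rparr>). \<phi> g X = X)"
  proof (rule A.p_group_second_fixed_point[OF p o _ Fsub _ pd A1])
    show "finite ?F" using fin by (simp add: F)
    show "\<phi> g X \<in> ?F" if "g \<in> carrier (G\<lparr>carrier := ?P\<rparr>)" "X \<in> ?F" for g X
      using that phi gC by (auto simp: F)
    show "\<phi> g A = A" if "g \<in> carrier (G\<lparr>carrier := ?P\<rparr>)" for g
    proof -
      have gc: "g \<in> ?P" "g \<in> carrier G" using that sP subgroup.mem_carrier by auto
      have "\<phi> g (A #> \<one>) = A #> (g \<otimes> \<one> \<otimes> inv g)"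
        using phi[OF gc(1)] d subgroup.one_closed by blast
      then show ?thesis using gc coset_mult_one[OF sub(1)] by simp
    qed
  qed
  then obtain x where x: "x \<in> C" "A #> x \<noteq> A" "\<phi> t (A #> x) = A #> x"
    using generate.incl[of t "{t}" G] by (auto simp: F)
  have xc: "x \<in> carrier G" using x sub by auto
  have "t \<in> ?P" using generate.incl[of t "{t}" G] by simp
  then have "A #> (t \<otimes> x \<otimes> inv t) = A #> x" using phi x by simp
  then have "t \<otimes> x \<otimes> inv t \<otimes> inv x \<in> A"
    using d(1) xc t(1)
    by (metis subgroup.rcos_module_imp is_group m_closed inv_closed rcos_self)
  moreover have "x \<notin> A" using x(2) coset_eq_self_iff[OF d(1) xc] by auto
  ultimately show ?thesis using x by blast
qed

text \<open>Let i be least such that \<open>M\<close> meets the i-th derived subgroup inside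
  \<open>N\<close>. Multiplying \<open>N\<close> by the intersection of \<open>M\<close> with the
  preceding derived subgroup gives \<open>L\<close>.\<close>

lemma solvable_abelian_section:
  assumes sol: "solvable G" and M: "normal_in M T" and nm: "normal_in N T" and NM: "N \<subset> M"
  shows "\<exists>L. normal_in L T \<and> N \<subset> L \<and> L \<subseteq> M \<and> (\<forall>x\<in>L. \<forall>y\<in>L. x \<otimes> y \<otimes> inv x \<otimes> inv y \<in> N)"
proof -
  note d = normal_inD[OF nm] and dM = normal_inD[OF M]
  define D where "D = (\<lambda>i. (derived G ^^ i) (carrier G))"
  have Dn: "D i \<lhd> G" for i
    by (induction i) (auto simp: D_def normal_self derived_is_normal)
  obtain n where n: "D n = {\<one>}" using sol by (auto simp: D_def solvable_iff_trivial_derived_seq)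
  have Dc: "x \<otimes> y \<otimes> inv x \<otimes> inv y \<in> D (Suc i)" if "x \<in> D i" "y \<in> D i" for x y i
    using that by (auto simp: D_def derived_def intro!: generate.incl)
  have ex: "M \<inter> D n \<subseteq> N" using n d(1) subgroup.one_closed by auto
  define i where "i = (LEAST i. M \<inter> D i \<subseteq> N)"
  have i: "M \<inter> D i \<subseteq> N" using LeastI[of "\<lambda>i. M \<inter> D i \<subseteq> N", OF ex] by (simp add: i_def)
  have "D 0 = carrier G" by (simp add: D_def)
  then have "\<not> M \<inter> D 0 \<subseteq> N" using NM dM subgroup.subset by blast
  then obtain j where j: "i = Suc j" using i by (cases i) auto
  have Mj: "\<not> M \<inter> D j \<subseteq> N"
    using not_less_Least[of j "\<lambda>i. M \<inter> D i \<subseteq> N"] j by (auto simp: i_def[symmetric])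
  define E where "E = M \<inter> D j"
  have sDj: "subgroup (D j) G" using Dn normal_imp_subgroup by blast
  have "normal_in E T"
  proof -
    have "subgroup E G" using dM(1) sDj subgroups_Inter_pair by (simp add: E_def)
    moreover have "t \<otimes> x \<otimes> inv t \<in> E" if "t \<in> T" "x \<in> E" for t x
      using that dM(2,4) Dn[of j] by (auto simp: E_def normal_inv_iff subgroup.mem_carrier)
    ultimately show ?thesis using dM by (auto simp: normal_in_def E_def)
  qed
  define L where "L = N <#> E"
  have L: "normal_in L T" unfolding L_def by (rule normal_in_set_mult) fact+
  note sE = normal_inD(1)[OF \<open>normal_in E T\<close>]
  have sup: "N \<subseteq> L" "E \<subseteq> L" unfolding L_def using set_mult_superset[OF d(1) sE] by auto
  have NL: "normal_in N L" using normal_in_mono[OF nm normal_inD(1)[OF L] sup(1)] normal_inD(3)[OF L] by blast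
  interpret L: group "G\<lparr>carrier := L\<rparr>" by (rule subgroup_imp_group[OF normal_inD(1)[OF L]])
  interpret N: normal N "G\<lparr>carrier := L\<rparr>" using NL normal_in_iff_normal by blast
  have mult: "(N #> x) <#> (N #> y) = N #> (x \<otimes> y)" if "x \<in> L" "y \<in> L" for x y
    using N.rcos_sum[of x y] that by (simp add: r_coset_in_sub set_mult_def)
  have comm: "x \<otimes> y \<otimes> inv x \<otimes> inv y \<in> N" if xy: "x \<in> L" "y \<in> L" for x y
  proof -
    have Lc: "L \<subseteq> carrier G" using L normal_inD subgroup.subset by blast
    \<comment> \<open>Whether a commutator lies in \<open>N\<close> depends only on the cosets
      involved, so representatives may be taken in \<open>E\<close>, where the derived series
      controls commutators.\<close>
    have coset: "\<exists>e\<in>E. N #> x = N #> e" if x: "x \<in> L" for x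
    proof -
      obtain a e where ae: "x = a \<otimes> e" "a \<in> N" "e \<in> E"
        using x unfolding L_def set_mult_def by blast
      then have "e \<in> carrier G" "a \<in> carrier G"
        using subgroup.mem_carrier[OF sE] subgroup.mem_carrier[OF d(1)] by auto
      then have "N #> x = N #> e" using ae d(1)
        by (metis coset_mult_assoc subgroup.rcos_const subgroup.subset is_group)
      then show ?thesis using ae by blast
    qed
    obtain e f where ef: "e \<in> E" "f \<in> E" "N #> x = N #> e" "N #> y = N #> f"
      using coset xy by metis
    have c: "e \<in> carrier G" "f \<in> carrier G" "x \<in> carrier G" "y \<in> carrier G"
      using ef sE xy Lc subgroup.mem_carrier by auto
    have "e \<otimes> f \<otimes> inv e \<otimes> inv f \<in> M \<inter> D i"
    proof
      show "e \<otimes> f \<otimes> inv e \<otimes> inv f \<in> D i" using Dc[of e j f] ef j by (simp add: E_def)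
      show "e \<otimes> f \<otimes> inv e \<otimes> inv f \<in> M"
        using ef dM(1) by (simp add: E_def subgroup.m_closed subgroup.m_inv_closed)
    qed
    then have "(e \<otimes> f) \<otimes> inv (f \<otimes> e) \<in> N" using i c by (auto simp: inv_mult_group m_assoc)
    then have "N #> (e \<otimes> f) = N #> (f \<otimes> e)"
      using c d(1) by (metis coset_join2 coset_mult_inv1 m_closed inv_closed subgroup.subset)
    then have "N #> (x \<otimes> y) = N #> (y \<otimes> x)"
      using mult xy ef sup by (metis subsetD)
    then have "(x \<otimes> y) \<otimes> inv (y \<otimes> x) \<in> N"
      using d(1) c by (metis subgroup.rcos_module_imp is_group m_closed rcos_self)
    then show ?thesis using c by (simp add: inv_mult_group m_assoc)
  qed
  have "L \<subseteq> M"
    using NM unfolding L_def set_mult_def E_def by (auto intro: subgroup.m_closed[OF dM(1)])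
  moreover have "N \<noteq> L" using Mj sup by (auto simp: E_def)
  ultimately show ?thesis using L sup comm by blast
qed

end

section \<open>Twisted group algebras\<close>

definition p_roots :: "nat \<Rightarrow> complex set" where
  "p_roots p = {z. \<exists>a. z ^ (p ^ a) = 1}"

lemma p_roots_one [simp]: "1 \<in> p_roots p"
  by (simp add: p_roots_def)

lemma p_roots_nonzero: "p > 0 \<Longrightarrow> z \<in> p_roots p \<Longrightarrow> z \<noteq> 0"
  by (auto simp: p_roots_def power_0_left)

lemma p_roots_mult:
  assumes "x \<in> p_roots p" "y \<in> p_roots p" shows "x * y \<in> p_roots p"
proof -
  obtain a b where "x ^ (p ^ a) = 1" "y ^ (p ^ b) = 1" using assms by (auto simp: p_roots_def)
  then have "(x * y) ^ (p ^ (a + b)) = 1"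
    by (simp add: power_mult_distrib power_add power_mult)
       (metis mult.commute power_mult power_one)
  then show ?thesis unfolding p_roots_def by blast
qed

lemma p_roots_inverse: "x \<in> p_roots p \<Longrightarrow> inverse x \<in> p_roots p"
  by (auto simp: p_roots_def power_inverse)

lemma p_roots_divide: "x \<in> p_roots p \<Longrightarrow> y \<in> p_roots p \<Longrightarrow> x / y \<in> p_roots p"
  by (simp add: divide_inverse p_roots_mult p_roots_inverse)

lemma p_roots_power: "x \<in> p_roots p \<Longrightarrow> x ^ k \<in> p_roots p"
  by (induction k) (auto intro: p_roots_mult)

lemma p_roots_prod: "(\<And>i. i \<in> I \<Longrightarrow> f i \<in> p_roots p) \<Longrightarrow> prod f I \<in> p_roots p"
  by (induction I rule: infinite_finite_induct) (auto intro: p_roots_mult)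

lemma p_roots_root: "x ^ (p ^ k) \<in> p_roots p \<Longrightarrow> x \<in> p_roots p"
  by (auto simp: p_roots_def power_mult[symmetric] power_add[symmetric])

text \<open>One exponent common to all values of a cocycle is what allows an integer prime to p to
  be inverted on all of them at once.\<close>

lemma p_roots_finite_exponent:
  assumes "finite F" "F \<subseteq> p_roots p"
  shows "\<exists>a. \<forall>z\<in>F. z ^ (p ^ a) = 1"
  using assms
proof (induction F rule: finite_induct)
  case (insert x F)
  then obtain a b where "\<forall>z\<in>F. z ^ (p ^ a) = 1" "x ^ (p ^ b) = 1"
    by (auto simp: p_roots_def)
  then have "\<forall>z\<in>insert x F. z ^ (p ^ (a + b)) = 1"
    by (auto simp: power_add power_mult) (metis mult.commute power_mult power_one)
  then show ?case by blast
qed simp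

text \<open>The coefficient subring \<open>AK\<close> plays the role of a \<open>K\<close>-form of the complex algebra \<open>'r\<close>, and
  \<open>\<tau>\<close> that of the coefficient functional at the identity of a group algebra.\<close>

locale twisted_algebra = group G + vector_space scale
  for G :: "('g, 'm) monoid_scheme" (structure)
    and scale :: "complex \<Rightarrow> 'r::ring \<Rightarrow> 'r" (infixr \<open>*s\<close> 75) +
  fixes p :: nat and K :: "complex set" and AK :: "'r set" and \<tau> :: "'r \<Rightarrow> complex"
  assumes finite_carrier: "finite (carrier G)"
    and prime_p: "Factorial_Ring.prime p"
    and mult_scale_left [simp]: "(c *s x) * y = c *s (x * y)"
    and mult_scale_right [simp]: "x * (c *s y) = c *s (x * y)"
    and K_add: "a \<in> K \<Longrightarrow> b \<in> K \<Longrightarrow> a + b \<in> K"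
    and K_mult: "a \<in> K \<Longrightarrow> b \<in> K \<Longrightarrow> a * b \<in> K"
    and K_minus: "a \<in> K \<Longrightarrow> - a \<in> K"
    and K_inverse: "a \<in> K \<Longrightarrow> inverse a \<in> K"
    and K_p_roots: "p_roots p \<subseteq> K"
    and AK_add: "x \<in> AK \<Longrightarrow> y \<in> AK \<Longrightarrow> x + y \<in> AK"
    and AK_mult: "x \<in> AK \<Longrightarrow> y \<in> AK \<Longrightarrow> x * y \<in> AK"
    and AK_scale: "a \<in> K \<Longrightarrow> x \<in> AK \<Longrightarrow> a *s x \<in> AK"
    and AK_zero: "0 \<in> AK"
    and \<tau>_add: "\<tau> (x + y) = \<tau> x + \<tau> y"
    and \<tau>_scale [simp]: "\<tau> (c *s x) = c * \<tau> x"
    and \<tau>_K: "x \<in> AK \<Longrightarrow> \<tau> x \<in> K"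
begin

abbreviation "\<mu> \<equiv> p_roots p"

lemma p_pos: "p > 0" using prime_p prime_gt_0_nat by blast

lemma mu_nonzero: "z \<in> \<mu> \<Longrightarrow> z \<noteq> 0" using p_roots_nonzero p_pos by blast

lemma mu_K: "z \<in> \<mu> \<Longrightarrow> z \<in> K" using K_p_roots by blast

lemma K_one: "1 \<in> K" using mu_K by simp

lemma K_zero: "0 \<in> K" using K_add[OF K_one K_minus[OF K_one]] by simp

lemma K_of_nat: "of_nat n \<in> K" by (induction n) (auto intro: K_zero K_add K_one)

lemma K_divide: "a \<in> K \<Longrightarrow> b \<in> K \<Longrightarrow> a / b \<in> K"
  by (simp add: divide_inverse K_mult K_inverse)

lemma K_power: "a \<in> K \<Longrightarrow> a ^ n \<in> K" by (induction n) (auto intro: K_one K_mult)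

lemma K_sum: "(\<And>i. i \<in> I \<Longrightarrow> f i \<in> K) \<Longrightarrow> sum f I \<in> K"
  by (induction I rule: infinite_finite_induct) (auto intro: K_zero K_add)

lemma K_prod: "(\<And>i. i \<in> I \<Longrightarrow> f i \<in> K) \<Longrightarrow> prod f I \<in> K"
  by (induction I rule: infinite_finite_induct) (auto intro: K_one K_mult)

lemma AK_sum: "(\<And>i. i \<in> I \<Longrightarrow> f i \<in> AK) \<Longrightarrow> sum f I \<in> AK"
  by (induction I rule: infinite_finite_induct) (auto intro: AK_zero AK_add)

lemma \<tau>_zero [simp]: "\<tau> 0 = 0" using \<tau>_scale[of 0 0] by simp

lemma \<tau>_sum: "\<tau> (sum f I) = (\<Sum>i\<in>I. \<tau> (f i))"
  by (induction I rule: infinite_finite_induct) (auto simp: \<tau>_add)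

lemma span_mult:
  assumes S: "\<And>a b. a \<in> S \<Longrightarrow> b \<in> S \<Longrightarrow> a * b \<in> span S"
    and x: "x \<in> span S" and y: "y \<in> span S"
  shows "x * y \<in> span S"
  using x
proof (induction rule: span_induct_alt)
  case base
  then show ?case by (simp add: span_zero)
next
  case (step c a z)
  have "a * y \<in> span S"
    using y
  proof (induction rule: span_induct_alt)
    case base
    then show ?case by (simp add: span_zero)
  next
    case (step c b z')
    then show ?case using S \<open>a \<in> S\<close> by (auto simp: distrib_left intro!: span_add span_scale)
  qed
  then show ?case using step by (auto simp: distrib_right intro!: span_add span_scale)
qed

end

text \<open>A projective representation \<open>u\<close> of \<open>T / N\<close> in the corner \<open>f A f\<close> whose cocycle has values in the
  \<open>p\<close>-power roots of unity. By the condition on \<open>\<tau>\<close>, elements \<open>u t\<close> from distinct cosets of \<open>N\<close>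
  are linearly independent, so that \<open>u\<close> spans a twisted group algebra of \<open>T / N\<close>.\<close>

locale twisted_rep = twisted_algebra +
  fixes T N :: "'a set" and f :: 'c and u :: "'a \<Rightarrow> 'c"
  assumes NT: "normal_in N T"
    and ff [simp]: "f * f = f" and f_AK: "f \<in> AK" and \<tau>f: "\<tau> f \<noteq> 0"
    and u_AK: "t \<in> T \<Longrightarrow> u t \<in> AK"
    and fu [simp]: "t \<in> T \<Longrightarrow> f * u t = u t" and uf [simp]: "t \<in> T \<Longrightarrow> u t * f = u t"
    and uu: "s \<in> T \<Longrightarrow> t \<in> T \<Longrightarrow> \<exists>z\<in>\<mu>. u s * u t = z *s u (s \<otimes> t)"
    and uN: "n \<in> N \<Longrightarrow> \<exists>z\<in>\<mu>. u n = z *s f"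
    and \<tau>u: "t \<in> T \<Longrightarrow> t \<notin> N \<Longrightarrow> \<tau> (u t) = 0"
begin

lemma f_nonzero: "f \<noteq> 0" using \<tau>f by auto

lemmas sN = normal_inD(1)[OF NT] and sT = normal_inD(2)[OF NT] and N_sub_T = normal_inD(3)[OF NT]

lemma T_carrier: "t \<in> T \<Longrightarrow> t \<in> carrier G" using sT subgroup.mem_carrier by metis
lemma T_mult [simp]: "s \<in> T \<Longrightarrow> t \<in> T \<Longrightarrow> s \<otimes> t \<in> T" using sT subgroup.m_closed by metis
lemma T_inv [simp]: "t \<in> T \<Longrightarrow> inv t \<in> T" using sT subgroup.m_inv_closed by metis
lemma T_one [simp]: "\<one> \<in> T" using sT subgroup.one_closed by metis
lemma N_T: "n \<in> N \<Longrightarrow> n \<in> T" using N_sub_T by blast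
lemma T_pow [simp]: "t \<in> T \<Longrightarrow> t [^] (k::nat) \<in> T"
  by (induction k) auto

lemma finite_T: "finite T" using finite_subset[OF subgroup.subset[OF sT] finite_carrier] .

lemma fuN: "t \<in> T \<Longrightarrow> f * (u t * x) = u t * x" by (metis fu mult.assoc)
lemma ffx: "f * (f * x) = f * x" by (metis ff mult.assoc)
lemma ufx: "t \<in> T \<Longrightarrow> u t * (f * x) = u t * x" by (metis uf mult.assoc)

lemma inverse_exists:
  assumes t: "t \<in> T"
  shows "\<exists>x. x \<in> AK \<and> u t * x = f \<and> x * u t = f \<and> f * x = x \<and> x * f = x \<and>
    (\<exists>z\<in>\<mu>. x = z *s u (inv t))"
proof -
  have tc: "t \<in> carrier G" by (rule T_carrier[OF t])
  obtain z0 where z0: "z0 \<in> \<mu>" "u \<one> = z0 *s f" using uN subgroup.one_closed[OF sN] by blast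
  obtain a where a: "a \<in> \<mu>" "u t * u (inv t) = a *s u \<one>" using uu[of t "inv t"] t tc by auto
  obtain b where b: "b \<in> \<mu>" "u (inv t) * u t = b *s u \<one>" using uu[of "inv t" t] t tc by auto
  define c d where "c = a * z0" and "d = b * z0"
  have c: "c \<in> \<mu>" "u t * u (inv t) = c *s f" and d: "d \<in> \<mu>" "u (inv t) * u t = d *s f"
    using a b z0 by (auto simp: c_def d_def p_roots_mult)
  \<comment> \<open>The two bracketings of \<open>u t * u (inv t) * u t\<close> force the left and
    the right scalar to agree.\<close>
  have "c *s u t = d *s u t"
  proof -
    have "c *s u t = (u t * u (inv t)) * u t" using c t by simp
    also have "\<dots> = d *s u t" using d t by (simp add: mult.assoc)
    finally show ?thesis .
  qed
  moreover have "u t \<noteq> 0"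
  proof
    assume "u t = 0"
    then have "c *s f = 0" using c by simp
    then show False using f_nonzero mu_nonzero[OF c(1)] by simp
  qed
  ultimately have cd: "c = d" by simp
  define x where "x = inverse c *s u (inv t)"
  have "c \<noteq> 0" using mu_nonzero c by simp
  then show ?thesis
    using c d cd t u_AK[of "inv t"] mu_K[OF c(1)] p_roots_inverse[OF c(1)]
    by (intro exI[of _ x]) (auto simp: x_def AK_scale K_inverse)
qed

text \<open>The inverse of \<open>u t\<close> in the corner with unit \<open>f\<close>. It agrees
  with \<open>u (inv t)\<close> only up to a factor in \<mu>.\<close>

definition w :: "'a \<Rightarrow> 'c" where
  "w t = (SOME x. x \<in> AK \<and> u t * x = f \<and> x * u t = f \<and> f * x = x \<and> x * f = x \<and>
    (\<exists>z\<in>\<mu>. x = z *s u (inv t)))"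

lemma w:
  assumes "t \<in> T"
  shows "w t \<in> AK" "u t * w t = f" "w t * u t = f" "f * w t = w t" "w t * f = w t"
    "\<exists>z\<in>\<mu>. w t = z *s u (inv t)"
  using someI_ex[OF inverse_exists[OF assms]] unfolding w_def by blast+

lemma wx:
  assumes "t \<in> T"
  shows "u t * (w t * x) = f * x" "w t * (u t * x) = f * x" "f * (w t * x) = w t * x" "w t * (f * x) = w t * x"
  using w[OF assms] by (metis mult.assoc)+

lemmas uw_simps = w fuN ffx ufx wx mult.assoc

lemma u_nonzero: "t \<in> T \<Longrightarrow> u t \<noteq> 0" using w(2)[of t] f_nonzero by auto

lemma u_mult:
  assumes "s \<in> T" "t \<in> T"
  shows "\<exists>z\<in>\<mu>. u (s \<otimes> t) = z *s (u s * u t)"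
proof -
  obtain z where "z \<in> \<mu>" "u s * u t = z *s u (s \<otimes> t)" using uu assms by blast
  then show ?thesis using mu_nonzero p_roots_inverse by (intro bexI[of _ "inverse z"]) auto
qed

lemma u_conj:
  assumes "s \<in> T" "t \<in> T"
  shows "\<exists>z\<in>\<mu>. u s * u t * w s = z *s u (s \<otimes> t \<otimes> inv s)"
proof -
  obtain a where a: "a \<in> \<mu>" "u s * u t = a *s u (s \<otimes> t)" using uu assms by blast
  obtain b where b: "b \<in> \<mu>" "w s = b *s u (inv s)" using w(6) assms by blast
  obtain c where c: "c \<in> \<mu>" "u (s \<otimes> t) * u (inv s) = c *s u (s \<otimes> t \<otimes> inv s)"
    using uu[of "s \<otimes> t" "inv s"] assms by auto
  show ?thesis using a b c by (intro bexI[of _ "b * (a * c)"]) (auto intro!: p_roots_mult)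
qed

text \<open>The ring type carries no unit; powers are iterated multiplications applied to
  \<open>f\<close>, the unit of the corner.\<close>

lemma u_pow:
  assumes "t \<in> T"
  shows "\<exists>z\<in>\<mu>. ((*) (u t) ^^ k) f = z *s u (t [^] k)"
proof (induction k)
  case 0
  obtain z where z: "z \<in> \<mu>" "u \<one> = z *s f" using uN subgroup.one_closed[OF sN] by blast
  then show ?case using mu_nonzero p_roots_inverse by (intro bexI[of _ "inverse z"]) auto
next
  case (Suc k)
  then obtain z where z: "z \<in> \<mu>" "((*) (u t) ^^ k) f = z *s u (t [^] k)" by blast
  obtain y where y: "y \<in> \<mu>" "u t * u (t [^] k) = y *s u (t \<otimes> t [^] k)"
    using uu[of t "t [^] k"] assms by auto
  have "t \<otimes> t [^] k = t [^] Suc k" using T_carrier[OF assms] nat_pow_Suc2 by metis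
  then show ?case using z y by (intro bexI[of _ "z * y"]) (auto intro: p_roots_mult)
qed

lemma u_scalar_pow:
  assumes "t \<in> T" "t [^] k \<in> N"
  shows "\<exists>z\<in>\<mu>. ((*) (u t) ^^ k) f = z *s f"
proof -
  obtain z where z: "z \<in> \<mu>" "((*) (u t) ^^ k) f = z *s u (t [^] k)" using u_pow[OF assms(1)] by blast
  obtain y where y: "y \<in> \<mu>" "u (t [^] k) = y *s f" using uN[OF assms(2)] by blast
  show ?thesis using z y by (intro bexI[of _ "z * y"]) (auto intro: p_roots_mult)
qed

text \<open>Absolute primitivity: the corner of the twisted group algebra at \<open>e\<close> is
  one-dimensional over the complex numbers, although membership in \<open>AK\<close> keeps
  \<open>e\<close> defined over \<open>K\<close>. Membership in the span makes \<open>e\<close>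
  commute with everything that commutes with all \<open>u t\<close>.\<close>

definition primitive_idempotent :: "'c \<Rightarrow> bool" where
  "primitive_idempotent e \<longleftrightarrow> e \<in> AK \<and> e \<noteq> 0 \<and> e * e = e \<and> f * e = e \<and> e * f = e \<and>
     e \<in> span (u ` T) \<and> (\<forall>t\<in>T. \<exists>c. e * u t * e = c *s e)"

lemma f_span:
  assumes "\<one> \<in> M"
  shows "f \<in> span (u ` M)"
proof -
  obtain z where z: "z \<in> \<mu>" "u \<one> = z *s f" using uN subgroup.one_closed[OF sN] by blast
  then have "f = inverse z *s u \<one>" using mu_nonzero by simp
  then show ?thesis using assms by (metis imageI span_base span_scale)
qed

lemma span_u_mult:
  assumes "M \<subseteq> T" "\<And>m h. m \<in> M \<Longrightarrow> h \<in> M \<Longrightarrow> m \<otimes> h \<in> M"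
    and "x \<in> span (u ` M)" "y \<in> span (u ` M)"
  shows "x * y \<in> span (u ` M)"
proof (rule span_mult[OF _ assms(3,4)])
  fix a b assume "a \<in> u ` M" "b \<in> u ` M"
  then obtain m h where mh: "m \<in> M" "h \<in> M" "a = u m" "b = u h" by blast
  then obtain z where "a * b = z *s u (m \<otimes> h)" using uu assms(1) by blast
  moreover have "u (m \<otimes> h) \<in> span (u ` M)" using assms(2) mh by (intro span_base imageI)
  ultimately show "a * b \<in> span (u ` M)" by (simp add: span_scale)
qed

lemma primitive_idempotent_trivial:
  assumes "N = T"
  shows "primitive_idempotent f"
proof -
  have "\<exists>c. f * u t * f = c *s f" if "t \<in> T" for t
    using uN[of t] assms that by auto
  then show ?thesis using f_AK f_nonzero f_span[of T] by (simp add: primitive_idempotent_def)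
qed

end

section \<open>Clifford theory over a section on which the cocycle splits\<close>

locale twisted_rep_normal = twisted_rep +
  fixes M :: "'a set"
  assumes MT: "normal_in M T" and NM: "N \<subseteq> M"
begin

lemmas sM = normal_inD(1)[OF MT] and M_sub_T = normal_inD(3)[OF MT] and M_conj = normal_inD(4)[OF MT]

lemma M_T: "m \<in> M \<Longrightarrow> m \<in> T" using M_sub_T by blast
lemma M_mult [simp]: "s \<in> M \<Longrightarrow> t \<in> M \<Longrightarrow> s \<otimes> t \<in> M" using sM subgroup.m_closed by metis
lemma M_inv [simp]: "t \<in> M \<Longrightarrow> inv t \<in> M" using sM subgroup.m_inv_closed by metis
lemma M_one [simp]: "\<one> \<in> M" using sM subgroup.one_closed by metis
lemma finite_M: "finite M" using finite_subset[OF M_sub_T finite_T] .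
lemma M_carrier: "m \<in> M \<Longrightarrow> m \<in> carrier G" using M_T T_carrier by blast
lemma card_M: "card M \<noteq> 0" by (metis M_one card_0_eq empty_iff finite_M)
lemma N_M: "n \<in> N \<Longrightarrow> n \<in> M" using NM by blast
lemma nNM: "normal_in N M" using normal_in_mono[OF NT sM NM M_sub_T] .

end

text \<open>A splitting of the cocycle over M / N with values in \<mu>: the corrected elements
  \<open>l m *s u m\<close> multiply like the group elements. The corresponding linear character of
  the twisted algebra sends \<open>u m\<close> to \<open>inverse (l m)\<close>.\<close>

locale twisted_rep_char = twisted_rep_normal +
  fixes l :: "'a \<Rightarrow> complex"
  assumes l_mu: "m \<in> M \<Longrightarrow> l m \<in> \<mu>"
    and l_mult: "m \<in> M \<Longrightarrow> h \<in> M \<Longrightarrow> (l m *s u m) * (l h *s u h) = l (m \<otimes> h) *s u (m \<otimes> h)"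
    and l_N: "n \<in> N \<Longrightarrow> l n *s u n = f"
begin

definition v :: "'a \<Rightarrow> 'c" where "v m = l m *s u m"

lemma v_mult: "m \<in> M \<Longrightarrow> h \<in> M \<Longrightarrow> v m * v h = v (m \<otimes> h)" by (simp only: v_def l_mult)
lemma fv: "m \<in> M \<Longrightarrow> f * v m = v m" by (simp add: v_def M_T)
lemma vf: "m \<in> M \<Longrightarrow> v m * f = v m" by (simp add: v_def M_T)
lemma v_N: "n \<in> N \<Longrightarrow> v n = f" by (simp add: v_def l_N)
lemma v_AK: "m \<in> M \<Longrightarrow> v m \<in> AK"
  by (auto simp: v_def intro!: AK_scale u_AK M_T mu_K l_mu)

text \<open>The idempotent of the linear character: \<open>u m\<close> acts on it as the scalar
  \<open>inverse (l m)\<close>.\<close>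

definition e :: 'c where "e = inverse (of_nat (card M)) *s (\<Sum>m\<in>M. v m)"

lemma e_AK: "e \<in> AK"
  by (auto simp: e_def intro!: AK_scale AK_sum v_AK K_inverse K_of_nat)

lemma fe: "f * e = e" by (simp add: e_def sum_distrib_left fv)
lemma ef: "e * f = e" by (simp add: e_def sum_distrib_right vf)

lemma ve: assumes "m \<in> M" shows "v m * e = e"
proof -
  have "(\<Sum>h\<in>M. v (m \<otimes> h)) = (\<Sum>h\<in>M. v h)"
    by (rule sum.reindex_bij_witness[where i = "\<lambda>h. inv m \<otimes> h" and j = "\<lambda>h. m \<otimes> h"])
       (use assms M_carrier in \<open>auto simp: inv_cancel\<close>)
  then show ?thesis using assms by (simp add: e_def sum_distrib_left v_mult)
qed

lemma ev: assumes "m \<in> M" shows "e * v m = e"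
proof -
  have "(\<Sum>h\<in>M. v (h \<otimes> m)) = (\<Sum>h\<in>M. v h)"
    by (rule sum.reindex_bij_witness[where i = "\<lambda>h. h \<otimes> inv m" and j = "\<lambda>h. h \<otimes> m"])
       (use assms M_carrier in \<open>auto simp: m_assoc\<close>)
  then show ?thesis using assms by (simp add: e_def sum_distrib_right v_mult)
qed

lemma ee: "e * e = e"
proof -
  have "e * e = inverse (of_nat (card M)) *s (\<Sum>m\<in>M. v m * e)"
    by (subst (1) e_def) (simp add: sum_distrib_right)
  also have "\<dots> = inverse (of_nat (card M)) *s (of_nat (card M) *s e)"
    by (simp add: ve sum_constant_scale del: sum_constant)
  also have "\<dots> = e" using card_M by simp
  finally show ?thesis .
qed

lemma \<tau>_v: "m \<in> M \<Longrightarrow> m \<notin> N \<Longrightarrow> \<tau> (v m) = 0"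
  by (simp add: v_def \<tau>u M_T)

text \<open>Only the summands over \<open>N\<close> survive under \<tau>, and each of them is
  \<open>f\<close>.\<close>

lemma \<tau>e: "\<tau> e \<noteq> 0"
proof -
  have "(\<Sum>m\<in>M. \<tau> (v m)) = (\<Sum>m\<in>N. \<tau> (v m))"
    by (rule sum.mono_neutral_right) (use finite_M NM \<tau>_v in auto)
  also have "\<dots> = of_nat (card N) * \<tau> f" by (simp add: v_N)
  finally have "\<tau> e = inverse (of_nat (card M)) * (of_nat (card N) * \<tau> f)"
    by (simp add: e_def \<tau>_sum)
  moreover have "card N \<noteq> 0"
    using finite_subset[OF NM finite_M] subgroup.one_closed[OF sN] by auto
  ultimately show ?thesis using \<tau>f card_M by simp
qed

text \<open>The stabilizer of the linear character. Conjugation by any \<open>u t\<close> takes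
  \<open>v m\<close> to a multiple of \<open>v (t \<otimes> m \<otimes> inv t)\<close>; for
  \<open>t\<close> in \<open>S\<close> all these factors are 1.\<close>

definition S :: "'a set" where
  "S = {t\<in>T. \<forall>m\<in>M. u t * v m = v (t \<otimes> m \<otimes> inv t) * u t}"

lemma uv:
  assumes t: "t \<in> T" and m: "m \<in> M"
  shows "\<exists>z. u t * v m = z *s (v (t \<otimes> m \<otimes> inv t) * u t)"
proof -
  let ?m = "t \<otimes> m \<otimes> inv t"
  have m': "?m \<in> M" "?m \<in> T" using M_conj t m M_T by auto
  obtain a where a: "u t * u m = a *s u (t \<otimes> m)" using uu t m M_T by blast
  obtain b where b: "b \<in> \<mu>" "u (?m \<otimes> t) = b *s (u ?m * u t)" using u_mult m' t by blast
  have "?m \<otimes> t = t \<otimes> m" using t m T_carrier M_carrier by (simp add: m_assoc)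
  then have *: "u t * v m = (l m * a * b) *s (u ?m * u t)" using a b by (simp add: v_def)
  have "l ?m \<noteq> 0" using l_mu m' mu_nonzero by blast
  then have "u ?m * u t = inverse (l ?m) *s (v ?m * u t)" by (simp add: v_def)
  then show ?thesis using * by auto
qed

lemma S_T: "t \<in> S \<Longrightarrow> t \<in> T" by (simp add: S_def)

lemma S_mult: assumes "s \<in> S" "t \<in> S" shows "s \<otimes> t \<in> S"
proof -
  have T: "s \<in> T" "t \<in> T" using assms S_T by auto
  have "u (s \<otimes> t) * v m = v (s \<otimes> t \<otimes> m \<otimes> inv (s \<otimes> t)) * u (s \<otimes> t)" if m: "m \<in> M" for m
  proof -
    let ?m = "t \<otimes> m \<otimes> inv t"
    have m': "?m \<in> M" using M_conj T m by auto
    have eq: "s \<otimes> ?m \<otimes> inv s = s \<otimes> t \<otimes> m \<otimes> inv (s \<otimes> t)"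
      using T T_carrier m M_carrier by (simp add: m_assoc inv_mult_group)
    obtain b where b: "u (s \<otimes> t) = b *s (u s * u t)" using u_mult T by blast
    have "u s * u t * v m = u s * (v ?m * u t)"
      using assms(2) m by (simp add: S_def mult.assoc)
    also have "\<dots> = (u s * v ?m) * u t" by (simp add: mult.assoc)
    also have "\<dots> = (v (s \<otimes> ?m \<otimes> inv s) * u s) * u t"
      using assms(1) m' by (simp add: S_def)
    finally show ?thesis using b eq by (simp add: mult.assoc)
  qed
  then show ?thesis using T by (simp add: S_def)
qed

lemma M_S: assumes "m \<in> M" shows "m \<in> S"
proof -
  have "u m * v h = v (m \<otimes> h \<otimes> inv m) * u m" if h: "h \<in> M" for h
  proof -
    have c: "m \<in> carrier G" "h \<in> carrier G" using assms h M_carrier by auto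
    have "v m * v h = v (m \<otimes> h \<otimes> inv m) * v m"
      using assms h c by (simp add: v_mult m_assoc)
    then have "l m *s (u m * v h) = l m *s (v (m \<otimes> h \<otimes> inv m) * u m)"
      by (simp add: v_def[of m])
    then show ?thesis using l_mu[OF assms] mu_nonzero by auto
  qed
  then show ?thesis using assms M_T by (simp add: S_def)
qed

lemma S_pow: "t \<in> S \<Longrightarrow> t [^] (k::nat) \<in> S"
  by (induction k) (auto intro: S_mult M_S subgroup.one_closed[OF sM])

lemma sS: "subgroup S G"
proof (rule subgroupI)
  show "S \<subseteq> carrier G" using S_T T_carrier by auto
  show "S \<noteq> {}" using M_S M_one by blast
  fix t assume t: "t \<in> S"
  have tc: "t \<in> carrier G" using t S_T T_carrier by auto
  have o: "Coset.order G > 0" using finite_carrier order_gt_0_iff_finite by blast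
  have "t [^] (Coset.order G - 1) \<otimes> t = \<one>"
    using pow_order_eq_1[OF tc] o tc by (metis Suc_diff_1 nat_pow_Suc)
  then have "inv t = t [^] (Coset.order G - 1)" using tc by (simp add: inv_equality)
  then show "inv t \<in> S" using S_pow[OF t] by simp
qed (rule S_mult)

lemma MS: "normal_in M S"
  using MT sM sS M_S S_T by (auto simp: normal_in_def)

lemma ue:
  assumes t: "t \<in> S"
  shows "u t * e = e * u t"
proof -
  have tT: "t \<in> T" using t S_T by blast
  have tc: "t \<in> carrier G" using tT T_carrier by auto
  have "u t * e = inverse (of_nat (card M)) *s (\<Sum>m\<in>M. v (t \<otimes> m \<otimes> inv t) * u t)"
    using t by (simp add: e_def sum_distrib_left S_def)
  also have "(\<Sum>m\<in>M. v (t \<otimes> m \<otimes> inv t) * u t) = (\<Sum>m\<in>M. v m * u t)"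
  proof (rule sum.reindex_bij_witness[where i = "\<lambda>h. inv t \<otimes> h \<otimes> t" and j = "\<lambda>h. t \<otimes> h \<otimes> inv t"])
    show "inv t \<otimes> m \<otimes> t \<in> M" if "m \<in> M" for m
      using M_conj[of "inv t" m] that tT tc by simp
    show "t \<otimes> m \<otimes> inv t \<in> M" if "m \<in> M" for m using M_conj tT that by blast
  qed (use tc M_carrier in \<open>auto simp: m_assoc inv_cancel\<close>)
  finally show ?thesis by (simp add: e_def sum_distrib_right)
qed

text \<open>If \<open>t\<close> moves the character, conjugation changes some \<open>v m\<close> by
  a factor \<open>z\<close> other than 1. Both \<open>v m\<close> and its conjugate are absorbed by
  \<open>e\<close>, so that \<open>e * u t * e\<close> equals its own multiple by
  \<open>z\<close>.\<close>

lemma eue_outside: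
  assumes t: "t \<in> T" "t \<notin> S"
  shows "e * u t * e = 0"
proof -
  obtain m where m: "m \<in> M" "u t * v m \<noteq> v (t \<otimes> m \<otimes> inv t) * u t"
    using t by (auto simp: S_def)
  have m': "t \<otimes> m \<otimes> inv t \<in> M" using M_conj m t by blast
  obtain z where z: "u t * v m = z *s (v (t \<otimes> m \<otimes> inv t) * u t)"
    using uv t m by blast
  have "z \<noteq> 1" using z m by auto
  have "e * u t * e = e * (u t * v m) * e" using ve[OF m(1)] by (simp add: mult.assoc)
  also have "\<dots> = z *s ((e * v (t \<otimes> m \<otimes> inv t)) * u t * e)" by (simp add: z mult.assoc)
  also have "\<dots> = z *s (e * u t * e)" by (simp add: ev m')
  finally have "(1 - z) *s (e * u t * e) = 0" by (simp add: scale_left_diff_distrib)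
  then show ?thesis using \<open>z \<noteq> 1\<close> by simp
qed

text \<open>Clifford correspondence: by \<open>eue_outside\<close>, cutting down by \<open>e\<close> leaves only the stabilizer of the
  character.\<close>

lemma stabilizer_rep: "twisted_rep G scale p K AK \<tau> S M e (\<lambda>t. u t * e)"
proof unfold_locales
  show "normal_in M S" by (rule MS)
  show "e * e = e" by (rule ee)
  show "e \<in> AK" by (rule e_AK)
  show "\<tau> e \<noteq> 0" by (rule \<tau>e)
  fix t assume t: "t \<in> S"
  have tT: "t \<in> T" using t S_T by blast
  show "u t * e \<in> AK" using u_AK tT e_AK AK_mult by blast
  show "e * (u t * e) = u t * e" using ue[OF t] ee by (metis mult.assoc)
  show "u t * e * e = u t * e" using ee by (simp add: mult.assoc)
  { fix s assume s: "s \<in> S"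
    obtain z where z: "z \<in> \<mu>" "u s * u t = z *s u (s \<otimes> t)" using uu s t S_T by blast
    have "u s * e * (u t * e) = u s * (e * u t) * e" by (simp add: mult.assoc)
    also have "\<dots> = u s * u t * e" using ue[OF t] ee by (metis mult.assoc)
    finally show "\<exists>z\<in>\<mu>. u s * e * (u t * e) = z *s (u (s \<otimes> t) * e)" using z by auto }
  { assume m: "t \<notin> M"
    have "\<tau> (u t * v m) = 0" if h: "m \<in> M" for m
    proof -
      obtain z where z: "u t * u m = z *s u (t \<otimes> m)" using uu tT h M_T by blast
      have "t \<otimes> m \<notin> N"
      proof
        assume "t \<otimes> m \<in> N"
        then have "t \<otimes> m \<in> M" using NM by blast
        then have "(t \<otimes> m) \<otimes> inv m \<in> M" using M_mult[OF _ M_inv[OF h]] by blast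
        then show False using m h tT T_carrier M_carrier by (simp add: m_assoc)
      qed
      then have "\<tau> (u (t \<otimes> m)) = 0" using tT h M_T by (intro \<tau>u) auto
      then show ?thesis using z by (simp add: v_def)
    qed
    then show "\<tau> (u t * e) = 0" by (simp add: e_def sum_distrib_left \<tau>_sum) }
next
  fix m assume m: "m \<in> M"
  have "l m \<noteq> 0" using l_mu m mu_nonzero by blast
  then have "u m = inverse (l m) *s v m" by (simp add: v_def)
  then have "u m * e = inverse (l m) *s e" using ve[OF m] by simp
  then show "\<exists>z\<in>\<mu>. u m * e = z *s e" using l_mu[OF m] p_roots_inverse by blast
qed

text \<open>Since \<open>x\<close> lies in the corner of \<open>e\<close>, elements outside the
  stabilizer contribute 0 to \<open>x * u t * x\<close>, and those in \<open>S\<close> are covered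
  by the assumption.\<close>

lemma primitive_idempotent_lift:
  assumes "twisted_rep.primitive_idempotent scale AK S e (\<lambda>t. u t * e) x"
  shows "primitive_idempotent x \<and> e * x = x \<and> x * e = x"
proof -
  interpret S: twisted_rep G scale p K AK \<tau> S M e "\<lambda>t. u t * e" by (rule stabilizer_rep)
  have xs: "x \<in> span ((\<lambda>t. u t * e) ` S)" using assms by (simp add: S.primitive_idempotent_def)
  have "e \<in> span (u ` T)"
    unfolding e_def v_def using M_T by (intro span_scale span_sum) (auto intro: span_base)
  then have "(\<lambda>t. u t * e) ` S \<subseteq> span (u ` T)"
    using span_u_mult[OF subset_refl T_mult span_base[OF imageI]] S_T by blast
  then have "x \<in> span (u ` T)" using xs span_minimal subspace_span by blast
  have x: "x \<in> AK" "x \<noteq> 0" "x * x = x" "e * x = x" "x * e = x" "\<And>t. t \<in> S \<Longrightarrow> \<exists>c. x * (u t * e) * x = c *s x"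
    using assms by (auto simp: S.primitive_idempotent_def)
  have "\<exists>c. x * u t * x = c *s x" if t: "t \<in> T" for t
  proof (cases "t \<in> S")
    case True
    then obtain c where "x * (u t * e) * x = c *s x" using x by blast
    then show ?thesis using x(4) by (metis mult.assoc)
  next
    case False
    have "x * u t * x = (x * e) * u t * (e * x)" by (simp add: x)
    also have "\<dots> = x * (e * u t * e) * x" by (simp add: mult.assoc)
    also have "\<dots> = 0 *s x" using eue_outside[OF t False] by simp
    finally show ?thesis by blast
  qed
  moreover have "f * x = x" "x * f = x" using x fe ef by (metis mult.assoc)+
  ultimately show ?thesis using x \<open>x \<in> span (u ` T)\<close> by (simp add: primitive_idempotent_def)
qed

end

section \<open>Eigenvectors and the splitting of cocycles\<close>

lemma sum_root_of_unity_powers: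
  fixes z0 :: complex
  assumes q: "q > 0" and z0: "z0 \<noteq> 0" and i: "i < q"
  defines "R \<equiv> (\<lambda>j. z0 * cis (2 * pi * real j / real q)) ` {..<q}"
  shows "(\<Sum>a\<in>R. inverse a ^ i) = (if i = 0 then of_nat q else 0)"
    and "\<And>a. a \<in> R \<Longrightarrow> a ^ q = z0 ^ q"
proof -
  define \<omega> where "\<omega> = cis (2 * pi / real q)"
  have \<omega>: "cis (2 * pi * real j / real q) = \<omega> ^ j" for j
    by (simp add: \<omega>_def DeMoivre mult_ac)
  have inj: "inj_on (\<lambda>j. \<omega> ^ j) {..<q}"
    using bij_betw_roots_unity[OF q] by (simp add: bij_betw_def \<omega>)
  have w1: "\<omega> ^ q = 1" using q by (simp add: \<omega>_def DeMoivre)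
  have w0: "\<omega> \<noteq> 0" by (simp add: \<omega>_def)
  have "(\<Sum>a\<in>R. inverse a ^ i) = (\<Sum>j<q. inverse (z0 * \<omega> ^ j) ^ i)"
    unfolding R_def \<omega> using inj z0 by (subst sum.reindex) (auto simp: inj_on_def)
  also have "\<dots> = inverse z0 ^ i * (\<Sum>j<q. (inverse \<omega> ^ i) ^ j)"
    by (simp add: sum_distrib_left power_mult_distrib power_inverse power_mult[symmetric] mult.commute)
  also have "(\<Sum>j<q. (inverse \<omega> ^ i) ^ j) = (if i = 0 then of_nat q else 0)"
  proof (cases "i = 0")
    case False
    have "\<omega> ^ i \<noteq> \<omega> ^ 0" using inj_onD[OF inj, of i 0] i q False by auto
    then have ne: "inverse \<omega> ^ i \<noteq> 1" by (simp add: power_inverse)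
    have "(inverse \<omega> ^ i) ^ q = 1" using w1 by (metis inverse_1 power_inverse power_mult mult.commute power_one)
    then show ?thesis using geometric_sum[OF ne, of q] False by simp
  qed simp
  finally show "(\<Sum>a\<in>R. inverse a ^ i) = (if i = 0 then of_nat q else 0)" by simp
  show "a ^ q = z0 ^ q" if "a \<in> R" for a
    using that w1 unfolding R_def \<omega> by (auto simp: power_mult_distrib) (metis mult.commute power_mult power_one)
qed

lemma power_eq_of_cong:
  fixes x :: "'a::monoid_mult"
  assumes "x ^ q = 1" "[a = b] (mod q)"
  shows "x ^ a = x ^ b"
proof -
  have "x ^ a = x ^ (a mod q)" for a
    by (metis assms(1) mod_mult_div_eq mult.right_neutral power_add power_mult power_one)
  then show ?thesis using assms(2) by (metis cong_def)
qed

text \<open>The choice is made once for each coset, so that \<open>rep\<close> is constant on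
  cosets; \<open>coprime_character\<close> needs this to obtain a cocycle that depends only on
  cosets.\<close>

lemma (in group) coset_representatives:
  assumes nm: "normal_in N M" and fin: "finite M"
  shows "\<exists>rep. (\<forall>t\<in>M. \<exists>n\<in>N. rep t = n \<otimes> t) \<and>
    (\<forall>s\<in>M. \<forall>t\<in>M. N #> s = N #> t \<longrightarrow> rep s = rep t) \<and> card (rep ` M) * card N = card M"
proof -
  note d = normal_inD[OF nm]
  let ?C = "rcosets\<^bsub>G\<lparr>carrier := M\<rparr>\<^esub> N"
  have C: "?C = (\<lambda>c. N #> c) ` M" by (auto simp: RCOSETS_def r_coset_def)
  define ch :: "'a set \<Rightarrow> 'a" where "ch X = (SOME x. x \<in> X)" for X
  have Mc: "m \<in> carrier G" if "m \<in> M" for m using subgroup.mem_carrier[OF d(2) that] .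
  have self: "m \<in> N #> m" if "m \<in> M" for m by (rule rcos_self[OF Mc[OF that] d(1)])
  have ch_in: "ch (N #> m) \<in> N #> m" if "m \<in> M" for m
    unfolding ch_def by (rule someI[of "\<lambda>x. x \<in> N #> m" m, OF self[OF that]])
  have coset: "N #> ch (N #> m) = N #> m" if "m \<in> M" for m
    by (rule repr_independence[OF ch_in[OF that] Mc[OF that] d(1), symmetric])
  have inj: "inj_on ch ?C"
  proof (rule inj_onI)
    fix X Y assume "X \<in> ?C" "Y \<in> ?C" and eq: "ch X = ch Y"
    then obtain x y where xy: "x \<in> M" "y \<in> M" "X = N #> x" "Y = N #> y" unfolding C by blast
    have "X = N #> ch X" unfolding xy(3) by (rule coset[OF xy(1), symmetric])
    also have "\<dots> = Y" unfolding eq unfolding xy(4) by (rule coset[OF xy(2)])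
    finally show "X = Y" .
  qed
  show ?thesis
  proof (intro exI[of _ "\<lambda>t. ch (N #> t)"] conjI ballI impI)
    show "\<exists>n\<in>N. ch (N #> t) = n \<otimes> t" if "t \<in> M" for t
      using ch_in[OF that] unfolding r_coset_def by blast
    have "(\<lambda>t. ch (N #> t)) ` M = ch ` ?C" unfolding C image_image ..
    then show "card ((\<lambda>t. ch (N #> t)) ` M) * card N = card M"
      using card_image[OF inj] card_rcosets_mult[OF nm fin] by argo
  qed simp
qed

context twisted_algebra
begin

text \<open>For the \<open>q\<close>-th roots \<open>a\<close> of \<open>z\<close>, the vectors \<open>\<Sum>i<q. a\<^sup>-\<^sup>i L\<^sup>i x\<close> are eigenvectors or zero,
  and they sum up to \<open>q x\<close>.\<close>

lemma eigenvector_of_root: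
  assumes L_add: "\<And>x y. L (x + y) = L x + L y" and L_scale: "\<And>c x. L (c *s x) = c *s L x"
    and V: "subspace V" "\<And>x. x \<in> V \<Longrightarrow> L x \<in> V"
    and x: "x \<in> V" "x \<noteq> 0" and q: "q > 0" and z: "z \<noteq> 0" "(L ^^ q) x = z *s x"
  shows "\<exists>y\<in>V. y \<noteq> 0 \<and> (\<exists>a. a ^ q = z \<and> L y = a *s y)"
proof -
  obtain z0 where z0: "z0 ^ q = z" using nth_root_exists[OF q] by blast
  then have z00: "z0 \<noteq> 0" using z q by auto
  define R where "R = (\<lambda>j. z0 * cis (2 * pi * real j / real q)) ` {..<q}"
  note R = sum_root_of_unity_powers[OF q z00, folded R_def]
  have Ra: "a ^ q = z" if "a \<in> R" for a using R(2)[OF q that] z0 by simp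
  have L_sum: "L (sum g I) = (\<Sum>i\<in>I. L (g i))" if "finite I" for g :: "nat \<Rightarrow> 'r" and I
    using that
  proof (induction I)
    case empty
    show ?case using L_scale[of 0 0] by simp
  qed (simp add: L_add)
  define y where "y a = (\<Sum>i<q. (inverse a ^ i) *s (L ^^ i) x)" for a
  have LV: "(L ^^ i) x \<in> V" for i by (induction i) (auto simp: x V)
  have yV: "y a \<in> V" for a unfolding y_def using V(1) LV by (intro subspace_sum subspace_scale)
  have Ly: "L (y a) = a *s y a" if "a \<in> R" for a
  proof -
    have a: "a ^ q = z" "a \<noteq> 0" using Ra[OF that] z q by auto
    define g where "g i = (inverse a ^ i) *s (L ^^ i) x" for i
    have "L (y a) = (\<Sum>i<q. (inverse a ^ i) *s (L ^^ Suc i) x)" by (simp add: y_def L_sum L_scale)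
    also have "\<dots> = a *s (\<Sum>i<q. g (Suc i))" using a by (simp add: g_def scale_sum_right mult.assoc[symmetric])
    also have "(\<Sum>i<q. g (Suc i)) = (\<Sum>i<q. g i) + g q - g 0"
      using sum.lessThan_Suc[of g q] sum.lessThan_Suc_shift[of g q] by (simp add: eq_diff_eq add.commute)
    also have "g q = g 0" using z a by (simp add: g_def power_inverse)
    finally show ?thesis by (simp add: y_def g_def)
  qed
  have "(\<Sum>a\<in>R. y a) = (\<Sum>i<q. (\<Sum>a\<in>R. inverse a ^ i) *s (L ^^ i) x)"
    unfolding y_def by (subst sum.swap) (simp add: scale_sum_left)
  also have "\<dots> = (\<Sum>i<q. (if i = 0 then of_nat q *s x else 0))"
    by (rule sum.cong) (auto simp: R(1))
  also have "\<dots> = of_nat q *s x" using q by (simp add: sum.If_cases)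
  finally have "(\<Sum>a\<in>R. y a) \<noteq> 0" using x q by simp
  then obtain a where "a \<in> R" "y a \<noteq> 0" by (meson sum.neutral)
  then show ?thesis using yV Ly Ra by blast
qed

end

context twisted_rep
begin

lemma funpow_mult_left: "((*) a ^^ k) b * x = ((*) a ^^ k) (b * x)" for a b x :: 'c
  by (induction k) (auto simp: mult.assoc)

text \<open>The joint eigenspace \<open>V'\<close> of the elements treated so far is stable under
  the next \<open>u m\<close> because the \<open>u m\<close> commute. The \<open>p ^ k\<close>-th
  power of the new eigenvalue is in \<mu>, hence so is the eigenvalue.\<close>

lemma common_eigenvector:
  assumes M: "M \<subseteq> T" and comm: "\<And>m h. m \<in> M \<Longrightarrow> h \<in> M \<Longrightarrow> u m * u h = u h * u m"
    and q: "\<And>m. m \<in> M \<Longrightarrow> m [^] (p ^ k :: nat) \<in> N"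
    and V: "subspace V" "\<And>m x. m \<in> M \<Longrightarrow> x \<in> V \<Longrightarrow> u m * x \<in> V" "\<And>x. x \<in> V \<Longrightarrow> f * x = x"
    and x0: "x0 \<in> V" "x0 \<noteq> 0" and F: "finite F" "F \<subseteq> M"
  shows "\<exists>x\<in>V. x \<noteq> 0 \<and> (\<forall>m\<in>F. \<exists>z\<in>\<mu>. u m * x = z *s x)"
  using F
proof (induction F rule: finite_induct)
  case empty
  then show ?case using x0 by auto
next
  case (insert m F)
  then obtain x where x: "x \<in> V" "x \<noteq> 0" "\<forall>m\<in>F. \<exists>z\<in>\<mu>. u m * x = z *s x" by auto
  then obtain zz where zz: "\<And>h. h \<in> F \<Longrightarrow> zz h \<in> \<mu> \<and> u h * x = zz h *s x" by metis
  define V' where "V' = {y\<in>V. \<forall>h\<in>F. u h * y = zz h *s y}"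
  have m: "m \<in> M" "m \<in> T" using insert M by auto
  have sub: "subspace V'"
    using V(1) unfolding subspace_def V'_def
    by (auto simp: distrib_left scale_right_distrib mult.commute)
  have stable: "u m * y \<in> V'" if "y \<in> V'" for y
  proof -
    have "u h * (u m * y) = zz h *s (u m * y)" if h: "h \<in> F" for h
    proof -
      have "u h * (u m * y) = u m * (u h * y)"
        using comm[of h m] h insert m by (metis insert_subset mult.assoc subsetD)
      then show ?thesis using h \<open>y \<in> V'\<close> by (simp add: V'_def)
    qed
    then show ?thesis using that V(2) m by (simp add: V'_def)
  qed
  obtain z where z: "z \<in> \<mu>" "((*) (u m) ^^ (p ^ k)) f = z *s f"
    using u_scalar_pow[OF m(2) q[OF m(1)]] by blast
  have "((*) (u m) ^^ (p ^ k)) x = z *s x"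
    using funpow_mult_left[of "p ^ k" "u m" f x] z V(3)[OF x(1)] by simp
  then obtain y a where y: "y \<in> V'" "y \<noteq> 0" "a ^ (p ^ k) = z" "u m * y = a *s y"
    using eigenvector_of_root[of "(*) (u m)" V' x "p ^ k" z] sub stable x zz p_pos mu_nonzero[OF z(1)]
    by (auto simp: V'_def distrib_left)
  then have "a \<in> \<mu>" using z p_roots_root by blast
  then show ?case using y zz by (intro bexI[of _ y]) (auto simp: V'_def)
qed

text \<open>On a common eigenvector the scalars of \<open>u m\<close> absorb the cocycle, since the
  vector is not 0; their inverses are the splitting. Prescribing the space \<open>V\<close> of the
  eigenvector makes it possible to exclude the trivial character later.\<close>

lemma commuting_character:
  assumes MT: "normal_in M T" and NM: "N \<subseteq> M" and c: "card M = p ^ k * card N"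
    and comm: "\<And>m h. m \<in> M \<Longrightarrow> h \<in> M \<Longrightarrow> u m * u h = u h * u m"
    and V: "subspace V" "\<And>m x. m \<in> M \<Longrightarrow> x \<in> V \<Longrightarrow> u m * x \<in> V" "\<And>x. x \<in> V \<Longrightarrow> f * x = x"
    and x0: "x0 \<in> V" "x0 \<noteq> 0"
  shows "\<exists>l. \<exists>x\<in>V. x \<noteq> 0 \<and> twisted_rep_char G scale p K AK \<tau> T N f u M l \<and>
    (\<forall>m\<in>M. (l m *s u m) * x = x)"
proof -
  have M: "M \<subseteq> T" by (rule normal_inD(3)[OF MT])
  have nNM: "normal_in N M" using normal_in_mono[OF NT normal_inD(1)[OF MT] NM M] .
  have finM: "finite M" using finite_subset[OF M finite_T] .
  obtain x where x: "x \<in> V" "x \<noteq> 0" "\<forall>m\<in>M. \<exists>z\<in>\<mu>. u m * x = z *s x"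
    using common_eigenvector[OF M comm normal_in_pow_index[OF nNM finM c] V x0 finM] by auto
  then obtain zz where zz: "\<And>m. m \<in> M \<Longrightarrow> zz m \<in> \<mu> \<and> u m * x = zz m *s x" by metis
  define l where "l m = inverse (zz m)" for m
  have lz: "l m * zz m = 1" if "m \<in> M" for m using zz[OF that] mu_nonzero by (simp add: l_def)
  have lx: "(l m *s u m) * x = x" if "m \<in> M" for m using zz[OF that] lz[OF that] by simp
  have fx: "f * x = x" using x V by blast
  have "twisted_rep_char G scale p K AK \<tau> T N f u M l"
  proof unfold_locales
    show "normal_in M T" "N \<subseteq> M" by fact+
    show "l m \<in> \<mu>" if "m \<in> M" for m using zz[OF that] by (simp add: l_def p_roots_inverse)
    show "(l m *s u m) * (l h *s u h) = l (m \<otimes> h) *s u (m \<otimes> h)" if mh: "m \<in> M" "h \<in> M" for m h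
    proof -
      have mhM: "m \<otimes> h \<in> M" using mh normal_inD(1)[OF MT] subgroup.m_closed by metis
      obtain z where z: "u m * u h = z *s u (m \<otimes> h)" using uu mh M by blast
      define c where "c = l m * l h * z"
      have eq: "(l m *s u m) * (l h *s u h) = c *s u (m \<otimes> h)" by (simp add: z c_def mult_ac)
      have "(l m *s u m) * (l h *s u h) * x = x"
        using lx mh by (simp only: mult.assoc)
      then have "(c *s u (m \<otimes> h)) * x = x" unfolding eq .
      then have "(c * zz (m \<otimes> h)) *s x = 1 *s x" using zz[OF mhM] by simp
      then have "c * zz (m \<otimes> h) = 1" using x by (simp only: scale_cancel_right) simp
      then have "c = l (m \<otimes> h)" using lz[OF mhM] zz[OF mhM] mu_nonzero by (metis mult_right_cancel)
      then show ?thesis using eq by simp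
    qed
    show "l n *s u n = f" if n: "n \<in> N" for n
    proof -
      obtain z where z: "u n = z *s f" using uN n by blast
      then have "(l n * z) *s x = 1 *s x" using lx[of n] n NM fx by auto
      then have "l n * z = 1" using x by (simp only: scale_cancel_right) simp
      then show ?thesis using z by simp
    qed
  qed
  then show ?thesis using x lx by blast
qed

text \<open>Transfer: multiplying the cocycle identity over a transversal shows that the \<open>r\<close>-th power of the
  cocycle is the coboundary of \<open>\<beta>\<close>, and \<open>r\<close> is invertible modulo its order.\<close>

lemma coprime_character:
  assumes MT: "normal_in M T" and NM: "N \<subseteq> M" and c: "card M = r * card N" and cop: "coprime p r"
  shows "\<exists>l. twisted_rep_char G scale p K AK \<tau> T N f u M l"
proof -
  have M: "M \<subseteq> T" by (rule normal_inD(3)[OF MT])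
  note sM = normal_inD(1)[OF MT]
  have nNM: "normal_in N M" using normal_in_mono[OF NT sM NM M] .
  have finM: "finite M" using finite_subset[OF M finite_T] .
  have MT': "m \<in> T" if "m \<in> M" for m using M that by blast
  have Mc: "m \<in> carrier G" if "m \<in> M" for m using MT' that T_carrier by blast
  have Mm: "m \<otimes> h \<in> M" if "m \<in> M" "h \<in> M" for m h using that sM subgroup.m_closed by metis
  have Mi: "inv m \<in> M" if "m \<in> M" for m using that sM subgroup.m_inv_closed by metis
  obtain rep where rep_ex: "\<And>t. t \<in> M \<Longrightarrow> \<exists>n\<in>N. rep t = n \<otimes> t"
    and rep_eqI: "\<And>s t. s \<in> M \<Longrightarrow> t \<in> M \<Longrightarrow> N #> s = N #> t \<Longrightarrow> rep s = rep t"
    and card_rep: "card (rep ` M) * card N = card M"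
    using coset_representatives[OF nNM finM] by metis
  have rep_M: "rep t \<in> M" if "t \<in> M" for t using rep_ex[OF that] NM that Mm by auto
  have coset_rep: "N #> rep t = N #> t" if t: "t \<in> M" for t
  proof -
    obtain n where n: "n \<in> N" "rep t = n \<otimes> t" using rep_ex[OF t] by blast
    then have "rep t \<in> N #> t" unfolding r_coset_def by blast
    from repr_independence[OF this Mc[OF t] sN] show ?thesis by (rule sym)
  qed
  have rep_rep: "rep (rep t) = rep t" if "t \<in> M" for t using rep_eqI[OF rep_M[OF that] that coset_rep[OF that]] .
  have mult: "(N #> x) <#> (N #> y) = N #> (x \<otimes> y)" if "x \<in> M" "y \<in> M" for x y
  proof -
    interpret M: group "G\<lparr>carrier := M\<rparr>" by (rule subgroup_imp_group[OF sM])
    interpret N: normal N "G\<lparr>carrier := M\<rparr>" using nNM normal_in_iff_normal by blast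
    show ?thesis using N.rcos_sum[of x y] that by (simp add: r_coset_in_sub set_mult_def)
  qed
  have rep_mult: "rep (s \<otimes> rep t) = rep (s \<otimes> t)" "rep (rep s \<otimes> t) = rep (s \<otimes> t)"
    if "s \<in> M" "t \<in> M" for s t
    using mult[of s "rep t"] mult[of s t] mult[of "rep s" t] coset_rep that rep_M Mm
    by (auto intro!: rep_eqI)
  define R where "R = rep ` M"
  have R_M: "k \<in> M" "rep k = k" if "k \<in> R" for k using that rep_M rep_rep by (auto simp: R_def)
  have "card R * card N = r * card N" using card_rep c by (simp add: R_def)
  moreover have "card N \<noteq> 0"
    using finite_subset[OF NM finM] subgroup.one_closed[OF sN] by auto
  ultimately have cardR: "card R = r" by simp
  \<comment> \<open>Passing to representatives changes \<open>u\<close> by factors in \<mu> and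
    makes the cocycle \<alpha> a function of cosets, so that products over the transversal
    \<open>R\<close> can be shifted.\<close>
  define V where "V t = u (rep t)" for t
  have VN: "\<exists>z\<in>\<mu>. u t = z *s V t" if t: "t \<in> M" for t
  proof -
    obtain n where n: "n \<in> N" "rep t = n \<otimes> t" using rep_ex[OF t] by blast
    obtain a where a: "a \<in> \<mu>" "u n = a *s f" using uN n by blast
    obtain b where b: "b \<in> \<mu>" "u (n \<otimes> t) = b *s (u n * u t)" using u_mult n t MT' N_T by blast
    define c where "c = a * b"
    have "V t = c *s u t" using a b n t MT' by (simp add: V_def c_def mult.commute)
    moreover have "c \<in> \<mu>" "c \<noteq> 0" using a b p_roots_mult mu_nonzero by (auto simp: c_def)
    ultimately show ?thesis by (intro bexI[of _ "inverse c"]) (auto intro: p_roots_inverse)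
  qed
  have V0: "V t \<noteq> 0" if "t \<in> M" for t using u_nonzero MT' rep_M that by (simp add: V_def)
  have "\<exists>z\<in>\<mu>. V s * V t = z *s V (s \<otimes> t)" if st: "s \<in> M" "t \<in> M" for s t
  proof -
    obtain a where a: "a \<in> \<mu>" "V s * V t = a *s u (rep s \<otimes> rep t)"
      using uu[of "rep s" "rep t"] MT' rep_M st by (auto simp: V_def)
    obtain b where b: "b \<in> \<mu>" "u (rep s \<otimes> rep t) = b *s V (rep s \<otimes> rep t)"
      using VN[of "rep s \<otimes> rep t"] Mm rep_M st by blast
    have "V (rep s \<otimes> rep t) = V (s \<otimes> t)"
      using rep_mult st rep_M by (simp add: V_def)
    then show ?thesis using a b by (intro bexI[of _ "a * b"]) (auto intro: p_roots_mult)
  qed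
  then obtain \<alpha> where \<alpha>: "\<And>s t. s \<in> M \<Longrightarrow> t \<in> M \<Longrightarrow> \<alpha> s t \<in> \<mu> \<and> V s * V t = \<alpha> s t *s V (s \<otimes> t)"
    by metis
  have \<alpha>_rep: "\<alpha> s (rep t) = \<alpha> s t" "\<alpha> (rep s) t = \<alpha> s t" if st: "s \<in> M" "t \<in> M" for s t
  proof -
    have "V (rep t) = V t" "V (rep s) = V s" "V (s \<otimes> rep t) = V (s \<otimes> t)" "V (rep s \<otimes> t) = V (s \<otimes> t)"
      using rep_rep rep_mult st by (simp_all add: V_def)
    then have "\<alpha> s (rep t) *s V (s \<otimes> t) = \<alpha> s t *s V (s \<otimes> t)" "\<alpha> (rep s) t *s V (s \<otimes> t) = \<alpha> s t *s V (s \<otimes> t)"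
      using \<alpha>[of s "rep t"] \<alpha>[of s t] \<alpha>[of "rep s" t] st rep_M by metis+
    then show "\<alpha> s (rep t) = \<alpha> s t" "\<alpha> (rep s) t = \<alpha> s t" using V0[OF Mm[OF st]] by simp_all
  qed
  have cocycle: "\<alpha> s t * \<alpha> (s \<otimes> t) k = \<alpha> t k * \<alpha> s (t \<otimes> k)" if stk: "s \<in> M" "t \<in> M" "k \<in> M" for s t k
  proof -
    have "(V s * V t) * V k = V s * (V t * V k)" by (simp add: mult.assoc)
    then have "(\<alpha> s t * \<alpha> (s \<otimes> t) k) *s V (s \<otimes> t \<otimes> k) = (\<alpha> t k * \<alpha> s (t \<otimes> k)) *s V (s \<otimes> (t \<otimes> k))"
      using \<alpha> stk Mm by simp
    then show ?thesis using V0[OF Mm[OF Mm[OF stk(1,2)] stk(3)]] stk Mc by (simp add: m_assoc)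
  qed
  define \<beta> where "\<beta> s = (\<Prod>k\<in>R. \<alpha> s k)" for s
  have \<beta>_mu: "\<beta> s \<in> \<mu>" if "s \<in> M" for s unfolding \<beta>_def using \<alpha> that R_M by (intro p_roots_prod) blast
  \<comment> \<open>Left translation by \<open>t\<close> permutes the cosets, and \<open>rep\<close>
    brings the translated elements back into \<open>R\<close>.\<close>
  have shift: "(\<Prod>k\<in>R. \<alpha> s (t \<otimes> k)) = \<beta> s" if st: "s \<in> M" "t \<in> M" for s t
  proof -
    have "(\<Prod>k\<in>R. \<alpha> s (t \<otimes> k)) = (\<Prod>k\<in>R. \<alpha> s (rep (t \<otimes> k)))"
      using st R_M Mm by (intro prod.cong) (auto simp: \<alpha>_rep)
    also have "\<dots> = (\<Prod>k\<in>R. \<alpha> s k)"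
    proof (rule prod.reindex_bij_witness[where i = "\<lambda>k. rep (inv t \<otimes> k)" and j = "\<lambda>k. rep (t \<otimes> k)"])
      fix k assume k: "k \<in> R"
      note kM = R_M[OF k]
      show "rep (inv t \<otimes> rep (t \<otimes> k)) = k" "rep (t \<otimes> rep (inv t \<otimes> k)) = k"
        using rep_mult(1)[of "inv t" "t \<otimes> k"] rep_mult(1)[of t "inv t \<otimes> k"] kM st Mi Mm Mc by (simp_all add: inv_cancel)
      show "rep (t \<otimes> k) \<in> R" "rep (inv t \<otimes> k) \<in> R" using kM st Mi Mm by (auto simp: R_def)
    qed simp
    finally show ?thesis by (simp add: \<beta>_def)
  qed
  have \<alpha>r: "\<alpha> s t ^ r * \<beta> (s \<otimes> t) = \<beta> t * \<beta> s" if st: "s \<in> M" "t \<in> M" for s t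
  proof -
    have "\<alpha> s t ^ r * \<beta> (s \<otimes> t) = (\<Prod>k\<in>R. \<alpha> s t * \<alpha> (s \<otimes> t) k)"
      by (simp add: prod.distrib \<beta>_def cardR)
    also have "\<dots> = (\<Prod>k\<in>R. \<alpha> t k * \<alpha> s (t \<otimes> k))"
      using cocycle st R_M by (intro prod.cong) auto
    also have "\<dots> = \<beta> t * \<beta> s" using shift[OF st] by (simp add: prod.distrib \<beta>_def)
    finally show ?thesis .
  qed
  define FA where "FA = (\<lambda>(s, t). \<alpha> s t) ` (M \<times> M)"
  have "finite FA" "FA \<subseteq> \<mu>" using finM \<alpha> by (auto simp: FA_def)
  from p_roots_finite_exponent[OF this] obtain a where "\<forall>z\<in>FA. z ^ (p ^ a) = 1" by blast
  then have a: "\<alpha> s t ^ (p ^ a) = 1" if "s \<in> M" "t \<in> M" for s t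
    using that by (auto simp: FA_def)
  have "coprime r (p ^ a)" using cop by (simp add: coprime_commute)
  then obtain i where "[r * i = Suc 0] (mod p ^ a)" using cong_solve_coprime_nat by blast
  then have i: "[r * i = 1] (mod p ^ a)" by simp
  have \<alpha>ri: "(\<alpha> s t ^ r) ^ i = \<alpha> s t" if "s \<in> M" "t \<in> M" for s t
    using power_eq_of_cong[OF a[OF that] i] by (simp add: power_mult)
  define \<nu> where "\<nu> s = inverse (\<beta> s ^ i)" for s
  have \<nu>_mu: "\<nu> s \<in> \<mu>" if "s \<in> M" for s
    unfolding \<nu>_def using \<beta>_mu[OF that] by (intro p_roots_inverse p_roots_power)
  have \<nu>_mult: "\<nu> (s \<otimes> t) = \<nu> s * \<nu> t * \<alpha> s t" if st: "s \<in> M" "t \<in> M" for s t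
  proof -
    have "\<alpha> s t * \<beta> (s \<otimes> t) ^ i = \<beta> t ^ i * \<beta> s ^ i"
      using \<alpha>r[OF st] \<alpha>ri[OF st] by (metis power_mult_distrib)
    moreover have "\<beta> (s \<otimes> t) \<noteq> 0" "\<beta> s \<noteq> 0" "\<beta> t \<noteq> 0" using \<beta>_mu st Mm mu_nonzero by auto
    ultimately show ?thesis by (simp add: \<nu>_def field_simps)
  qed
  obtain cc where cc: "\<And>t. t \<in> M \<Longrightarrow> cc t \<in> \<mu> \<and> u t = cc t *s V t" using VN by metis
  define l where "l t = \<nu> t / cc t" for t
  have lu: "l t *s u t = \<nu> t *s V t" if "t \<in> M" for t
    using cc[OF that] mu_nonzero by (auto simp: l_def)
  have lmult: "(l m *s u m) * (l h *s u h) = l (m \<otimes> h) *s u (m \<otimes> h)" if mh: "m \<in> M" "h \<in> M" for m h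
    using \<alpha>[OF mh] \<nu>_mult[OF mh] by (simp add: lu mh Mm mult_ac)
  have "l n *s u n = f" if n: "n \<in> N" for n
  proof -
    have nM: "n \<in> M" "\<one> \<in> M" using n NM subgroup.one_closed[OF sN] by auto
    have "N #> n = N #> \<one>"
      using n coset_mult_one[OF subgroup.subset[OF sN]] coset_join2[OF _ sN n] Mc nM by simp
    then have rn: "rep n = rep \<one>" by (rule rep_eqI[OF nM])
    have "\<beta> n = \<beta> \<one>"
      unfolding \<beta>_def
    proof (rule prod.cong[OF refl])
      fix k assume "k \<in> R"
      then show "\<alpha> n k = \<alpha> \<one> k"
        using \<alpha>_rep(2)[OF nM(1), of k] \<alpha>_rep(2)[OF nM(2), of k] rn R_M by simp
    qed
    then have eq: "l n *s u n = l \<one> *s u \<one>" using rn by (simp add: lu nM \<nu>_def V_def)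
    obtain z where z: "z \<in> \<mu>" "u \<one> = z *s f" using uN subgroup.one_closed[OF sN] by blast
    define d where "d = l \<one> * z"
    have d: "l \<one> *s u \<one> = d *s f" by (simp add: d_def z)
    \<comment> \<open>The corrected element at the identity is a nonzero scalar multiple of
      \<open>f\<close> and idempotent, hence equal to \<open>f\<close>.\<close>
    have "(d *s f) * (d *s f) = d *s f" using lmult[OF nM(2) nM(2)] d by simp
    then have "d * d = d" using f_nonzero by simp
    moreover have "d \<noteq> 0"
      using z(1) cc[OF nM(2)] \<nu>_mu[OF nM(2)] mu_nonzero by (simp add: d_def l_def)
    ultimately show ?thesis using eq d by simp
  qed
  moreover have "l m \<in> \<mu>" if "m \<in> M" for m
    unfolding l_def using cc[OF that] \<nu>_mu[OF that] by (intro p_roots_divide) auto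
  ultimately have "twisted_rep_char G scale p K AK \<tau> T N f u M l"
    using MT NM lmult by unfold_locales auto
  then show ?thesis by blast
qed

end

section \<open>The algebra \<open>B\<close> of a nondegenerate section\<close>

lemma (in group) transversal_exists:
  assumes nm: "normal_in N M" and fin: "finite M"
  shows "\<exists>R. R \<subseteq> M \<and> card R * card N = card M \<and> (\<forall>m\<in>M. \<exists>r\<in>R. \<exists>n\<in>N. m = n \<otimes> r) \<and>
    (\<forall>r\<in>R. \<forall>s\<in>R. inv r \<otimes> s \<in> N \<longrightarrow> r = s)"
proof -
  note d = normal_inD[OF nm]
  have Mc: "m \<in> carrier G" if "m \<in> M" for m using subgroup.mem_carrier[OF d(2) that] .
  have Nc: "n \<in> carrier G" if "n \<in> N" for n using subgroup.mem_carrier[OF d(1) that] .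
  obtain rep where rep_ex: "\<And>t. t \<in> M \<Longrightarrow> \<exists>n\<in>N. rep t = n \<otimes> t"
    and rep_eqI: "\<And>s t. s \<in> M \<Longrightarrow> t \<in> M \<Longrightarrow> N #> s = N #> t \<Longrightarrow> rep s = rep t"
    and card_rep: "card (rep ` M) * card N = card M"
    using coset_representatives[OF nm fin] by metis
  have sub: "rep m \<in> M" if m: "m \<in> M" for m
  proof -
    obtain n where n: "n \<in> N" "rep m = n \<otimes> m" using rep_ex[OF m] by blast
    then show ?thesis using subgroup.m_closed[OF d(2) subsetD[OF d(3)] m] by simp
  qed
  have coset: "N #> rep m = N #> m" if m: "m \<in> M" for m
  proof -
    obtain n where n: "n \<in> N" "rep m = n \<otimes> m" using rep_ex[OF m] by blast
    then show ?thesis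
      using coset_mult_assoc[OF subgroup.subset[OF d(1)] Nc[OF n(1)] Mc[OF m]]
        coset_join2[OF Nc[OF n(1)] d(1) n(1)] by simp
  qed
  show ?thesis
  proof (intro exI[of _ "rep ` M"] conjI ballI impI)
    show "rep ` M \<subseteq> M" using sub by blast
    show "card (rep ` M) * card N = card M" by (rule card_rep)
    fix m assume m: "m \<in> M"
    obtain n where n: "n \<in> N" "rep m = n \<otimes> m" using rep_ex[OF m] by blast
    then have "m = inv n \<otimes> rep m" using Nc Mc m by (simp add: inv_cancel)
    then show "\<exists>r\<in>rep ` M. \<exists>n\<in>N. m = n \<otimes> r"
      using m subgroup.m_inv_closed[OF d(1) n(1)] by blast
  next
    fix r s assume "r \<in> rep ` M" "s \<in> rep ` M" and n: "inv r \<otimes> s \<in> N"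
    then obtain x y where xy: "x \<in> M" "y \<in> M" "r = rep x" "s = rep y" by blast
    have c: "r \<in> M" "s \<in> M" "r \<in> carrier G" "s \<in> carrier G" using xy sub Mc by auto
    have "r \<otimes> (inv r \<otimes> s) \<otimes> inv r \<in> N" using d(4) n c by blast
    then have "s \<otimes> inv r \<in> N" using c by (simp add: inv_cancel)
    then have "N #> s = N #> r"
      using coset_mult_inv1[OF coset_join2[OF _ d(1)]] c subgroup.subset[OF d(1)] by simp
    then have "N #> x = N #> y" unfolding xy(3,4) coset[OF xy(1)] coset[OF xy(2)] by (rule sym)
    then show "r = s" unfolding xy(3,4) by (rule rep_eqI[OF xy(1,2)])
  qed
qed

lemma (in twisted_rep) twisted_rep_subgroup:
  assumes "subgroup S G" "N \<subseteq> S" "S \<subseteq> T"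
  shows "twisted_rep G scale p K AK \<tau> S N f u"
proof unfold_locales
  show "normal_in N S" using normal_in_mono[OF NT assms] .
qed (use assms \<tau>f uN in \<open>auto simp: f_AK u_AK uu \<tau>u subsetD\<close>)

text \<open>As M / N is abelian, the \<open>u m\<close> commute up to scalars.
  \<open>nondegenerate\<close> says that this commutator pairing has trivial radical; it is the
  reason that only scalars are central in the span of the \<open>u m\<close>.\<close>

locale twisted_rep_pairing = twisted_rep_normal +
  fixes k :: nat
  assumes card_MN: "card M = p ^ k * card N"
    and MN_abelian: "m \<in> M \<Longrightarrow> h \<in> M \<Longrightarrow> m \<otimes> h \<otimes> inv m \<otimes> inv h \<in> N"
    and nondegenerate: "m \<in> M \<Longrightarrow> (\<And>h. h \<in> M \<Longrightarrow> u m * u h = u h * u m) \<Longrightarrow> m \<in> N"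
begin

lemma normal_in_between:
  assumes "subgroup A G" "N \<subseteq> A" "A \<subseteq> C" "C \<subseteq> M" "subgroup C G"
  shows "normal_in A C"
proof -
  have "c \<otimes> x \<otimes> inv c \<in> A" if "c \<in> C" "x \<in> A" for c x
  proof -
    have cx: "c \<in> carrier G" "x \<in> carrier G" "c \<in> M" "x \<in> M"
      using that assms(3,4) M_carrier by auto
    have "c \<otimes> x \<otimes> inv c \<otimes> inv x \<in> A" using MN_abelian cx assms(2) by blast
    then have "c \<otimes> x \<otimes> inv c \<otimes> inv x \<otimes> x \<in> A" using that subgroup.m_closed[OF assms(1)] by blast
    then show ?thesis using cx by (simp add: m_assoc)
  qed
  then show ?thesis using assms by (simp add: normal_in_def)
qed

lemma u_commute:
  assumes m: "m \<in> M" and h: "h \<in> M"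
  shows "\<exists>z\<in>\<mu>. u m * u h = z *s (u h * u m)"
proof -
  let ?n = "m \<otimes> h \<otimes> inv m \<otimes> inv h"
  have c: "m \<in> carrier G" "h \<in> carrier G" using m h M_carrier by auto
  have eq: "m \<otimes> h = ?n \<otimes> (h \<otimes> m)" using c by (simp add: m_assoc inv_cancel)
  have n: "?n \<in> N" by (rule MN_abelian[OF m h])
  have T: "m \<in> T" "h \<in> T" "?n \<in> T" "h \<otimes> m \<in> T" using m h M_T n N_T by auto
  obtain a1 where a: "a1 \<in> \<mu>" "u m * u h = a1 *s u (m \<otimes> h)" using uu T by blast
  obtain a2 where b: "a2 \<in> \<mu>" "u (?n \<otimes> (h \<otimes> m)) = a2 *s (u ?n * u (h \<otimes> m))" using u_mult[OF T(3,4)] by blast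
  obtain a3 where c: "a3 \<in> \<mu>" "u ?n = a3 *s f" using uN n by blast
  obtain a4 where d: "a4 \<in> \<mu>" "u (h \<otimes> m) = a4 *s (u h * u m)" using u_mult T by blast
  have "u m * u h = (a1 * a2 * a3 * a4) *s (u h * u m)"
    using a b c d T by (simp add: eq[symmetric] ufx fuN)
  then show ?thesis using a b c d p_roots_mult by blast
qed

definition \<kappa> :: "'a \<Rightarrow> 'a \<Rightarrow> complex" where
  "\<kappa> m h = (SOME z. z \<in> \<mu> \<and> u m * u h = z *s (u h * u m))"

lemma \<kappa>: "m \<in> M \<Longrightarrow> h \<in> M \<Longrightarrow> \<kappa> m h \<in> \<mu>" "m \<in> M \<Longrightarrow> h \<in> M \<Longrightarrow> u m * u h = \<kappa> m h *s (u h * u m)"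
proof -
  assume "m \<in> M" "h \<in> M"
  then have "\<exists>z. z \<in> \<mu> \<and> u m * u h = z *s (u h * u m)" using u_commute by blast
  from someI_ex[OF this] show "\<kappa> m h \<in> \<mu>" "u m * u h = \<kappa> m h *s (u h * u m)"
    unfolding \<kappa>_def by blast+
qed

lemma u_conj_M:
  assumes "m \<in> M" "h \<in> M" shows "u m * u h * w m = \<kappa> m h *s u h"
  using \<kappa>[OF assms] w[OF M_T[OF assms(1)]] assms M_T by (simp add: mult.assoc)

lemma \<kappa>_eqI:
  assumes "m \<in> M" "h \<in> M" "u m * u h * w m = z *s u h" shows "\<kappa> m h = z"
  using u_conj_M[OF assms(1,2)] assms u_nonzero[OF M_T[OF assms(2)]] by simp

lemma w_mult:
  assumes "s \<in> T" "t \<in> T" "u (s \<otimes> t) = z *s (u s * u t)" "z \<noteq> 0"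
  shows "w (s \<otimes> t) = inverse z *s (w t * w s)"
proof -
  let ?x = "inverse z *s (w t * w s)"
  have "u (s \<otimes> t) * ?x = f" using assms by (simp add: uw_simps)
  then have "w (s \<otimes> t) * (u (s \<otimes> t) * ?x) = w (s \<otimes> t)" using w assms by simp
  then have "f * ?x = w (s \<otimes> t)" using w(3)[of "s \<otimes> t"] assms by (metis T_mult mult.assoc)
  then show ?thesis using assms by (simp add: wx)
qed

lemma \<kappa>_mult:
  assumes "m \<in> M" "m' \<in> M" "h \<in> M"
  shows "\<kappa> (m \<otimes> m') h = \<kappa> m h * \<kappa> m' h"
proof -
  have T: "m \<in> T" "m' \<in> T" "h \<in> T" using assms M_T by auto
  obtain z where z: "z \<in> \<mu>" "u (m \<otimes> m') = z *s (u m * u m')" using u_mult T by blast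
  have z0: "z \<noteq> 0" using mu_nonzero z by blast
  have wz: "w (m \<otimes> m') = inverse z *s (w m' * w m)" by (rule w_mult[OF T(1,2) z(2) z0])
  have "u (m \<otimes> m') * u h * w (m \<otimes> m') = u m * (u m' * u h * w m') * w m"
    unfolding z(2) wz using z0 by (simp add: mult.assoc)
  also have "\<dots> = (\<kappa> m' h * \<kappa> m h) *s u h"
    unfolding u_conj_M[OF assms(2,3)] using u_conj_M[OF assms(1,3)] by simp
  finally show ?thesis using \<kappa>_eqI assms by (simp add: mult.commute)
qed

text \<open>For fixed \<open>h\<close> outside \<open>N\<close> the pairing is a nontrivial
  character of \<open>M\<close>, and translation by an element where it is not 1 shows that its sum
  vanishes.\<close>

lemma \<kappa>_sum:
  assumes h: "h \<in> M" "h \<notin> N"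
  shows "(\<Sum>m\<in>M. \<kappa> m h) = 0"
proof -
  obtain m0 where m0: "m0 \<in> M" "u h * u m0 \<noteq> u m0 * u h" using nondegenerate h by metis
  then have k: "\<kappa> m0 h \<noteq> 1" using \<kappa>(2)[OF m0(1) h(1)] by auto
  have "(\<Sum>m\<in>M. \<kappa> m h) = (\<Sum>m\<in>M. \<kappa> (m0 \<otimes> m) h)"
    by (rule sum.reindex_bij_witness[where j = "\<lambda>h. inv m0 \<otimes> h" and i = "\<lambda>h. m0 \<otimes> h"])
       (use m0 M_carrier in \<open>auto simp: inv_cancel\<close>)
  also have "\<dots> = \<kappa> m0 h * (\<Sum>m\<in>M. \<kappa> m h)" using m0 h by (simp add: \<kappa>_mult sum_distrib_left)
  finally show ?thesis using k by (metis mult_cancel_right1)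
qed

abbreviation "B \<equiv> span (u ` M)"

lemma u_B: "m \<in> M \<Longrightarrow> u m \<in> B" by (simp add: span_base)
lemma B_mult: "x \<in> B \<Longrightarrow> y \<in> B \<Longrightarrow> x * y \<in> B" by (rule span_u_mult[OF M_sub_T]) auto
lemma f_B: "f \<in> B" by (rule f_span) simp
lemma w_B: "m \<in> M \<Longrightarrow> w m \<in> B" using w(6)[OF M_T] by (metis M_inv span_scale u_B)

lemma fB: "x \<in> B \<Longrightarrow> f * x = x"
  by (induction rule: span_induct_alt) (auto simp: distrib_left M_T)

lemma Bf: "x \<in> B \<Longrightarrow> x * f = x"
  by (induction rule: span_induct_alt) (auto simp: distrib_right M_T)

text \<open>Averaging over conjugation kills every \<open>u h\<close> with \<open>h\<close> outside
  \<open>N\<close>, by orthogonality, and fixes the scalars. The functional \<tau> sees exactly the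
  surviving part.\<close>

lemma B_average:
  assumes "x \<in> B"
  shows "(\<Sum>m\<in>M. u m * x * w m) = (of_nat (card M) * \<tau> x / \<tau> f) *s f"
  using assms
proof (induction rule: span_induct_alt)
  case base
  then show ?case by simp
next
  case (step c a y)
  then obtain h where h: "h \<in> M" "a = u h" by blast
  have "(\<Sum>m\<in>M. u m * u h * w m) = (of_nat (card M) * \<tau> (u h) / \<tau> f) *s f"
  proof (cases "h \<in> N")
    case True
    then obtain z where z: "u h = z *s f" using uN by blast
    have "(\<Sum>m\<in>M. u m * u h * w m) = (\<Sum>m\<in>M. z *s f)"
      by (rule sum.cong) (auto simp: z M_T w)
    also have "\<dots> = (of_nat (card M) * z) *s f" by (simp add: sum_constant_scale del: sum_constant)
    finally show ?thesis using \<tau>f z by simp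
  next
    case False
    have "(\<Sum>m\<in>M. u m * u h * w m) = (\<Sum>m\<in>M. \<kappa> m h) *s u h"
      using h by (simp add: u_conj_M scale_sum_left)
    then show ?thesis using \<kappa>_sum[OF h(1) False] \<tau>u[of h] h False M_T by simp
  qed
  then have "(\<Sum>m\<in>M. u m * (c *s a + y) * w m) =
     c *s ((of_nat (card M) * \<tau> a / \<tau> f) *s f) + (of_nat (card M) * \<tau> y / \<tau> f) *s f"
    using step.IH by (simp add: h distrib_left distrib_right sum.distrib scale_sum_right[symmetric])
  also have "\<dots> = (of_nat (card M) * \<tau> (c *s a + y) / \<tau> f) *s f"
  proof -
    have "of_nat (card M) * \<tau> (c *s a + y) / \<tau> f
        = c * (of_nat (card M) * \<tau> a / \<tau> f) + of_nat (card M) * \<tau> y / \<tau> f"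
      by (simp add: \<tau>_add add_divide_distrib distrib_left)
    then show ?thesis by (simp only: scale_left_distrib scale_scale)
  qed
  finally show ?case .
qed

lemma B_center:
  assumes x: "x \<in> B" and c: "\<And>m. m \<in> M \<Longrightarrow> u m * x = x * u m"
  shows "x = (\<tau> x / \<tau> f) *s f"
proof -
  have "u m * x * w m = x" if "m \<in> M" for m
    using c[OF that] w(2)[OF M_T[OF that]] Bf[OF x] by (simp add: mult.assoc)
  then have "of_nat (card M) *s x = of_nat (card M) *s ((\<tau> x / \<tau> f) *s f)"
    using B_average[OF x] by (simp add: sum_constant_scale del: sum_constant)
  then show ?thesis using card_M by (simp del: scale_scale)
qed

text \<open>A transversal of \<open>N\<close> in \<open>M\<close>, arranged as a list so that the
  positions below \<open>p ^ k\<close> index the basis \<open>u (rs ! i)\<close> of \<open>B\<close>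
  and the rows and columns of matrices.\<close>

definition rs :: "'a list" where
  "rs = (SOME rs. distinct rs \<and> set rs \<subseteq> M \<and> length rs = p ^ k \<and>
    (\<forall>m\<in>M. \<exists>r\<in>set rs. \<exists>n\<in>N. m = n \<otimes> r) \<and> (\<forall>r\<in>set rs. \<forall>s\<in>set rs. inv r \<otimes> s \<in> N \<longrightarrow> r = s))"

lemma rs: "distinct rs" "set rs \<subseteq> M" "length rs = p ^ k"
  "\<And>m. m \<in> M \<Longrightarrow> \<exists>r\<in>set rs. \<exists>n\<in>N. m = n \<otimes> r"
  "\<And>r s. r \<in> set rs \<Longrightarrow> s \<in> set rs \<Longrightarrow> inv r \<otimes> s \<in> N \<Longrightarrow> r = s"
proof -
  obtain R where R: "R \<subseteq> M" "card R * card N = card M" "\<forall>m\<in>M. \<exists>r\<in>R. \<exists>n\<in>N. m = n \<otimes> r"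
    "\<forall>r\<in>R. \<forall>s\<in>R. inv r \<otimes> s \<in> N \<longrightarrow> r = s"
    using transversal_exists[OF nNM finite_M] by blast
  have "card N \<noteq> 0"
    using finite_subset[OF NM finite_M] subgroup.one_closed[OF sN] by auto
  then have cR: "card R = p ^ k" using R(2) card_MN by simp
  have "finite R" using finite_subset[OF R(1) finite_M] .
  then obtain xs where xs: "set xs = R" "distinct xs" using finite_distinct_list by blast
  then have "length xs = p ^ k" using cR distinct_card by metis
  then have ex: "\<exists>rs. distinct rs \<and> set rs \<subseteq> M \<and> length rs = p ^ k \<and>
    (\<forall>m\<in>M. \<exists>r\<in>set rs. \<exists>n\<in>N. m = n \<otimes> r) \<and> (\<forall>r\<in>set rs. \<forall>s\<in>set rs. inv r \<otimes> s \<in> N \<longrightarrow> r = s)"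
    using xs R by (intro exI[of _ xs]) simp
  note * = someI_ex[OF ex, folded rs_def]
  show "distinct rs" "set rs \<subseteq> M" "length rs = p ^ k"
    "\<And>m. m \<in> M \<Longrightarrow> \<exists>r\<in>set rs. \<exists>n\<in>N. m = n \<otimes> r"
    "\<And>r s. r \<in> set rs \<Longrightarrow> s \<in> set rs \<Longrightarrow> inv r \<otimes> s \<in> N \<Longrightarrow> r = s"
    using * by blast+
qed

lemma rs_M: "i < p ^ k \<Longrightarrow> rs ! i \<in> M" using rs by (metis nth_mem subsetD)

text \<open>Up to the factor \<open>\<tau> f\<close>, the elements \<open>w (rs ! i)\<close> are
  dual to the basis of \<open>B\<close> under \<tau>; this is the source of the coordinates in
  \<open>B_expand\<close> and of the matrix \<open>L\<close>.\<close>

lemma \<tau>_wu: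
  assumes "i < p ^ k" "j < p ^ k"
  shows "\<tau> (w (rs ! i) * u (rs ! j)) = (if i = j then \<tau> f else 0)"
proof (cases "i = j")
  case True
  then show ?thesis using w(3) M_T rs_M assms by simp
next
  case False
  let ?r = "rs ! i" and ?s = "rs ! j"
  have T: "?r \<in> T" "?s \<in> T" using rs_M assms M_T by auto
  obtain z where z: "w ?r = z *s u (inv ?r)" using w(6) T by blast
  obtain y where y: "u (inv ?r) * u ?s = y *s u (inv ?r \<otimes> ?s)" using uu[of "inv ?r" ?s] T by auto
  have "?r \<noteq> ?s" using False assms rs(1,3) by (simp add: nth_eq_iff_index_eq)
  then have "inv ?r \<otimes> ?s \<notin> N" using rs(5)[of ?r ?s] assms rs(3) by auto
  then have "\<tau> (u (inv ?r \<otimes> ?s)) = 0" using T by (intro \<tau>u) auto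
  then show ?thesis using z y False by simp
qed

lemma B_expand:
  assumes "x \<in> B"
  shows "x = (\<Sum>i<p ^ k. (\<tau> (w (rs ! i) * x) / \<tau> f) *s u (rs ! i))"
  using assms
proof (induction rule: span_induct_alt)
  case base
  then show ?case by simp
next
  case (step c a y)
  then obtain m where m: "m \<in> M" "a = u m" by blast
  obtain r n where r: "r \<in> set rs" "n \<in> N" "m = n \<otimes> r" using rs(4)[OF m(1)] by blast
  obtain j where j: "j < p ^ k" "r = rs ! j" using r rs(3) by (metis in_set_conv_nth)
  have T: "n \<in> T" "r \<in> T" using r N_T rs(2) M_T by auto
  obtain z1 where z1: "u m = z1 *s (u n * u r)" using u_mult T r by blast
  obtain z2 where z2: "u n = z2 *s f" using uN r by blast
  define z where "z = z1 * z2"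
  have a: "a = z *s u (rs ! j)" using z1 z2 T m j by (simp add: z_def)
  have "(\<Sum>i<p ^ k. (\<tau> (w (rs ! i) * a) / \<tau> f) *s u (rs ! i)) =
      (\<Sum>i<p ^ k. if i = j then z *s u (rs ! j) else 0)"
    by (rule sum.cong) (use j \<tau>f in \<open>auto simp: a \<tau>_wu\<close>)
  also have "\<dots> = a" using j a by simp
  finally have A: "a = (\<Sum>i<p ^ k. (\<tau> (w (rs ! i) * a) / \<tau> f) *s u (rs ! i))" by simp
  have "(\<Sum>i<p ^ k. (\<tau> (w (rs ! i) * (c *s a + y)) / \<tau> f) *s u (rs ! i)) =
     c *s (\<Sum>i<p ^ k. (\<tau> (w (rs ! i) * a) / \<tau> f) *s u (rs ! i)) +
     (\<Sum>i<p ^ k. (\<tau> (w (rs ! i) * y) / \<tau> f) *s u (rs ! i))"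
    by (simp add: distrib_left \<tau>_add add_divide_distrib scale_left_distrib sum.distrib scale_sum_right)
  also have "\<dots> = c *s a + y" using A step.IH by simp
  finally show ?case by simp
qed

lemma B_nonzero:
  assumes "x \<in> B" "x \<noteq> 0"
  shows "\<exists>h\<in>M. \<tau> (u h * x) \<noteq> 0"
proof (rule ccontr)
  assume a: "\<not> ?thesis"
  have "\<tau> (w (rs ! i) * x) = 0" if i: "i < p ^ k" for i
  proof -
    obtain z where "w (rs ! i) = z *s u (inv (rs ! i))" using w(6) M_T rs_M i by blast
    then show ?thesis using a rs_M[OF i] by simp
  qed
  then have "x = 0" using B_expand[OF assms(1)] by simp
  then show False using assms by simp
qed

text \<open>\<open>D\<close> is the determinant of the left multiplication on \<open>B\<close> with respect to the basis given by \<open>rs\<close>,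
  \<open>L\<close> being its matrix. The size \<open>p\<^sup>k\<close> of this matrix makes \<open>D\<close> useful for normalizing scalars modulo
  \<open>p\<close>-power roots of unity.\<close>

definition L :: "'c \<Rightarrow> complex mat" where
  "L x = mat (p ^ k) (p ^ k) (\<lambda>(i, j). \<tau> (w (rs ! i) * x * u (rs ! j)) / \<tau> f)"

definition D :: "'c \<Rightarrow> complex" where "D x = det (L x)"

lemma L_carrier: "L x \<in> carrier_mat (p ^ k) (p ^ k)" by (simp add: L_def)

lemma L_mult:
  assumes x: "x \<in> B" and y: "y \<in> B"
  shows "L (x * y) = L x * L y"
proof (rule eq_matI)
  fix i j assume "i < dim_row (L x * L y)" "j < dim_col (L x * L y)"
  then have ij: "i < p ^ k" "j < p ^ k" by (auto simp: L_def)
  have yB: "y * u (rs ! j) \<in> B" using B_mult y u_B rs_M ij by simp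
  have "w (rs ! i) * (x * y) * u (rs ! j) = w (rs ! i) * x * (y * u (rs ! j))"
    by (simp add: mult.assoc)
  also have "\<dots> = (\<Sum>l<p ^ k. (\<tau> (w (rs ! l) * (y * u (rs ! j))) / \<tau> f) *s (w (rs ! i) * x * u (rs ! l)))"
    by (subst B_expand[OF yB]) (simp add: sum_distrib_left)
  finally have "\<tau> (w (rs ! i) * (x * y) * u (rs ! j)) / \<tau> f =
    (\<Sum>l<p ^ k. (\<tau> (w (rs ! i) * x * u (rs ! l)) / \<tau> f) * (\<tau> (w (rs ! l) * y * u (rs ! j)) / \<tau> f))"
    by (simp add: \<tau>_sum sum_divide_distrib mult.assoc mult.commute)
  then show "L (x * y) $$ (i, j) = (L x * L y) $$ (i, j)"
    using ij by (simp add: L_def scalar_prod_def lessThan_atLeast0)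
qed (simp_all add: L_def)

lemma D_mult: "x \<in> B \<Longrightarrow> y \<in> B \<Longrightarrow> D (x * y) = D x * D y"
  unfolding D_def by (simp add: L_mult det_mult[OF L_carrier L_carrier])

lemma D_scale: "D (c *s x) = c ^ (p ^ k) * D x"
proof -
  have "L (c *s x) = c \<cdot>\<^sub>m L x" by (rule eq_matI) (simp_all add: L_def)
  then show ?thesis by (simp add: D_def L_def)
qed

lemma D_f: "D f = 1"
proof -
  have "L f = 1\<^sub>m (p ^ k)"
  proof (rule eq_matI)
    fix i j assume "i < dim_row (1\<^sub>m (p ^ k) :: complex mat)" "j < dim_col (1\<^sub>m (p ^ k) :: complex mat)"
    then show "L f $$ (i, j) = 1\<^sub>m (p ^ k) $$ (i, j)"
      using \<tau>_wu \<tau>f rs_M M_T w by (simp add: L_def)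
  qed (simp_all add: L_def)
  then show ?thesis by (simp add: D_def)
qed

lemma D_scalar: "D (c *s f) = c ^ (p ^ k)" by (simp add: D_scale D_f)

lemma D_K:
  assumes "x \<in> AK" shows "D x \<in> K"
proof -
  have ent: "L x $$ (i, j) \<in> K" if "i < p ^ k" "j < p ^ k" for i j
    using that assms rs_M M_T u_AK w(1) f_AK
    by (auto simp: L_def intro!: K_divide \<tau>_K AK_mult)
  have sgn: "(signof \<pi> :: complex) \<in> K" for \<pi> :: "nat \<Rightarrow> nat"
    by (auto simp: sign_def intro: K_one K_minus)
  have "D x = (\<Sum>\<pi>\<in>{\<pi>. \<pi> permutes {0..<p ^ k}}. signof \<pi> * (\<Prod>i = 0..<p ^ k. L x $$ (i, \<pi> i)))"
    unfolding D_def by (rule det_def'[OF L_carrier])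
  also have "\<dots> \<in> K"
    by (intro K_sum K_mult sgn K_prod ent) (auto dest: permutes_in_image)
  finally show ?thesis .
qed

end

section \<open>Implementing the automorphisms of \<open>B\<close> by units with controlled
  determinant\<close>

context twisted_rep_pairing
begin

definition \<Phi> :: "'a \<Rightarrow> 'c \<Rightarrow> 'c" where "\<Phi> t x = u t * x * w t"

lemma \<Phi>_add: "\<Phi> t (x + y) = \<Phi> t x + \<Phi> t y" by (simp add: \<Phi>_def distrib_left distrib_right)
lemma \<Phi>_scale: "\<Phi> t (c *s x) = c *s \<Phi> t x" by (simp add: \<Phi>_def)
lemma \<Phi>_zero: "\<Phi> t 0 = 0" by (simp add: \<Phi>_def)
lemma \<Phi>_sum: "\<Phi> t (sum g I) = (\<Sum>i\<in>I. \<Phi> t (g i))"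
  by (simp add: \<Phi>_def sum_distrib_left sum_distrib_right)
lemma \<Phi>_f: "t \<in> T \<Longrightarrow> \<Phi> t f = f" by (simp add: \<Phi>_def w)
lemma \<Phi>_AK: "t \<in> T \<Longrightarrow> x \<in> AK \<Longrightarrow> \<Phi> t x \<in> AK" by (simp add: \<Phi>_def AK_mult u_AK w)

lemma \<Phi>_mult: "t \<in> T \<Longrightarrow> f * y = y \<Longrightarrow> \<Phi> t (x * y) = \<Phi> t x * \<Phi> t y"
  by (simp add: \<Phi>_def wx mult.assoc) (metis mult.assoc)

lemma \<Phi>_u: "t \<in> T \<Longrightarrow> m \<in> M \<Longrightarrow> \<exists>z\<in>\<mu>. \<Phi> t (u m) = z *s u (t \<otimes> m \<otimes> inv t)"
  unfolding \<Phi>_def using u_conj M_T by blast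

lemma \<Phi>_B:
  assumes t: "t \<in> T" and x: "x \<in> B"
  shows "\<Phi> t x \<in> B"
  using x
proof (induction rule: span_induct_alt)
  case base
  then show ?case by (simp add: \<Phi>_zero span_zero)
next
  case (step c a y)
  then obtain m where m: "m \<in> M" "a = u m" by blast
  obtain z where "\<Phi> t (u m) = z *s u (t \<otimes> m \<otimes> inv t)" using \<Phi>_u t m by blast
  then have "\<Phi> t a \<in> B" using M_conj t m by (simp add: span_scale u_B)
  then show ?case using step.IH by (simp add: \<Phi>_add \<Phi>_scale span_add span_scale)
qed

lemma \<Phi>_comp:
  assumes st: "s \<in> T" "t \<in> T"
  shows "\<Phi> s (\<Phi> t x) = \<Phi> (s \<otimes> t) x"
proof -
  obtain z where z: "z \<in> \<mu>" "u (s \<otimes> t) = z *s (u s * u t)" using u_mult st by blast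
  have z0: "z \<noteq> 0" using mu_nonzero z by blast
  show ?thesis unfolding \<Phi>_def z(2) w_mult[OF st z(2) z0] using z0 by (simp add: mult.assoc)
qed

lemma \<Phi>_N: assumes "n \<in> N" "x \<in> B" shows "\<Phi> n x = x"
proof -
  obtain z where z: "z \<in> \<mu>" "u n = z *s f" using uN assms by blast
  have nT: "n \<in> T" using N_T assms by blast
  have "f = z *s w n" using w(2)[OF nT] z w(4)[OF nT] by simp
  then have "w n = inverse z *s f" using mu_nonzero[OF z(1)] by (metis left_inverse scale_one scale_scale)
  then show ?thesis using z mu_nonzero[OF z(1)] assms fB Bf by (simp add: \<Phi>_def)
qed

text \<open>For invertible \<open>X\<close> the condition means that \<open>\<Phi> t\<close> is
  conjugation by \<open>X\<close> on \<open>B\<close>, and \<open>X \<in> AK\<close> that it is so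
  over \<open>K\<close>. The linear form of the condition allows averaging before invertibility is
  known.\<close>

definition intertwines :: "'a \<Rightarrow> 'c \<Rightarrow> bool" where
  "intertwines t X \<longleftrightarrow> X \<in> B \<and> X \<in> AK \<and> (\<forall>m\<in>M. X * u m = \<Phi> t (u m) * X)"

lemma intertwinesD:
  assumes "intertwines t X" "t \<in> T" "x \<in> B"
  shows "X * x = \<Phi> t x * X"
  using assms(3)
proof (induction rule: span_induct_alt)
  case base
  then show ?case by (simp add: \<Phi>_zero)
next
  case (step c a y)
  then show ?case using assms by (auto simp: intertwines_def distrib_left distrib_right \<Phi>_add \<Phi>_scale)
qed

lemma intertwines_mult:
  assumes "intertwines s X" "intertwines t Y" "s \<in> T" "t \<in> T"
  shows "intertwines (s \<otimes> t) (X * Y)"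
proof -
  have B: "X \<in> B" "Y \<in> B" "X \<in> AK" "Y \<in> AK" using assms by (auto simp: intertwines_def)
  have "X * Y * u m = \<Phi> (s \<otimes> t) (u m) * (X * Y)" if m: "m \<in> M" for m
  proof -
    have "X * Y * u m = X * \<Phi> t (u m) * Y"
      using assms(2) m by (simp add: intertwines_def mult.assoc)
    also have "\<dots> = \<Phi> s (\<Phi> t (u m)) * X * Y"
      using intertwinesD[OF assms(1,3) \<Phi>_B[OF assms(4) u_B[OF m]]] by simp
    finally show ?thesis using \<Phi>_comp assms by (simp add: mult.assoc)
  qed
  then show ?thesis using B by (simp add: intertwines_def B_mult AK_mult)
qed

lemma intertwines_scale: "intertwines t X \<Longrightarrow> c \<in> K \<Longrightarrow> intertwines t (c *s X)"
  by (simp add: intertwines_def span_scale AK_scale)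

text \<open>On \<open>B\<close> the map \<open>\<Phi> n\<close> is the identity, so that the
  intertwiner is central in \<open>B\<close> and hence a scalar.\<close>

lemma intertwines_N:
  assumes "n \<in> N" "intertwines n X"
  shows "\<exists>c\<in>K. X = c *s f"
proof -
  have X: "X \<in> B" "X \<in> AK" using assms by (auto simp: intertwines_def)
  have "u m * X = X * u m" if "m \<in> M" for m
    using assms that \<Phi>_N u_B by (simp add: intertwines_def)
  then have "X = (\<tau> X / \<tau> f) *s f" using B_center X by blast
  moreover have "\<tau> X / \<tau> f \<in> K" using \<tau>_K X f_AK K_divide by blast
  ultimately show ?thesis by blast
qed

text \<open>The averaging behind the Skolem-Noether theorem: \<open>M\<close> acts on the left
  through \<open>\<Phi> t\<close> and on the right by inverses, so that the average of any
  \<open>b\<close> is an intertwiner.\<close>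

definition avg :: "'a \<Rightarrow> 'c \<Rightarrow> 'c" where "avg t b = (\<Sum>m\<in>M. \<Phi> t (u m) * b * w m)"

lemma avg_intertwines:
  assumes t: "t \<in> T" and b: "b \<in> B" "b \<in> AK"
  shows "intertwines t (avg t b)"
proof -
  have "avg t b * u h = \<Phi> t (u h) * avg t b" if h: "h \<in> M" for h
  proof -
    have hT: "h \<in> T" using h M_T by blast
    have "avg t b = (\<Sum>m\<in>M. \<Phi> t (u (h \<otimes> m)) * b * w (h \<otimes> m))"
      unfolding avg_def
      by (rule sum.reindex_bij_witness[where j = "\<lambda>m. inv h \<otimes> m" and i = "\<lambda>m. h \<otimes> m"])
         (use h M_carrier in \<open>auto simp: inv_cancel\<close>)
    then have "avg t b * u h = (\<Sum>m\<in>M. \<Phi> t (u (h \<otimes> m)) * b * w (h \<otimes> m) * u h)"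
      by (simp add: sum_distrib_right)
    also have "\<dots> = (\<Sum>m\<in>M. \<Phi> t (u h) * (\<Phi> t (u m) * b * w m))"
    proof (rule sum.cong[OF refl])
      fix m assume m: "m \<in> M"
      then have mT: "m \<in> T" using M_T by blast
      obtain z where z: "z \<in> \<mu>" "u (h \<otimes> m) = z *s (u h * u m)" using u_mult hT mT by blast
      have z0: "z \<noteq> 0" using mu_nonzero z by blast
      have "\<Phi> t (u (h \<otimes> m)) = z *s (\<Phi> t (u h) * \<Phi> t (u m))"
        unfolding z(2) \<Phi>_scale using \<Phi>_mult t mT by simp
      then show "\<Phi> t (u (h \<otimes> m)) * b * w (h \<otimes> m) * u h = \<Phi> t (u h) * (\<Phi> t (u m) * b * w m)"
        unfolding w_mult[OF hT mT z(2) z0] using z0 w[OF hT] w[OF mT] by (simp add: mult.assoc)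
    qed
    finally show ?thesis by (simp add: avg_def sum_distrib_left)
  qed
  moreover have "avg t b \<in> B" unfolding avg_def
    by (intro span_sum B_mult \<Phi>_B t u_B b w_B)
  moreover have "avg t b \<in> AK" unfolding avg_def
    using t b M_T u_AK w by (intro AK_sum AK_mult \<Phi>_AK) auto
  ultimately show ?thesis by (simp add: intertwines_def)
qed

lemma w_N_inverse: assumes n: "n \<in> N" shows "\<exists>z\<in>\<mu>. u n = z *s f \<and> w n = inverse z *s f"
proof -
  obtain z where z: "z \<in> \<mu>" "u n = z *s f" using uN n by blast
  have nT: "n \<in> T" using N_T n by blast
  have "f = z *s w n" using w(2)[OF nT] z w(4)[OF nT] by simp
  then have "w n = inverse z *s f" using mu_nonzero[OF z(1)] by (metis left_inverse scale_one scale_scale)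
  then show ?thesis using z by blast
qed

text \<open>Sum \<open>avg t (u h) * w h\<close> over \<open>h\<close> and evaluate the sum over
  \<open>h\<close> first: by \<open>B_average\<close> only the terms with \<open>m\<close> in
  \<open>N\<close> survive, and the total is \<open>card N * card M\<close> times
  \<open>f\<close>.\<close>

lemma avg_nonzero:
  assumes t: "t \<in> T"
  shows "\<exists>h\<in>M. avg t (u h) \<noteq> 0"
proof (rule ccontr)
  assume "\<not> ?thesis"
  then have "0 = (\<Sum>h\<in>M. avg t (u h) * w h)" by simp
  also have "\<dots> = (\<Sum>m\<in>M. \<Phi> t (u m) * (\<Sum>h\<in>M. u h * w m * w h))"
    unfolding avg_def sum_distrib_right sum_distrib_left
    by (subst sum.swap) (simp add: mult.assoc)
  also have "\<dots> = (\<Sum>m\<in>M. if m \<in> N then of_nat (card M) *s f else 0)"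
  proof (rule sum.cong[OF refl])
    fix m assume m: "m \<in> M"
    have avgm: "(\<Sum>h\<in>M. u h * w m * w h) = (of_nat (card M) * \<tau> (w m) / \<tau> f) *s f"
      using B_average[OF w_B[OF m]] by simp
    show "\<Phi> t (u m) * (\<Sum>h\<in>M. u h * w m * w h) = (if m \<in> N then of_nat (card M) *s f else 0)"
    proof (cases "m \<in> N")
      case True
      then obtain z where z: "z \<in> \<mu>" "u m = z *s f" "w m = inverse z *s f" using w_N_inverse by blast
      then have "z \<noteq> 0" using mu_nonzero by blast
      then show ?thesis unfolding avgm using z True \<tau>f t by (simp add: \<Phi>_scale \<Phi>_f)
    next
      case False
      then have "inv m \<notin> N" using subgroup.m_inv_closed[OF sN, of "inv m"] M_carrier[OF m] by auto
      then have "\<tau> (u (inv m)) = 0" using \<tau>u m M_T by simp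
      then have "\<tau> (w m) = 0" using w(6)[OF M_T[OF m]] by auto
      then show ?thesis unfolding avgm using False by simp
    qed
  qed
  also have "\<dots> = (\<Sum>m\<in>N. of_nat (card M) *s f)"
    using NM finite_M by (simp add: sum.If_cases Int_absorb1)
  also have "\<dots> = (of_nat (card N) * of_nat (card M)) *s f" by (simp add: sum_constant_scale del: sum_constant)
  finally have "card N = 0 \<or> card M = 0" using f_nonzero by auto
  moreover have "card N \<noteq> 0"
    using finite_subset[OF NM finite_M] subgroup.one_closed[OF sN] by auto
  ultimately show False using card_M by simp
qed

text \<open>The first column of \<open>L x\<close> determines the product of \<open>x\<close> with
  the first basis element, which is invertible.\<close>

lemma L_inj:
  assumes x: "x \<in> B" and y: "y \<in> B" and eq: "L x = L y"
  shows "x = y"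
proof -
  have pk: "0 < p ^ k" using p_pos by simp
  have r: "rs ! 0 \<in> M" "rs ! 0 \<in> T" using rs_M[OF pk] M_T by auto
  have "\<tau> (w (rs ! i) * (x * u (rs ! 0))) = \<tau> (w (rs ! i) * (y * u (rs ! 0)))" if "i < p ^ k" for i
  proof -
    have "L x $$ (i, 0) = L y $$ (i, 0)" using eq by simp
    then show ?thesis using that pk \<tau>f by (simp add: L_def mult.assoc)
  qed
  then have "x * u (rs ! 0) = y * u (rs ! 0)"
    using B_expand[OF B_mult[OF x u_B[OF r(1)]]] B_expand[OF B_mult[OF y u_B[OF r(1)]]] by simp
  then have "x * (u (rs ! 0) * w (rs ! 0)) = y * (u (rs ! 0) * w (rs ! 0))" by (metis mult.assoc)
  then show ?thesis using w(2)[OF r(2)] Bf x y by simp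
qed

text \<open>One-sided inverses of square matrices are two-sided, and the faithful matrix map
  \<open>L\<close> transports this to \<open>B\<close>.\<close>

lemma left_inverse_imp_right:
  assumes X: "X \<in> B" and Y: "Y \<in> B" and YX: "Y * X = f"
  shows "X * Y = f"
proof (rule L_inj)
  have "L f = 1\<^sub>m (p ^ k)"
    by (rule eq_matI) (use \<tau>_wu \<tau>f rs_M M_T w in \<open>auto simp: L_def\<close>)
  moreover have "L Y * L X = L f" using L_mult[OF Y X] YX by simp
  ultimately show "L (X * Y) = L f"
    using L_mult[OF X Y] mat_mult_left_right_inverse[OF L_carrier L_carrier, of Y X] by simp
qed (use X Y B_mult f_B in auto)

text \<open>For suitable \<open>h\<close> the average of \<open>u h * X\<close> under conjugation is
  a nonzero scalar. Intertwining moves \<open>X\<close> to the right end of every summand and thus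
  exhibits a left inverse up to this scalar.\<close>

lemma intertwiner_inverse:
  assumes t: "t \<in> T" and X: "intertwines t X" "X \<noteq> 0"
  shows "\<exists>Y. Y \<in> B \<and> Y \<in> AK \<and> X * Y = f \<and> Y * X = f"
proof -
  have XB: "X \<in> B" "X \<in> AK" using X by (auto simp: intertwines_def)
  obtain h where h: "h \<in> M" "\<tau> (u h * X) \<noteq> 0" using B_nonzero XB X(2) by blast
  define c where "c = of_nat (card M) * \<tau> (u h * X) / \<tau> f"
  have c0: "c \<noteq> 0" using h \<tau>f card_M by (simp add: c_def)
  have cK: "c \<in> K" unfolding c_def using h XB u_AK M_T f_AK
    by (intro K_divide K_mult K_of_nat \<tau>_K AK_mult) auto
  define Z where "Z = (\<Sum>m\<in>M. u m * u h * \<Phi> t (w m))"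
  have "Z * X = (\<Sum>m\<in>M. u m * (u h * X) * w m)"
    unfolding Z_def sum_distrib_right
    by (rule sum.cong) (simp_all add: intertwinesD[OF X(1) t w_B] mult.assoc)
  also have "\<dots> = c *s f" unfolding c_def using B_average[OF B_mult[OF u_B[OF h(1)] XB(1)]] .
  finally have ZX: "Z * X = c *s f" .
  have ZB: "Z \<in> B" "Z \<in> AK" unfolding Z_def using h u_AK M_T w t
    by (auto intro!: span_sum AK_sum B_mult AK_mult u_B \<Phi>_B w_B \<Phi>_AK)
  define Y where "Y = inverse c *s Z"
  have YX: "Y * X = f" using ZX c0 by (simp add: Y_def)
  have YB: "Y \<in> B" "Y \<in> AK" unfolding Y_def using ZB cK by (auto intro: span_scale AK_scale K_inverse)
  show ?thesis using YB YX left_inverse_imp_right[OF XB(1) YB(1) YX] by blast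
qed

text \<open>The automorphism \<open>\<Phi> t\<close> of \<open>B\<close> is inner over the ground field, and the implementing unit can be
  normalized to have a \<open>p\<close>-power root of unity as determinant. This is what makes the cocycle of the
  induced projective representation of \<open>T / M\<close> take its values in \<open>\<mu>\<close> again.\<close>

definition realizable :: "'a \<Rightarrow> bool" where
  "realizable t \<longleftrightarrow> (\<exists>X Y. intertwines t X \<and> Y \<in> B \<and> Y \<in> AK \<and> X * Y = f \<and> Y * X = f \<and> D X \<in> \<mu>)"

lemma D_inverse:
  assumes "X \<in> B" "Y \<in> B" "X * Y = f" shows "D X * D Y = 1"
  using D_mult[OF assms(1,2)] assms(3) D_f by simp

lemma intertwiner_exists:
  assumes t: "t \<in> T"
  shows "\<exists>X Y. intertwines t X \<and> Y \<in> B \<and> Y \<in> AK \<and> X * Y = f \<and> Y * X = f"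
proof -
  obtain h where h: "h \<in> M" "avg t (u h) \<noteq> 0" using avg_nonzero[OF t] by blast
  have I: "intertwines t (avg t (u h))" using avg_intertwines[OF t u_B[OF h(1)]] u_AK M_T h by blast
  show ?thesis using intertwiner_inverse[OF t I h(2)] I by blast
qed

lemma realizable_mult:
  assumes s: "s \<in> T" "realizable s" and t: "t \<in> T" "realizable t"
  shows "realizable (s \<otimes> t)"
proof -
  obtain X Y where X: "intertwines s X" "Y \<in> B" "Y \<in> AK" "X * Y = f" "Y * X = f" "D X \<in> \<mu>"
    using s by (auto simp: realizable_def)
  obtain X' Y' where X': "intertwines t X'" "Y' \<in> B" "Y' \<in> AK" "X' * Y' = f" "Y' * X' = f" "D X' \<in> \<mu>"
    using t by (auto simp: realizable_def)
  have B: "X \<in> B" "X' \<in> B" using X X' by (auto simp: intertwines_def)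
  have "X * X' * (Y' * Y) = X * (X' * Y') * Y" by (simp add: mult.assoc)
  also have "\<dots> = f" using X X' Bf[OF B(1)] by simp
  finally have 1: "X * X' * (Y' * Y) = f" .
  have "Y' * Y * (X * X') = Y' * (Y * X) * X'" by (simp add: mult.assoc)
  also have "\<dots> = f" using X X' Bf[OF X'(2)] by simp
  finally have 2: "Y' * Y * (X * X') = f" .
  have "intertwines (s \<otimes> t) (X * X')" using intertwines_mult X X' s t by blast
  moreover have "D (X * X') \<in> \<mu>" using D_mult[OF B] X X' p_roots_mult by simp
  moreover have "Y' * Y \<in> B" "Y' * Y \<in> AK" using X X' B_mult AK_mult by auto
  ultimately show ?thesis using 1 2 unfolding realizable_def by blast
qed

definition fpow :: "'c \<Rightarrow> nat \<Rightarrow> 'c" where "fpow x n = ((*) x ^^ n) f"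

lemma fpow_0 [simp]: "fpow x 0 = f" by (simp add: fpow_def)
lemma fpow_Suc: "fpow x (Suc n) = x * fpow x n" by (simp add: fpow_def)

lemma fpow_B: "x \<in> B \<Longrightarrow> fpow x n \<in> B"
  by (induction n) (auto simp: fpow_Suc f_B B_mult)

lemma fpow_AK: "x \<in> AK \<Longrightarrow> fpow x n \<in> AK"
  by (induction n) (auto simp: fpow_Suc f_AK AK_mult)

lemma D_fpow: "x \<in> B \<Longrightarrow> D (fpow x n) = D x ^ n"
  by (induction n) (auto simp: fpow_Suc D_f D_mult fpow_B)

text \<open>The power of \<open>u m\<close> with exponent \<open>p ^ k\<close> is a scalar in \<mu>,
  hence so is that power of its determinant.\<close>

lemma D_u_mu: assumes m: "m \<in> M" shows "D (u m) \<in> \<mu>"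
proof -
  have "m [^] (p ^ k) \<in> N" using normal_in_pow_index[OF nNM finite_M card_MN m] .
  then obtain z where z: "z \<in> \<mu>" "fpow (u m) (p ^ k) = z *s f"
    unfolding fpow_def using u_scalar_pow M_T m by blast
  have "D (u m) ^ (p ^ k) = z ^ (p ^ k)" using z D_fpow[OF u_B[OF m]] D_scalar by metis
  then show ?thesis using z p_roots_power p_roots_root by metis
qed

lemma realizable_M: assumes m: "m \<in> M" shows "realizable m"
proof -
  have mT: "m \<in> T" using m M_T by blast
  have "intertwines m (u m)" unfolding intertwines_def \<Phi>_def
    using m mT u_B u_AK w[OF mT] M_T by (simp add: mult.assoc)
  then show ?thesis unfolding realizable_def using w[OF mT] w_B[OF m] D_u_mu[OF m] by blast
qed

lemma intertwines_one_f: "intertwines \<one> f"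
  unfolding intertwines_def using f_B f_AK fB Bf u_B \<Phi>_N subgroup.one_closed[OF sN] by simp

lemma intertwines_fpow:
  assumes "intertwines t X" "t \<in> T"
  shows "intertwines (t [^] (n::nat)) (fpow X n)"
proof (induction n)
  case 0
  then show ?case by (simp add: intertwines_one_f)
next
  case (Suc n)
  have "intertwines (t \<otimes> t [^] n) (X * fpow X n)"
    using intertwines_mult[OF assms(1) Suc] assms by simp
  then show ?case using T_carrier[OF assms(2)] nat_pow_Suc2 by (metis fpow_Suc)
qed

text \<open>If \<open>X\<^sup>r = c\<close> then \<open>D X\<^sup>r = c\<^sup>n\<close> with \<open>n = p\<^sup>k\<close> prime to \<open>r\<close>, hence \<open>D X\<close> is an \<open>n\<close>-th power in \<open>K\<close>.\<close>

lemma realizable_p'_element: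
  assumes t: "t \<in> T" and r: "t [^] r \<in> N" "coprime p r" "r > 0"
  shows "realizable t"
proof -
  obtain X Y where X: "intertwines t X" "Y \<in> B" "Y \<in> AK" "X * Y = f" "Y * X = f"
    using intertwiner_exists[OF t] by blast
  have XB: "X \<in> B" "X \<in> AK" using X by (auto simp: intertwines_def)
  obtain c where c: "c \<in> K" "fpow X r = c *s f"
    using intertwines_N[OF r(1) intertwines_fpow[OF X(1) t]] by blast
  define d where "d = D X"
  define n where "n = p ^ k"
  have dc: "d ^ r = c ^ n" using D_fpow[OF XB(1), of r] c D_scalar by (simp add: d_def n_def)
  have d0: "d \<noteq> 0" using D_inverse[OF XB(1) X(2,4)] by (auto simp: d_def)
  have dK: "d \<in> K" using D_K XB by (simp add: d_def)
  have c0: "c \<noteq> 0"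
  proof
    assume "c = 0"
    then have "d ^ r = 0" using dc p_pos by (simp add: n_def power_0_left)
    then show False using d0 by simp
  qed
  have "coprime n r" using r by (simp add: n_def)
  then obtain a b where ab: "n * a = 1 + r * b"
    using bezout_nat[of n r] p_pos by (auto simp: n_def)
  have "d * d ^ (r * b) = d ^ (n * a)" by (simp add: ab power_add)
  then have dd: "d * c ^ (n * b) = d ^ (n * a)" using dc by (metis power_mult)
  \<comment> \<open>From \<open>n * a = 1 + r * b\<close> and \<open>d ^ r = c ^ n\<close> one gets
    \<open>d * c ^ (n * b) = d ^ (n * a)\<close>. Thus \<open>g ^ n\<close> is the inverse of
    \<open>d\<close>, and scaling \<open>X\<close> by \<open>g\<close> makes the determinant
    1.\<close>
  define g where "g = c ^ b / d ^ a"
  have g0: "g \<noteq> 0" using c0 d0 by (simp add: g_def)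
  have gK: "g \<in> K" using c dK by (simp add: g_def K_divide K_power)
  have "g ^ n * d = 1"
    using dd d0 by (simp add: g_def power_divide power_mult[symmetric] mult.commute)
  then have "D (g *s X) = 1" by (simp add: D_scale d_def n_def)
  moreover have "intertwines t (g *s X)" by (rule intertwines_scale[OF X(1) gK])
  moreover have "(g *s X) * (inverse g *s Y) = f" "(inverse g *s Y) * (g *s X) = f"
    using g0 X by simp_all
  moreover have "inverse g *s Y \<in> B" "inverse g *s Y \<in> AK"
    using X gK by (auto intro: span_scale AK_scale K_inverse)
  ultimately show ?thesis unfolding realizable_def by (metis p_roots_one)
qed

end

section \<open>Commuting subgroups stable under a p-element, and monomial units\<close>

context twisted_rep
begin

lemma subgroup_commutant:
  assumes z: "z \<in> T"
  shows "subgroup {y\<in>T. u y * u z = u z * u y} G"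
proof (rule subgroupI)
  show "{y\<in>T. u y * u z = u z * u y} \<subseteq> carrier G" using T_carrier by auto
  obtain c where "u \<one> = c *s f" using uN subgroup.one_closed[OF sN] by blast
  then have "\<one> \<in> {y\<in>T. u y * u z = u z * u y}" using z by simp
  then show "{y\<in>T. u y * u z = u z * u y} \<noteq> {}" by blast
next
  fix y assume "y \<in> {y\<in>T. u y * u z = u z * u y}"
  then have y: "y \<in> T" "u y * u z = u z * u y" by auto
  have "w y * u z = w y * (u z * u y) * w y" using w[OF y(1)] z by (simp add: mult.assoc)
  also have "\<dots> = (w y * u y) * u z * w y" using y(2) by (simp add: mult.assoc)
  also have "\<dots> = u z * w y" using w[OF y(1)] z by simp
  finally have wz: "w y * u z = u z * w y" .
  obtain c where c: "c \<in> \<mu>" "w y = c *s u (inv y)" using w(6)[OF y(1)] by blast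
  then have "c *s (u (inv y) * u z) = c *s (u z * u (inv y))" using wz by simp
  then have "u (inv y) * u z = u z * u (inv y)" using mu_nonzero[OF c(1)] by simp
  then show "inv y \<in> {y\<in>T. u y * u z = u z * u y}" using y by simp
next
  fix x y assume "x \<in> {y\<in>T. u y * u z = u z * u y}" "y \<in> {y\<in>T. u y * u z = u z * u y}"
  then have xy: "x \<in> T" "y \<in> T" "u x * u z = u z * u x" "u y * u z = u z * u y" by auto
  obtain c where c: "u (x \<otimes> y) = c *s (u x * u y)" using u_mult xy by blast
  have "u x * u y * u z = u z * (u x * u y)" using xy by (metis mult.assoc)
  then show "x \<otimes> y \<in> {y\<in>T. u y * u z = u z * u y}" using xy c by simp
qed

lemma commutant_conj:
  assumes t: "t \<in> T" and m: "m \<in> T" "\<And>x. x \<in> X \<Longrightarrow> u m * u x = u x * u m"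
    and X: "\<And>x. x \<in> X \<Longrightarrow> x \<in> T \<and> inv t \<otimes> x \<otimes> t \<in> X" and x: "x \<in> X"
  shows "u (t \<otimes> m \<otimes> inv t) * u x = u x * u (t \<otimes> m \<otimes> inv t)"
proof -
  define y where "y = inv t \<otimes> x \<otimes> t"
  have tc: "t \<in> carrier G" "x \<in> carrier G" using t x X T_carrier by auto
  have y: "y \<in> X" "y \<in> T" using X x by (auto simp: y_def)
  have xy: "t \<otimes> y \<otimes> inv t = x" using tc by (simp add: y_def m_assoc inv_cancel)
  obtain z1 where z1: "z1 \<in> \<mu>" "u t * u m * w t = z1 *s u (t \<otimes> m \<otimes> inv t)" using u_conj[OF t m(1)] by blast
  obtain z2 where z2: "z2 \<in> \<mu>" "u t * u y * w t = z2 *s u x" using u_conj[OF t y(2)] xy by auto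
  have "u t * (u m * u y) * w t = u t * (u y * u m) * w t" using m(2)[OF y(1)] by simp
  moreover have "u t * (a * b) * w t = (u t * a * w t) * (u t * b * w t)" if "f * b = b" for a b
    using that wx[OF t] by (simp add: mult.assoc) (metis mult.assoc)
  ultimately have "(u t * u m * w t) * (u t * u y * w t) = (u t * u y * w t) * (u t * u m * w t)"
    using m(1) y(2) by simp
  then have "(z1 * z2) *s (u (t \<otimes> m \<otimes> inv t) * u x) = (z1 * z2) *s (u x * u (t \<otimes> m \<otimes> inv t))"
    unfolding z1 z2 by (simp add: mult.commute)
  then show ?thesis using mu_nonzero z1 z2 by simp
qed

end

context twisted_rep_pairing
begin

text \<open>The subgroups between \<open>N\<close> and \<open>M\<close> that are isotropic for the
  commutator pairing and stable under conjugation by \<open>t\<close>.\<close>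

definition commuting_subgroup :: "'a \<Rightarrow> 'a set \<Rightarrow> bool" where
  "commuting_subgroup t A \<longleftrightarrow> subgroup A G \<and> N \<subseteq> A \<and> A \<subseteq> M \<and>
     (\<forall>x\<in>A. \<forall>y\<in>A. u x * u y = u y * u x) \<and> (\<forall>x\<in>A. t \<otimes> x \<otimes> inv t \<in> A)"

text \<open>Let \<open>C\<close> be the orthogonal complement of \<open>A\<close> in
  \<open>M\<close>. The p-element \<open>t\<close> acts on the nontrivial p-group C / A and fixes a
  nontrivial coset; adjoining a representative \<open>x\<close> preserves stability, and also
  commutation, since \<open>x\<close> commutes with \<open>A\<close> and with itself.\<close>

lemma commuting_subgroup_extend:
  assumes t: "t \<in> T" "t [^] (p ^ a :: nat) = \<one>"
    and A: "commuting_subgroup t A"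
    and m: "m \<in> M" "m \<notin> A" "\<And>x. x \<in> A \<Longrightarrow> u m * u x = u x * u m"
  shows "\<exists>A'. commuting_subgroup t A' \<and> A \<subset> A'"
proof -
  have sA: "subgroup A G" "N \<subseteq> A" "A \<subseteq> M" and cA: "\<And>x y. x \<in> A \<Longrightarrow> y \<in> A \<Longrightarrow> u x * u y = u y * u x"
    and tA: "\<And>x. x \<in> A \<Longrightarrow> t \<otimes> x \<otimes> inv t \<in> A"
    using A by (auto simp: commuting_subgroup_def)
  have tc: "t \<in> carrier G" using T_carrier t by blast
  define C where "C = {c\<in>M. \<forall>x\<in>A. u c * u x = u x * u c}"
  have AM: "x \<in> T" if "x \<in> A" for x using sA M_T that by blast
  have sC: "subgroup C G"
  proof (rule subgroupI)
    show "C \<subseteq> carrier G" using M_carrier by (auto simp: C_def)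
    show "C \<noteq> {}" using m by (auto simp: C_def)
    show "inv c \<in> C" if "c \<in> C" for c
      using that M_T subgroup.m_inv_closed[OF subgroup_commutant[OF AM], of _ c] by (auto simp: C_def)
    show "c \<otimes> d \<in> C" if "c \<in> C" "d \<in> C" for c d
      using that M_T subgroup.m_closed[OF subgroup_commutant[OF AM], of _ c d] by (auto simp: C_def)
  qed
  have CM: "C \<subseteq> M" by (auto simp: C_def)
  have AC: "A \<subseteq> C" using sA cA by (auto simp: C_def)
  \<comment> \<open>Stability under \<open>t\<close> passes to its natural powers, so the inverse is
    written as such a power.\<close>
  have inv_t: "inv t = t [^] (p ^ a - 1)"
  proof -
    have "t [^] (p ^ a - 1) \<otimes> t = \<one>" using t p_pos by (metis Suc_diff_1 nat_pow_Suc zero_less_power)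
    then show ?thesis using tc by (simp add: inv_equality)
  qed
  have tA': "inv t \<otimes> x \<otimes> t \<in> A" if "x \<in> A" for x
    using conj_nat_pow_mem[OF tc _ tA that, of "p ^ a - 1"] subgroup.subset[OF sA(1)] tc
    unfolding inv_t[symmetric] by simp
  have tC: "t \<otimes> c \<otimes> inv t \<in> C" if c: "c \<in> C" for c
  proof -
    have cM: "c \<in> M" using c CM by blast
    have "u (t \<otimes> c \<otimes> inv t) * u x = u x * u (t \<otimes> c \<otimes> inv t)" if x: "x \<in> A" for x
      by (rule commutant_conj[OF t(1) M_T[OF cM], of A]) (use c tA' AM x in \<open>auto simp: C_def\<close>)
    then show ?thesis using M_conj[OF t(1) cM] by (simp add: C_def)
  qed
  have nAC: "normal_in A C" by (rule normal_in_between[OF sA(1,2) AC CM sC])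
  have "finite C" using finite_subset[OF CM finite_M] .
  moreover have "\<exists>k. x [^] (p ^ k :: nat) \<in> A" if "x \<in> C" for x
    using normal_in_pow_index[OF nNM finite_M card_MN, of x] that CM sA by blast
  ultimately obtain j where j: "card C = p ^ j * card A"
    using card_p_power_index[OF nAC _ prime_p] by blast
  have "A \<noteq> C" using m by (auto simp: C_def)
  from p_element_fixes_coset[OF finite_carrier nAC prime_p j this tc t(2) tC tA]
  obtain x where x: "x \<in> C" "x \<notin> A" "t \<otimes> x \<otimes> inv t \<otimes> inv x \<in> A" by blast
  define A' where "A' = generate G (insert x A)"
  have xM: "x \<in> M" using x CM by blast
  have gen_sub: "insert x A \<subseteq> carrier G" using xM M_carrier subgroup.subset[OF sA(1)] by auto
  have sA': "subgroup A' G" unfolding A'_def by (rule generate_is_subgroup[OF gen_sub])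
  have inA': "y \<in> A'" if "y \<in> insert x A" for y unfolding A'_def using that by (rule generate.incl)
  have incl: "A' \<subseteq> H" if "subgroup H G" "insert x A \<subseteq> H" for H
    unfolding A'_def using generate_subgroup_incl[OF that(2,1)] .
  have A'M: "A' \<subseteq> M" using incl[OF sM] xM sA by blast
  have comm1: "u y * u z = u z * u y" if y: "y \<in> A'" and z: "z \<in> insert x A" for y z
  proof -
    have zT: "z \<in> T" using z AM xM M_T by auto
    have "insert x A \<subseteq> {y\<in>T. u y * u z = u z * u y}"
      using z x(1) cA AM xM M_T by (auto simp: C_def)
    then show ?thesis using incl[OF subgroup_commutant[OF zT]] y by auto
  qed
  have comm2: "u y * u z = u z * u y" if y: "y \<in> A'" and z: "z \<in> A'" for y z
  proof -
    have yT: "y \<in> T" using y A'M M_T by blast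
    have "insert x A \<subseteq> {z\<in>T. u z * u y = u y * u z}"
      using comm1[OF y] AM xM M_T by auto
    then show ?thesis using incl[OF subgroup_commutant[OF yT]] z by auto
  qed
  \<comment> \<open>The elements that \<open>t\<close> conjugates into \<open>A'\<close> form a
    subgroup; therefore the stability of \<open>A'\<close> can be checked on generators.\<close>
  have sconj: "subgroup {y\<in>carrier G. t \<otimes> y \<otimes> inv t \<in> A'} G"
  proof (rule subgroupI)
    show "{y\<in>carrier G. t \<otimes> y \<otimes> inv t \<in> A'} \<noteq> {}"
      using tc subgroup.one_closed[OF sA'] by auto
    fix y assume y: "y \<in> {y\<in>carrier G. t \<otimes> y \<otimes> inv t \<in> A'}"
    then have "inv (t \<otimes> y \<otimes> inv t) \<in> A'" using subgroup.m_inv_closed[OF sA'] by auto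
    then show "inv y \<in> {y\<in>carrier G. t \<otimes> y \<otimes> inv t \<in> A'}"
      using y tc by (simp add: inv_mult_group m_assoc)
  next
    fix y z assume yz: "y \<in> {y\<in>carrier G. t \<otimes> y \<otimes> inv t \<in> A'}" "z \<in> {y\<in>carrier G. t \<otimes> y \<otimes> inv t \<in> A'}"
    then show "y \<otimes> z \<in> {y\<in>carrier G. t \<otimes> y \<otimes> inv t \<in> A'}"
      using conj_mult[OF tc, of y z] subgroup.m_closed[OF sA'] by auto
  qed auto
  have "t \<otimes> x \<otimes> inv t \<in> A'"
  proof -
    have xc: "x \<in> carrier G" using xM M_carrier by blast
    have "t \<otimes> x \<otimes> inv t \<otimes> inv x \<otimes> x \<in> A'"
      using subgroup.m_closed[OF sA'] inA' x(3) by simp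
    then show ?thesis using xc tc by (simp add: m_assoc)
  qed
  then have "insert x A \<subseteq> {y\<in>carrier G. t \<otimes> y \<otimes> inv t \<in> A'}"
    using gen_sub tA inA' by auto
  then have "t \<otimes> y \<otimes> inv t \<in> A'" if "y \<in> A'" for y using incl[OF sconj] that by blast
  then have "commuting_subgroup t A'"
    unfolding commuting_subgroup_def using sA' A'M comm2 inA' sA by blast
  moreover have "A \<subset> A'" using x inA' by blast
  ultimately show ?thesis by blast
qed

lemma maximal_commuting_subgroup:
  assumes t: "t \<in> T" "t [^] (p ^ a :: nat) = \<one>"
  shows "\<exists>A. commuting_subgroup t A \<and> (\<forall>m\<in>M. (\<forall>x\<in>A. u m * u x = u x * u m) \<longrightarrow> m \<in> A)"
proof -
  have "commuting_subgroup t N"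
  proof -
    have "u x * u y = u y * u x" if xy: "x \<in> N" "y \<in> N" for x y
    proof -
      obtain a where "u x = a *s f" using uN[OF xy(1)] by blast
      moreover obtain b where "u y = b *s f" using uN[OF xy(2)] by blast
      ultimately show ?thesis by (simp add: mult.commute)
    qed
    then show ?thesis unfolding commuting_subgroup_def using sN NM normal_inD(4)[OF NT] t by blast
  qed
  moreover have "card A < Suc (card M)" if "commuting_subgroup t A" for A
    using that card_mono[OF finite_M] by (auto simp: commuting_subgroup_def less_Suc_eq_le)
  ultimately obtain A where A: "commuting_subgroup t A"
    "\<And>A'. commuting_subgroup t A' \<Longrightarrow> card A' \<le> card A"
    using ex_has_greatest_nat[of "commuting_subgroup t" N card "Suc (card M)"] by blast
  have "m \<in> A" if m: "m \<in> M" "\<forall>x\<in>A. u m * u x = u x * u m" for m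
  proof (rule ccontr)
    assume "m \<notin> A"
    then obtain A' where A': "commuting_subgroup t A'" "A \<subset> A'"
      using commuting_subgroup_extend[OF t A(1) m(1)] m(2) by blast
    then have "finite A'" using finite_subset[OF _ finite_M] by (simp add: commuting_subgroup_def)
    then show False using psubset_card_mono[of A' A] A' A(2)[OF A'(1)] by simp
  qed
  then show ?thesis using A by blast
qed

end

text \<open>A character of a maximal commuting subgroup \<open>A\<close> yields an idempotent \<open>pol.e\<close> of rank one in the
  matrix algebra \<open>B\<close>.\<close>

locale twisted_rep_polarized = twisted_rep_pairing +
  fixes A :: "'a set" and l :: "'a \<Rightarrow> complex"
  assumes polarization: "twisted_rep_char G scale p K AK \<tau> M N f u A l"
    and self_centralizing: "m \<in> M \<Longrightarrow> (\<And>x. x \<in> A \<Longrightarrow> u m * u x = u x * u m) \<Longrightarrow> m \<in> A"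
begin

sublocale pol: twisted_rep_char G scale p K AK \<tau> M N f u A l
  by (rule polarization)

lemma A_M: "a \<in> A \<Longrightarrow> a \<in> M" by (rule pol.M_T)

lemma e_B: "pol.e \<in> B"
  unfolding pol.e_def pol.v_def using A_M u_B by (intro span_scale span_sum) auto

text \<open>Commutators of \<open>m\<close> with \<open>A\<close> lie in \<open>N\<close>, where the
  corrected elements equal \<open>f\<close>. If \<open>m\<close> fixed the character of
  \<open>A\<close>, it would therefore commute with all of \<open>A\<close> and belong to
  \<open>A\<close>. Hence it moves the character.\<close>

lemma e_u_outside:
  assumes m: "m \<in> M" "m \<notin> A"
  shows "pol.e * u m * pol.e = 0"
proof -
  have "m \<notin> pol.S"
  proof
    assume S: "m \<in> pol.S"
    have "u m * u x = u x * u m" if x: "x \<in> A" for x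
    proof -
      have c: "m \<in> carrier G" "x \<in> carrier G" "x \<in> M" using m x A_M M_carrier by auto
      define n where "n = m \<otimes> x \<otimes> inv m \<otimes> inv x"
      have n: "n \<in> N" using MN_abelian m c by (simp add: n_def)
      have "m \<otimes> x \<otimes> inv m = n \<otimes> x" using c by (simp add: n_def m_assoc)
      then have "pol.v (m \<otimes> x \<otimes> inv m) = pol.v n * pol.v x"
        using pol.v_mult[of n x] n x pol.NM by auto
      also have "\<dots> = pol.v x" using pol.v_N[OF n] pol.fv[OF x] by simp
      finally have "u m * pol.v x = pol.v x * u m" using S x by (simp add: pol.S_def)
      then have "l x *s (u m * u x) = l x *s (u x * u m)" by (simp add: pol.v_def)
      moreover have "l x \<noteq> 0" using pol.l_mu[OF x] mu_nonzero by blast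
      ultimately show ?thesis by simp
    qed
    then show False using self_centralizing m by blast
  qed
  then show ?thesis using pol.eue_outside m by blast
qed

lemma u_e:
  assumes a: "a \<in> A"
  shows "\<exists>c. c \<noteq> 0 \<and> u a * pol.e = c *s pol.e \<and> pol.e * u a = c *s pol.e \<and> w a * pol.e = inverse c *s pol.e
    \<and> pol.e * w a = inverse c *s pol.e"
proof -
  define c where "c = inverse (l a)"
  have la: "l a \<noteq> 0" using pol.l_mu a mu_nonzero by blast
  have ua: "u a = c *s pol.v a" using la by (simp add: pol.v_def c_def)
  have aT: "a \<in> T" using a A_M M_T by blast
  have c0: "c \<noteq> 0" using la by (simp add: c_def)
  have 1: "u a * pol.e = c *s pol.e" "pol.e * u a = c *s pol.e"
    using ua pol.ve[OF a] pol.ev[OF a] by simp_all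
  have "c *s (w a * pol.e) = w a * (u a * pol.e)" using 1 by simp
  also have "\<dots> = pol.e" using wx[OF aT] pol.fe by simp
  finally have "w a * pol.e = inverse c *s pol.e"
    using c0 by (metis left_inverse scale_one scale_scale)
  moreover have "c *s (pol.e * w a) = (pol.e * u a) * w a" using 1 by simp
  then have "c *s (pol.e * w a) = pol.e" using w(2)[OF aT] pol.ef by (simp add: mult.assoc)
  then have "pol.e * w a = inverse c *s pol.e"
    using c0 by (metis left_inverse scale_one scale_scale)
  ultimately show ?thesis using 1 c0 by blast
qed

lemma e_B_e:
  assumes "x \<in> B"
  shows "\<exists>c. pol.e * x * pol.e = c *s pol.e"
  using assms
proof (induction rule: span_induct_alt)
  case base
  show ?case by (intro exI[of _ 0]) simp
next
  case (step c a y)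
  then obtain m where m: "m \<in> M" "a = u m" by blast
  have "\<exists>d. pol.e * a * pol.e = d *s pol.e"
  proof (cases "m \<in> A")
    case True
    then obtain d where "pol.e * u m = d *s pol.e" using u_e by blast
    then show ?thesis using m pol.ee by auto
  next
    case False
    then show ?thesis using m e_u_outside[of m] by (intro exI[of _ 0]) simp
  qed
  then obtain d d' where "pol.e * a * pol.e = d *s pol.e" "pol.e * y * pol.e = d' *s pol.e"
    using step.IH by blast
  then have "pol.e * (c *s a + y) * pol.e = (c * d + d') *s pol.e"
    by (simp add: distrib_left distrib_right scale_left_distrib)
  then show ?case by blast
qed

lemma e_w_outside:
  assumes m: "m \<in> M" "m \<notin> A"
  shows "pol.e * w m * pol.e = 0"
proof -
  obtain z where z: "w m = z *s u (inv m)" using w(6) M_T m by blast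
  have "inv m \<notin> A" using subgroup.m_inv_closed[OF pol.sM, of "inv m"] m M_carrier by auto
  then show ?thesis using z e_u_outside[of "inv m"] m by simp
qed

text \<open>The average is a scalar by \<open>B_average\<close>. Compressing it by
  \<open>pol.e\<close> from both sides kills the terms outside \<open>A\<close>, while each element
  of \<open>A\<close> contributes \<open>pol.e\<close>; this determines the scalar.\<close>

lemma e_average: "(\<Sum>m\<in>M. u m * pol.e * w m) = of_nat (card A) *s f"
proof -
  define c where "c = of_nat (card M) * \<tau> pol.e / \<tau> f"
  have eq: "(\<Sum>m\<in>M. u m * pol.e * w m) = c *s f" unfolding c_def by (rule B_average[OF e_B])
  have "c *s pol.e = pol.e * (\<Sum>m\<in>M. u m * pol.e * w m) * pol.e"
    unfolding eq using pol.ef pol.ee by simp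
  also have "\<dots> = (\<Sum>m\<in>M. (pol.e * u m * pol.e) * w m * pol.e)"
    by (simp add: sum_distrib_left sum_distrib_right mult.assoc)
  also have "\<dots> = (\<Sum>m\<in>A. (pol.e * u m * pol.e) * w m * pol.e)"
    by (rule sum.mono_neutral_right) (use finite_M A_M e_u_outside in auto)
  also have "\<dots> = (\<Sum>m\<in>A. pol.e)"
  proof (rule sum.cong[OF refl])
    fix m assume "m \<in> A"
    then obtain d where d: "d \<noteq> 0" "pol.e * u m = d *s pol.e" "w m * pol.e = inverse d *s pol.e"
      using u_e by blast
    then show "(pol.e * u m * pol.e) * w m * pol.e = pol.e"
      using pol.ee by (simp add: mult.assoc)
  qed
  also have "\<dots> = of_nat (card A) *s pol.e" by (simp add: sum_constant_scale del: sum_constant)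
  finally have "c = of_nat (card A)" using pol.\<tau>e by auto
  then show ?thesis using eq by simp
qed

text \<open>Some \<open>s\<close> in the coset \<open>M t\<close> fixes \<open>pol.e\<close>, hence permutes a monomial basis of \<open>B pol.e\<close>. The
  implementing unit fixing \<open>pol.e\<close> then has \<open>p\<close>-power order.\<close>

lemma realizable_p_element_invariant:
  assumes t: "t \<in> T" "t [^] (p ^ a :: nat) = \<one>" and tA: "\<And>x. x \<in> A \<Longrightarrow> t \<otimes> x \<otimes> inv t \<in> A"
  shows "realizable t"
proof -
  have tc: "t \<in> carrier G" using t T_carrier by blast
  define e' where "e' = \<Phi> t pol.e"
  have e'f: "e' * f = e'" using w(5)[OF t(1)] by (simp add: e'_def \<Phi>_def mult.assoc)
  have "e' \<noteq> 0"
  proof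
    assume "e' = 0"
    then have "w t * (u t * pol.e * w t) * u t = 0" by (simp add: e'_def \<Phi>_def)
    then have "pol.e = 0" using w[OF t(1)] pol.fe pol.ef by (simp add: mult.assoc wx[OF t(1)])
    then show False using pol.\<tau>e by simp
  qed
  have "e' * (\<Sum>m\<in>M. u m * pol.e * w m) = of_nat (card A) *s e'"
    unfolding e_average using e'f by simp
  then have "(\<Sum>m\<in>M. e' * u m * pol.e * w m) \<noteq> 0"
    using \<open>e' \<noteq> 0\<close> pol.card_M by (simp add: sum_distrib_left mult.assoc)
  then obtain m where m: "m \<in> M" "e' * u m * pol.e \<noteq> 0"
    by (metis (no_types, lifting) mult_zero_left sum.neutral)
  have mT: "m \<in> T" using m M_T by blast
  have mc: "m \<in> carrier G" using mT T_carrier by blast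
  define s where "s = inv m \<otimes> t"
  have sT: "s \<in> T" using mT t by (simp add: s_def)
  obtain zs where zs: "zs \<in> \<mu>" "u s = zs *s (u (inv m) * u t)" unfolding s_def using u_mult[of "inv m" t] mT t by auto
  have \<Phi>s: "\<Phi> s (pol.v x) = pol.v (t \<otimes> x \<otimes> inv t)" if x: "x \<in> A" for x
  proof -
    define y where "y = t \<otimes> x \<otimes> inv t"
    have y: "y \<in> A" "y \<in> M" using tA x A_M by (auto simp: y_def)
    obtain z where z: "\<Phi> t (pol.v x) = z *s pol.v y"
    proof -
      obtain z' where z': "\<Phi> t (u x) = z' *s u y" using \<Phi>_u[OF t(1) A_M[OF x]] by (auto simp: y_def)
      have "l y \<noteq> 0" using pol.l_mu y mu_nonzero by blast
      then have "\<Phi> t (pol.v x) = (l x * z' * inverse (l y)) *s pol.v y"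
        using z' by (simp add: pol.v_def \<Phi>_scale)
      then show ?thesis using that by blast
    qed
    have "e' * \<Phi> t (pol.v x) = e'"
    proof -
      have "f * pol.v x = pol.v x" using pol.fv x by blast
      then have "\<Phi> t (pol.e * pol.v x) = e' * \<Phi> t (pol.v x)" unfolding e'_def by (rule \<Phi>_mult[OF t(1)])
      then show ?thesis using pol.ev[OF x] by (simp add: e'_def)
    qed
    then have e'y: "z *s (e' * pol.v y) = e'" using z by simp
    have vy: "pol.v y * u m = \<kappa> y m *s (u m * pol.v y)"
      using \<kappa>(2)[OF y(2) m(1)] by (simp add: pol.v_def mult.commute)
    have "e' * u m * pol.e = z *s (e' * (pol.v y * u m) * pol.e)"
      using e'y by (metis mult.assoc mult_scale_left)
    also have "\<dots> = (z * \<kappa> y m) *s (e' * u m * (pol.v y * pol.e))"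
      unfolding vy by (simp add: mult.assoc)
    also have "\<dots> = (z * \<kappa> y m) *s (e' * u m * pol.e)" using pol.ve[OF y(1)] by simp
    finally have "(z * \<kappa> y m) *s (e' * u m * pol.e) = 1 *s (e' * u m * pol.e)" by simp
    then have zk: "z * \<kappa> y m = 1" using m(2) by (simp only: scale_cancel_right) simp
    have "\<Phi> s (pol.v x) = \<Phi> (inv m) (\<Phi> t (pol.v x))"
      unfolding s_def using \<Phi>_comp[of "inv m" t] mT t by simp
    also have "\<dots> = z *s \<Phi> (inv m) (pol.v y)" unfolding z by (simp add: \<Phi>_scale)
    also have "\<Phi> (inv m) (pol.v y) = \<kappa> y m *s pol.v y"
    proof -
      have "\<Phi> m (\<Phi> (inv m) (pol.v y)) = \<Phi> \<one> (pol.v y)"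
        using \<Phi>_comp[of m "inv m"] mT mc by simp
      moreover have vB: "pol.v y \<in> B" unfolding pol.v_def using y u_B by (simp add: span_scale)
      moreover have "\<Phi> m (pol.v y) = inverse (\<kappa> y m) *s pol.v y"
      proof -
        have "\<kappa> y m *s (u m * pol.v y * w m) = pol.v y * (u m * w m)"
          using vy by (metis mult.assoc mult_scale_left)
        also have "\<dots> = pol.v y" using w(2)[OF mT] pol.vf[OF y(1)] by simp
        finally show ?thesis unfolding \<Phi>_def
          using mu_nonzero[OF \<kappa>(1)[OF y(2) m(1)]] by (metis left_inverse scale_one scale_scale)
      qed
      ultimately have *: "\<Phi> m (\<Phi> (inv m) (pol.v y)) = \<Phi> m (\<kappa> y m *s pol.v y)"
        using \<Phi>_N[OF subgroup.one_closed[OF sN] vB] mu_nonzero[OF \<kappa>(1)[OF y(2) m(1)]]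
        by (simp add: \<Phi>_scale)
      have "\<Phi> (inv m) (\<Phi> m q) = q" if "q \<in> B" for q
        using \<Phi>_comp[of "inv m" m] mT mc \<Phi>_N[OF subgroup.one_closed[OF sN] that] by simp
      then show ?thesis using * \<Phi>_B vB mT by (metis T_inv span_scale)
    qed
    finally show ?thesis using zk by (simp add: y_def)
  qed
  have \<Phi>se: "\<Phi> s pol.e = pol.e"
  proof -
    have inj: "inj_on (\<lambda>x. t \<otimes> x \<otimes> inv t) A"
      using tc A_M M_carrier by (auto simp: inj_on_def)
    have "(\<lambda>x. t \<otimes> x \<otimes> inv t) ` A = A"
      by (rule endo_inj_surj[OF pol.finite_M _ inj]) (use tA in auto)
    then have bij: "bij_betw (\<lambda>x. t \<otimes> x \<otimes> inv t) A A" using inj by (simp add: bij_betw_def)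
    have "\<Phi> s pol.e = inverse (of_nat (card A)) *s (\<Sum>x\<in>A. pol.v (t \<otimes> x \<otimes> inv t))"
      unfolding pol.e_def by (simp add: \<Phi>_scale \<Phi>_sum \<Phi>s)
    also have "(\<Sum>x\<in>A. pol.v (t \<otimes> x \<otimes> inv t)) = (\<Sum>x\<in>A. pol.v x)"
      by (rule sum.reindex_bij_betw[OF bij])
    finally show ?thesis by (simp add: pol.e_def)
  qed
  \<comment> \<open>The factor is chosen to give \<open>X * pol.e = pol.e\<close>. A power of
    \<open>X\<close> that is a scalar is then forced to be \<open>f\<close>.\<close>
  define X where "X = inverse (of_nat (card A)) *s avg s pol.e"
  have IX: "intertwines s X" unfolding X_def
    by (intro intertwines_scale avg_intertwines sT e_B pol.e_AK K_inverse K_of_nat)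
  have XB: "X \<in> B" "X \<in> AK" using IX by (auto simp: intertwines_def)
  have Xe: "X * pol.e = pol.e"
  proof -
    have "avg s pol.e * pol.e = (\<Sum>m\<in>M. \<Phi> s (u m) * (pol.e * w m * pol.e))"
      by (simp add: avg_def sum_distrib_right mult.assoc)
    also have "\<dots> = (\<Sum>m\<in>A. \<Phi> s (u m) * (pol.e * w m * pol.e))"
      by (rule sum.mono_neutral_right) (use finite_M A_M e_w_outside in auto)
    also have "\<dots> = (\<Sum>m\<in>A. pol.e)"
    proof (rule sum.cong[OF refl])
      fix a assume a: "a \<in> A"
      then obtain d where d: "d \<noteq> 0" "u a * pol.e = d *s pol.e" "pol.e * w a = inverse d *s pol.e"
        using u_e by blast
      have "\<Phi> s (u a) * pol.e = \<Phi> s (u a * pol.e)" using \<Phi>_mult[OF sT pol.fe] \<Phi>se by simp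
      also have "\<dots> = d *s pol.e" using d \<Phi>se by (simp add: \<Phi>_scale)
      finally have "\<Phi> s (u a) * pol.e = d *s pol.e" .
      then show "\<Phi> s (u a) * (pol.e * w a * pol.e) = pol.e" using d pol.ee by simp
    qed
    also have "\<dots> = of_nat (card A) *s pol.e" by (simp add: sum_constant_scale del: sum_constant)
    finally show ?thesis using pol.card_M by (simp add: X_def)
  qed
  \<comment> \<open>Modulo \<open>M\<close> the element \<open>s\<close> agrees with
    \<open>t\<close>, so that \<open>p ^ a\<close> takes it into \<open>M\<close>; a further
    exponent \<open>p ^ k\<close> takes it into \<open>N\<close>.\<close>
  define q where "q = p ^ (a + k)"
  have "s [^] q \<in> N"
  proof -
    have "t [^] (p ^ a) \<in> M" using t by simp
    then have "s [^] (p ^ a) \<in> M" unfolding s_def using pow_mem_cong[OF MT t(1) M_inv[OF m(1)]] by simp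
    then have "(s [^] (p ^ a)) [^] (p ^ k) \<in> N" using normal_in_pow_index[OF nNM finite_M card_MN] by blast
    then show ?thesis using T_carrier[OF sT] by (simp add: q_def nat_pow_pow power_add)
  qed
  then obtain c where c: "fpow X q = c *s f"
    using intertwines_N intertwines_fpow[OF IX sT] by blast
  have "fpow X n * pol.e = pol.e" for n
    by (induction n) (simp_all add: fpow_Suc pol.fe mult.assoc Xe)
  then have "c *s pol.e = 1 *s pol.e" using c pol.fe by (metis mult_scale_left scale_one)
  then have "c = 1" using pol.\<tau>e by (simp only: scale_cancel_right) auto
  then have Xq: "fpow X q = f" using c by simp
  have q0: "q > 0" using p_pos by (simp add: q_def)
  define Y where "Y = fpow X (q - 1)"
  have Y: "Y \<in> B" "Y \<in> AK" using fpow_B fpow_AK XB by (auto simp: Y_def)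
  have XY: "X * Y = f" using Xq q0 by (metis Suc_diff_1 Y_def fpow_Suc)
  have YX: "Y * X = f" by (rule left_inverse_imp_right[OF Y(1) XB(1) XY])
  have "D X ^ q = 1" using D_fpow[OF XB(1), of q] Xq D_f by simp
  then have "D X \<in> \<mu>" unfolding q_def p_roots_def by blast
  then have "realizable s" unfolding realizable_def using IX Y XY YX by blast
  then have "realizable (m \<otimes> s)" using realizable_mult[OF mT realizable_M[OF m(1)] sT] by blast
  moreover have "m \<otimes> s = t" using mc tc by (simp add: s_def inv_cancel)
  ultimately show ?thesis by simp
qed

end

section \<open>Commutators in minimal p-sections\<close>

context group begin

text \<open>The preimage \<open>Z\<close> of the centre of M / N is normal in \<open>T\<close> and
  strictly larger than \<open>N\<close>, because a nontrivial p-group has a nontrivial centre.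
  Minimality gives \<open>Z = M\<close>.\<close>

lemma minimal_p_section_abelian:
  assumes fin: "finite (carrier G)" and p: "Factorial_Ring.prime p"
    and nm: "normal_in N T" and M: "normal_in M T" and NM: "N \<subset> M" and c: "card M = p ^ k * card N"
    and min: "\<And>L. normal_in L T \<Longrightarrow> N \<subset> L \<Longrightarrow> L \<subseteq> M \<Longrightarrow> L = M"
    and mh: "m \<in> M" "h \<in> M"
  shows "m \<otimes> h \<otimes> inv m \<otimes> inv h \<in> N"
proof -
  note d = normal_inD[OF nm] and dM = normal_inD[OF M]
  have nNM: "normal_in N M" using normal_in_mono[OF nm dM(1) _ dM(3)] NM by blast
  have Mc: "x \<in> carrier G" if "x \<in> M" for x using subgroup.mem_carrier[OF dM(1) that] .
  have Tc: "x \<in> carrier G" if "x \<in> T" for x using subgroup.mem_carrier[OF d(2) that] .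
  have Nc: "x \<in> carrier G" if "x \<in> N" for x using subgroup.mem_carrier[OF d(1) that] .
  have finM: "finite M" using finite_subset[OF subgroup.subset[OF dM(1)] fin] .
  have Nconj: "g \<otimes> n \<otimes> inv g \<in> N" if "g \<in> M" "n \<in> N" for g n using d(4) that dM(3) by blast
  define Z where "Z = {x\<in>M. \<forall>h\<in>M. h \<otimes> x \<otimes> inv h \<otimes> inv x \<in> N}"
  have ZM: "Z \<subseteq> M" by (auto simp: Z_def)
  have sZ: "subgroup Z G"
  proof (rule subgroupI)
    show "Z \<subseteq> carrier G" using ZM Mc by blast
    have "\<one> \<in> Z" using subgroup.one_closed[OF dM(1)] subgroup.one_closed[OF d(1)] Mc by (auto simp: Z_def)
    then show "Z \<noteq> {}" by blast
  next
    fix x assume x: "x \<in> Z"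
    then have xM: "x \<in> M" "inv x \<in> M" using ZM subgroup.m_inv_closed[OF dM(1)] by auto
    have "h \<otimes> inv x \<otimes> inv h \<otimes> inv (inv x) \<in> N" if h: "h \<in> M" for h
    proof -
      have hc: "h \<in> carrier G" "x \<in> carrier G" using h xM Mc by auto
      have n: "inv (h \<otimes> x \<otimes> inv h \<otimes> inv x) \<in> N"
        using x h subgroup.m_inv_closed[OF d(1)] by (auto simp: Z_def)
      have "inv x \<otimes> inv (h \<otimes> x \<otimes> inv h \<otimes> inv x) \<otimes> inv (inv x) \<in> N"
        by (rule Nconj[OF xM(2) n])
      then show ?thesis using hc by (simp add: inv_mult_group m_assoc inv_cancel)
    qed
    then show "inv x \<in> Z" using xM by (simp add: Z_def)
  next
    fix x y assume xy: "x \<in> Z" "y \<in> Z"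
    then have xyM: "x \<in> M" "y \<in> M" using ZM by auto
    have "h \<otimes> (x \<otimes> y) \<otimes> inv h \<otimes> inv (x \<otimes> y) \<in> N" if h: "h \<in> M" for h
    proof -
      have hc: "h \<in> carrier G" "x \<in> carrier G" "y \<in> carrier G" using h xyM Mc by auto
      have n: "h \<otimes> x \<otimes> inv h \<otimes> inv x \<in> N" "x \<otimes> (h \<otimes> y \<otimes> inv h \<otimes> inv y) \<otimes> inv x \<in> N"
        using xy h Nconj[OF xyM(1)] by (auto simp: Z_def)
      have "(h \<otimes> x \<otimes> inv h \<otimes> inv x) \<otimes> (x \<otimes> (h \<otimes> y \<otimes> inv h \<otimes> inv y) \<otimes> inv x) \<in> N"
        by (rule subgroup.m_closed[OF d(1) n])
      then show ?thesis using hc by (simp add: inv_mult_group m_assoc inv_cancel)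
    qed
    then show "x \<otimes> y \<in> Z" using subgroup.m_closed[OF dM(1) xyM] by (simp add: Z_def)
  qed
  have "t \<otimes> x \<otimes> inv t \<in> Z" if t: "t \<in> T" and x: "x \<in> Z" for t x
  proof -
    have xM: "x \<in> M" using x ZM by blast
    have "h \<otimes> (t \<otimes> x \<otimes> inv t) \<otimes> inv h \<otimes> inv (t \<otimes> x \<otimes> inv t) \<in> N" if h: "h \<in> M" for h
    proof -
      have c: "h \<in> carrier G" "x \<in> carrier G" "t \<in> carrier G" using h xM t Mc Tc by auto
      define h' where "h' = inv t \<otimes> h \<otimes> t"
      have h'M: "h' \<in> M" using dM(4)[of "inv t" h] t h c subgroup.m_inv_closed[OF d(2)] by (simp add: h'_def)
      have n: "h' \<otimes> x \<otimes> inv h' \<otimes> inv x \<in> N" using x h'M by (auto simp: Z_def)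
      have "t \<otimes> (h' \<otimes> x \<otimes> inv h' \<otimes> inv x) \<otimes> inv t \<in> N" by (rule d(4)[OF t n])
      then show ?thesis using c by (simp add: h'_def inv_mult_group m_assoc inv_cancel)
    qed
    then show ?thesis using dM(4)[OF t xM] by (simp add: Z_def)
  qed
  then have "normal_in Z T" using sZ d dM ZM by (auto simp: normal_in_def)
  moreover have "N \<subset> Z"
  proof -
    have "N \<subseteq> Z"
    proof
      fix n assume n: "n \<in> N"
      have "h \<otimes> n \<otimes> inv h \<otimes> inv n \<in> N" if "h \<in> M" for h
        using subgroup.m_closed[OF d(1) Nconj[OF that n] subgroup.m_inv_closed[OF d(1) n]] .
      then show "n \<in> Z" using n NM by (auto simp: Z_def)
    qed
    moreover obtain x where "x \<in> M" "x \<notin> N" "\<forall>h\<in>M. h \<otimes> x \<otimes> inv h \<otimes> inv x \<in> N"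
      using normal_in_center[OF nNM finM p c] NM by blast
    ultimately show ?thesis by (auto simp: Z_def)
  qed
  ultimately have "Z = M" using min ZM by blast
  then show ?thesis using mh by (auto simp: Z_def)
qed

end

section \<open>Passage to the twisted group algebra of T / M\<close>

context twisted_rep_pairing
begin

text \<open>A maximal commuting subgroup stable under \<open>t\<close> contains every element of
  \<open>M\<close> that commutes with it, and the cocycle splits on it by
  \<open>commuting_character\<close>. The case of the trivial \<open>t\<close> supplies the rank one
  idempotent needed in \<open>pairing_reduction\<close>.\<close>

lemma polarization_exists:
  assumes t: "t \<in> T" "t [^] (p ^ a :: nat) = \<one>"
  shows "\<exists>A l. twisted_rep_polarized G scale p K AK \<tau> T N f u M k A l \<and> (\<forall>x\<in>A. t \<otimes> x \<otimes> inv t \<in> A)"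
proof -
  obtain A where A: "commuting_subgroup t A"
    and sc: "\<forall>m\<in>M. (\<forall>x\<in>A. u m * u x = u x * u m) \<longrightarrow> m \<in> A"
    using maximal_commuting_subgroup[OF t] by blast
  have sA: "subgroup A G" "N \<subseteq> A" "A \<subseteq> M" and cA: "\<And>x y. x \<in> A \<Longrightarrow> y \<in> A \<Longrightarrow> u x * u y = u y * u x"
    and tA: "\<forall>x\<in>A. t \<otimes> x \<otimes> inv t \<in> A"
    using A by (auto simp: commuting_subgroup_def)
  interpret M': twisted_rep G scale p K AK \<tau> M N f u
    by (rule twisted_rep_subgroup[OF sM NM M_sub_T])
  have AM: "normal_in A M" by (rule normal_in_between[OF sA subset_refl sM])
  have nNA: "normal_in N A" using normal_in_mono[OF nNM sA] .
  have "\<exists>k. x [^] (p ^ k :: nat) \<in> N" if "x \<in> A" for x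
    using normal_in_pow_index[OF nNM finite_M card_MN, of x] that sA by blast
  then obtain j where j: "card A = p ^ j * card N"
    using card_p_power_index[OF nNA finite_subset[OF sA(3) finite_M] prime_p] by blast
  have "subspace {x. f * x = x}" by (auto simp: subspace_def distrib_left)
  moreover have "f \<in> {x. f * x = x}" by simp
  moreover have "u m * x \<in> {x. f * x = x}" if "m \<in> A" "x \<in> {x. f * x = x}" for m x
    using that sA M_T fuN by auto
  ultimately obtain l where l: "twisted_rep_char G scale p K AK \<tau> M N f u A l"
    using M'.commuting_character[OF AM sA(2) j cA, of "{x. f * x = x}" f] f_nonzero by blast
  have "twisted_rep_polarized G scale p K AK \<tau> T N f u M k A l"
    by (rule twisted_rep_polarized.intro[OF twisted_rep_pairing_axioms
          twisted_rep_polarized_axioms.intro[OF l]]) (use sc in blast)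
  then show ?thesis using tA by blast
qed

lemma realizable_p_element:
  assumes t: "t \<in> T" "t [^] (p ^ a :: nat) = \<one>"
  shows "realizable t"
proof -
  obtain A l where "twisted_rep_polarized G scale p K AK \<tau> T N f u M k A l" and tA: "\<forall>x\<in>A. t \<otimes> x \<otimes> inv t \<in> A"
    using polarization_exists[OF t] by blast
  then interpret twisted_rep_polarized G scale p K AK \<tau> T N f u M k A l by simp
  show ?thesis using realizable_p_element_invariant[OF t] tA by blast
qed

text \<open>Every \<open>t\<close> is the product of two of its powers, a p-element and an element
  of order prime to p, and realizable elements are closed under products.\<close>

lemma all_realizable: assumes t: "t \<in> T" shows "realizable t"
proof -
  have tc: "t \<in> carrier G" using T_carrier t by blast
  define n where "n = Coset.order G"
  have n0: "n \<noteq> 0" using finite_carrier order_gt_0_iff_finite by (simp add: n_def)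
  have tn: "t [^] n = \<one>" using pow_order_eq_1[OF tc] by (simp add: n_def)
  have "\<not> is_unit p" using prime_p not_prime_unit by blast
  then obtain r where r: "n = p ^ multiplicity p n * r" "\<not> p dvd r"
    using multiplicity_decompose'[OF n0] by blast
  define a where "a = multiplicity p n"
  have na: "n = p ^ a * r" using r by (simp add: a_def)
  have cop: "coprime p r" using prime_p r by (simp add: prime_imp_coprime)
  have r0: "r > 0" using n0 na by (cases r) auto
  have "coprime r (p ^ a)" using cop by (simp add: coprime_commute)
  then obtain x y where xy: "r * x = p ^ a * y + 1"
    using bezout_nat[of r "p ^ a"] r0 by auto
  define t1 where "t1 = t [^] (r * x)"
  \<comment> \<open>The exponent \<open>y * (n - 1)\<close> stands for \<open>- y\<close>, as
    \<open>t [^] n = \<one>\<close>. The exponents of \<open>t1\<close> and \<open>t2\<close> thus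
    add up to \<open>r * x - p ^ a * y = 1\<close> modulo \<open>n\<close>.\<close>
  define t2 where "t2 = t [^] (p ^ a * (y * (n - 1)))"
  have T: "t1 \<in> T" "t2 \<in> T" using t by (simp_all add: t1_def t2_def)
  have pw: "t [^] (n * i) = \<one>" for i using tn tc by (metis nat_pow_pow nat_pow_one)
  have "t1 [^] (p ^ a) = t [^] (n * x)" using tc by (simp add: t1_def nat_pow_pow na mult_ac)
  then have g1: "realizable t1" using realizable_p_element[OF T(1)] pw by metis
  have "t2 [^] r = t [^] (n * (y * (n - 1)))" using tc by (simp add: t2_def nat_pow_pow na mult_ac)
  then have "t2 [^] r \<in> N" using pw subgroup.one_closed[OF sN] by metis
  then have g2: "realizable t2" using realizable_p'_element[OF T(2) _ cop r0] by blast
  have "r * x + p ^ a * (y * (n - 1)) = n * (p ^ a * y) + 1"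
    using xy n0 by (cases n) (auto simp: algebra_simps)
  then have "t1 \<otimes> t2 = t [^] (n * (p ^ a * y) + 1)"
    using tc by (simp add: t1_def t2_def nat_pow_mult)
  also have "\<dots> = t" using pw[of "p ^ a * y"] tc by (simp add: nat_pow_mult[symmetric])
  finally show ?thesis using realizable_mult[OF T(1) g1 T(2) g2] by simp
qed

text \<open>\<open>X\<^sup>-\<^sup>1 u t\<close>, with \<open>X\<close> implementing \<open>\<Phi> t\<close>, lies in the centralizer of \<open>B\<close>; an idempotent found there is
  multiplied by a rank one idempotent of \<open>B\<close>.\<close>

lemma pairing_reduction:
  "\<exists>u'. twisted_rep G scale p K AK \<tau> T M f u' \<and>
     (\<forall>e'. twisted_rep.primitive_idempotent scale AK T f u' e' \<longrightarrow> (\<exists>e. primitive_idempotent e))"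
proof -
  obtain X Y where XY: "\<And>t. t \<in> T \<Longrightarrow> intertwines t (X t) \<and> Y t \<in> B \<and> Y t \<in> AK \<and> X t * Y t = f \<and>
      Y t * X t = f \<and> D (X t) \<in> \<mu>"
    using all_realizable unfolding realizable_def by metis
  have XB: "X t \<in> B" "X t \<in> AK" if "t \<in> T" for t using XY[OF that] by (auto simp: intertwines_def)
  have YB: "Y t \<in> B" "Y t \<in> AK" if "t \<in> T" for t using XY[OF that] by auto
  have DY: "D (Y t) \<in> \<mu>" if t: "t \<in> T" for t
  proof -
    have "D (X t) * D (Y t) = 1" using D_inverse XB YB XY t by blast
    then have "D (Y t) = inverse (D (X t))" by (metis inverse_unique)
    then show ?thesis using XY[OF t] p_roots_inverse by metis
  qed
  have YX: "Y t * X t = f" "X t * Y t = f" if "t \<in> T" for t using XY[OF that] by auto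
  define u' where "u' t = Y t * u t" for t
  \<comment> \<open>This is where the determinant pays off: a central element of \<open>B\<close> is
    a scalar, its determinant is the \<open>p ^ k\<close>-th power of that scalar, and \<mu> is
    closed under p-power roots.\<close>
  have scalar: "\<exists>z\<in>\<mu>. x = z *s f"
    if x: "x \<in> B" "\<And>m. m \<in> M \<Longrightarrow> u m * x = x * u m" and D: "D x \<in> \<mu>" for x
  proof -
    have eq: "x = (\<tau> x / \<tau> f) *s f" using B_center x by blast
    then have "D x = (\<tau> x / \<tau> f) ^ (p ^ k)" using D_scalar by metis
    then have "\<tau> x / \<tau> f \<in> \<mu>" using D p_roots_root by metis
    then show ?thesis using eq by blast
  qed
  have Yphi: "Y t * \<Phi> t b = b * Y t" if t: "t \<in> T" and b: "b \<in> B" for t b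
  proof -
    have "Y t * \<Phi> t b = Y t * (\<Phi> t b * (X t * Y t))" using YX[OF t] Bf[OF \<Phi>_B[OF t b]] by simp
    also have "\<dots> = Y t * (\<Phi> t b * X t) * Y t" by (simp add: mult.assoc)
    also have "\<dots> = Y t * (X t * b) * Y t" using intertwinesD[of t "X t" b] XY[OF t] t b by simp
    also have "\<dots> = (Y t * X t) * b * Y t" by (simp add: mult.assoc)
    finally show ?thesis using YX[OF t] fB[OF b] by simp
  qed
  have u'_comm: "u' t * b = b * u' t" if t: "t \<in> T" and b: "b \<in> B" for t b
  proof -
    have ub: "u t * b = \<Phi> t b * u t" using w(3)[OF t] Bf[OF b] by (simp add: \<Phi>_def mult.assoc)
    have "u' t * b = Y t * (\<Phi> t b * u t)" by (simp add: u'_def mult.assoc ub)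
    also have "\<dots> = (Y t * \<Phi> t b) * u t" by (simp add: mult.assoc)
    also have "\<dots> = b * u' t" using Yphi[OF t b] by (simp add: u'_def mult.assoc)
    finally show ?thesis .
  qed
  have uX: "u t = X t * u' t" if t: "t \<in> T" for t
    using YX(2)[OF t] t by (simp add: u'_def mult.assoc[symmetric])
  have rep': "twisted_rep G scale p K AK \<tau> T M f u'"
  proof unfold_locales
    show "normal_in M T" by (rule MT)
    show "f * f = f" "f \<in> AK" "\<tau> f \<noteq> 0" by (simp_all add: f_AK \<tau>f)
    fix t assume t: "t \<in> T"
    show "u' t \<in> AK" using YB u_AK t by (simp add: u'_def AK_mult)
    show "f * u' t = u' t" using fB[OF YB(1)[OF t]] by (simp add: u'_def mult.assoc[symmetric])
    show "u' t * f = u' t" using t by (simp add: u'_def mult.assoc)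
    { fix s assume s: "s \<in> T"
      have st: "s \<otimes> t \<in> T" using s t by simp
      \<comment> \<open>Up to a factor in \<mu>, \<open>b\<close> is the new cocycle value at
        \<open>s\<close> and \<open>t\<close>. It commutes with \<open>B\<close>, since all
        \<open>u'\<close> do and \<open>u' (s \<otimes> t)\<close> can be cancelled; its determinant
        is in \<mu>, so it is a scalar in \<mu>.\<close>
      define b where "b = Y t * Y s * X (s \<otimes> t)"
      have bB: "b \<in> B" unfolding b_def using YB XB s t st by (intro B_mult) auto
      obtain z where z: "z \<in> \<mu>" "u s * u t = z *s u (s \<otimes> t)" using uu s t by blast
      have "u' s * u' t = Y s * (u s * Y t) * u t" by (simp add: u'_def mult.assoc)
      also have "u s * Y t = \<Phi> s (Y t) * u s"
        using w(3)[OF s] Bf[OF YB(1)[OF t]] by (simp add: \<Phi>_def mult.assoc)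
      also have "Y s * (\<Phi> s (Y t) * u s) * u t = (Y s * \<Phi> s (Y t)) * (u s * u t)"
        by (simp add: mult.assoc)
      also have "\<dots> = (Y t * Y s) * (z *s (X (s \<otimes> t) * u' (s \<otimes> t)))"
        using Yphi[OF s YB(1)[OF t]] z uX[OF st] by simp
      finally have prod: "u' s * u' t = z *s (b * u' (s \<otimes> t))" by (simp add: b_def mult.assoc)
      have inv_st: "b * u' (s \<otimes> t) = inverse z *s (u' s * u' t)" using prod mu_nonzero[OF z(1)] by simp
      have "u m * b = b * u m" if m: "m \<in> M" for m
      proof -
        have mB: "u m \<in> B" by (rule u_B[OF m])
        have c1: "u m * (b * u' (s \<otimes> t)) = (b * u' (s \<otimes> t)) * u m"
        proof -
          have "u m * (u' s * u' t) = (u' s * u' t) * u m"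
            using u'_comm[OF s mB] u'_comm[OF t mB] by (metis mult.assoc)
          then show ?thesis unfolding inv_st by simp
        qed
        define v where "v = w (s \<otimes> t) * X (s \<otimes> t)"
        have "u' (s \<otimes> t) * v = Y (s \<otimes> t) * (u (s \<otimes> t) * w (s \<otimes> t)) * X (s \<otimes> t)"
          by (simp add: u'_def v_def mult.assoc)
        also have "\<dots> = f" using w(2)[OF st] YX[OF st] Bf[OF YB(1)[OF st]] by simp
        finally have uv: "u' (s \<otimes> t) * v = f" .
        have "u m * b = u m * (b * u' (s \<otimes> t)) * v"
          using uv Bf[OF B_mult[OF mB bB]] by (simp add: mult.assoc)
        also have "\<dots> = b * (u' (s \<otimes> t) * u m) * v" unfolding c1 by (simp add: mult.assoc)
        also have "\<dots> = b * u m * (u' (s \<otimes> t) * v)" unfolding u'_comm[OF st mB] by (simp add: mult.assoc)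
        also have "\<dots> = b * u m" using uv Bf[OF B_mult[OF bB mB]] by simp
        finally show ?thesis .
      qed
      moreover have "D b \<in> \<mu>"
        unfolding b_def using YB XB s t st DY XY by (simp add: D_mult B_mult p_roots_mult)
      ultimately obtain y where y: "y \<in> \<mu>" "b = y *s f" using scalar bB by blast
      have fu': "f * u' (s \<otimes> t) = u' (s \<otimes> t)"
        using fB[OF YB(1)[OF st]] by (simp add: u'_def mult.assoc[symmetric])
      have "u' s * u' t = (z * y) *s u' (s \<otimes> t)"
        unfolding prod y(2) using fu' by simp
      then show "\<exists>z\<in>\<mu>. u' s * u' t = z *s u' (s \<otimes> t)" using z y p_roots_mult by blast }
    { assume tM: "t \<notin> M"
      \<comment> \<open>Elements of \<open>B * u t\<close> involve only
        \<open>u (m \<otimes> t)\<close> with \<open>m\<close> in \<open>M\<close>, and none of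
        these group elements is in \<open>N\<close> when \<open>t\<close> is outside
        \<open>M\<close>.\<close>
      have "\<tau> (x * u t) = 0" if "x \<in> B" for x
        using that
      proof (induction rule: span_induct_alt)
        case (step c a y)
        then obtain m where m: "m \<in> M" "a = u m" by blast
        obtain z where z: "u m * u t = z *s u (m \<otimes> t)" using uu m M_T t by blast
        have "m \<otimes> t \<notin> N"
        proof
          assume "m \<otimes> t \<in> N"
          then have "inv m \<otimes> (m \<otimes> t) \<in> M" using N_M m M_mult[OF M_inv] by blast
          then show False using tM m M_carrier T_carrier[OF t] by (simp add: inv_cancel)
        qed
        then have "\<tau> (u (m \<otimes> t)) = 0" using \<tau>u m M_T t by simp
        then show ?case using step.IH z m by (simp add: distrib_right \<tau>_add)
      qed simp
      then show "\<tau> (u' t) = 0" using YB[OF t] by (simp add: u'_def) }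
  next
    fix m assume m: "m \<in> M"
    have mT: "m \<in> T" using m M_T by blast
    have B: "u' m \<in> B" using B_mult[OF YB(1)[OF mT] u_B[OF m]] by (simp add: u'_def)
    have "D (u' m) \<in> \<mu>"
      unfolding u'_def D_mult[OF YB(1)[OF mT] u_B[OF m]] using DY[OF mT] D_u_mu[OF m] p_roots_mult by blast
    then show "\<exists>z\<in>\<mu>. u' m = z *s f" using scalar[OF B] u'_comm[OF mT u_B] by metis
  qed
  have "\<exists>e. primitive_idempotent e" if ge: "twisted_rep.primitive_idempotent scale AK T f u' e'" for e'
  proof -
    interpret R: twisted_rep G scale p K AK \<tau> T M f u' by (rule rep')
    have e': "e' \<in> AK" "e' \<noteq> 0" "e' * e' = e'" "f * e' = e'" "e' * f = e'" "e' \<in> span (u' ` T)"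
      "\<And>t. t \<in> T \<Longrightarrow> \<exists>c. e' * u' t * e' = c *s e'"
      using ge by (auto simp: R.primitive_idempotent_def)
    \<comment> \<open>As \<open>e'\<close> lies in the span of the \<open>u' t\<close>, it commutes
      with \<open>B\<close> like each of them.\<close>
    have e'_comm: "e' * b = b * e'" if b: "b \<in> B" for b
      using e'(6)
    proof (induction rule: span_induct_alt)
      case (step c a y)
      then obtain t where t: "t \<in> T" "a = u' t" by blast
      then show ?case using step.IH u'_comm[OF t(1) b] by (simp add: distrib_left distrib_right)
    qed simp
    have "\<one> [^] (p ^ 0 :: nat) = \<one>" by simp
    then obtain A l where "twisted_rep_polarized G scale p K AK \<tau> T N f u M k A l"
      using polarization_exists[OF T_one] by blast
    then interpret P: twisted_rep_polarized G scale p K AK \<tau> T N f u M k A l by simp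
    define e where "e = P.pol.e * e'"
    have ec: "e = e' * P.pol.e" using e'_comm[OF P.e_B] by (simp add: e_def)
    have "e \<in> AK" using P.pol.e_AK e' by (simp add: e_def AK_mult)
    moreover have "e \<noteq> 0"
    proof
      assume "e = 0"
      \<comment> \<open>Averaging \<open>P.pol.e * e'\<close> over conjugation by \<open>M\<close>
        leaves \<open>e'\<close> untouched and turns the first factor into a nonzero scalar; the
        product cannot vanish.\<close>
      have "of_nat (card A) *s e' = (\<Sum>m\<in>M. u m * P.pol.e * w m) * e'"
        unfolding P.e_average using e'(4) by simp
      also have "\<dots> = (\<Sum>m\<in>M. u m * e * w m)"
        unfolding sum_distrib_right e_def
        by (rule sum.cong) (simp_all add: mult.assoc e'_comm[OF w_B])
      also have "\<dots> = 0" using \<open>e = 0\<close> by simp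
      finally show False using P.pol.card_M e'(2) by simp
    qed
    moreover have "e * e = e"
    proof -
      have "e * e = P.pol.e * (e' * P.pol.e) * e'" by (simp add: e_def mult.assoc)
      also have "\<dots> = (P.pol.e * P.pol.e) * (e' * e')" unfolding e'_comm[OF P.e_B] by (simp add: mult.assoc)
      finally show ?thesis using P.pol.ee e'(3) by (simp add: e_def)
    qed
    moreover have "f * e = e" using P.pol.fe by (simp add: e_def mult.assoc[symmetric])
    moreover have "e * f = e" using e'(5) by (simp add: e_def mult.assoc)
    moreover have "e \<in> span (u ` T)"
    proof -
      have BT: "x \<in> span (u ` T)" if "x \<in> B" for x
        using that span_mono[of "u ` M" "u ` T"] M_sub_T by blast
      have "u' ` T \<subseteq> span (u ` T)"
      proof
        fix x assume "x \<in> u' ` T"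
        then obtain t where "t \<in> T" "x = Y t * u t" by (auto simp: u'_def)
        then show "x \<in> span (u ` T)"
          using span_u_mult[OF subset_refl T_mult BT[OF YB(1)] span_base[OF imageI]] by blast
      qed
      then have "e' \<in> span (u ` T)" using e'(6) span_minimal subspace_span by blast
      then show ?thesis unfolding e_def by (intro span_u_mult[OF subset_refl T_mult BT[OF P.e_B]])
    qed
    moreover have "\<exists>c. e * u t * e = c *s e" if t: "t \<in> T" for t
    proof -
      obtain c where c: "e' * u' t * e' = c *s e'" using e'(7) t by blast
      obtain d where d: "P.pol.e * X t * P.pol.e = d *s P.pol.e" using P.e_B_e[OF XB(1)[OF t]] by blast
      have "e * u t * e = P.pol.e * (e' * X t) * u' t * (e' * P.pol.e)"
        unfolding uX[OF t] by (subst (2) ec) (simp add: e_def mult.assoc)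
      also have "\<dots> = P.pol.e * X t * (e' * u' t * e') * P.pol.e"
        unfolding e'_comm[OF XB(1)[OF t]] by (simp add: mult.assoc)
      also have "\<dots> = c *s (P.pol.e * X t * (e' * P.pol.e))" unfolding c by (simp add: mult.assoc)
      also have "\<dots> = c *s ((P.pol.e * X t * P.pol.e) * e')"
        unfolding e'_comm[OF P.e_B] by (simp add: mult.assoc)
      also have "\<dots> = (c * d) *s e" unfolding d by (simp add: e_def)
      finally show ?thesis by blast
    qed
    ultimately have "primitive_idempotent e" by (simp add: primitive_idempotent_def)
    then show ?thesis by blast
  qed
  then show ?thesis using rep' by blast
qed

end

section \<open>The induction that produces the idempotent\<close>

context twisted_algebra
begin

text \<open>Solvability enters only through \<open>step\<close>, so that one induction serves
  p-solvable and solvable groups. The gap between \<open>N\<close> and \<open>T\<close> shrinks in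
  every case: Clifford theory replaces the pair \<open>T\<close>, \<open>N\<close> by
  \<open>C.S\<close>, \<open>M\<close>, and the pairing replaces it by \<open>T\<close>,
  \<open>M\<close>.\<close>

theorem primitive_idempotent_exists:
  assumes step: "\<And>T N. normal_in N T \<Longrightarrow> N \<noteq> T \<Longrightarrow> \<exists>M. normal_in M T \<and> N \<subset> M \<and>
      (\<exists>r. card M = r * card N \<and> ((\<exists>k. r = p ^ k) \<or> coprime p r))"
    and rep: "twisted_rep G scale p K AK \<tau> T N f u"
  shows "\<exists>e. twisted_rep.primitive_idempotent scale AK T f u e"
  using rep
proof (induction "card T - card N" arbitrary: T N f u rule: less_induct)
  case less
  interpret twisted_rep G scale p K AK \<tau> T N f u by (rule less.prems)
  show ?case
  proof (cases "N = T")
    case True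
    then show ?thesis using primitive_idempotent_trivial by blast
  next
    case False
    have lift: "\<exists>e. primitive_idempotent e" if M: "N \<subset> M" and l: "twisted_rep_char G scale p K AK \<tau> T N f u M l" for M l
    proof -
      interpret C: twisted_rep_char G scale p K AK \<tau> T N f u M l by (rule l)
      have "card M \<le> card C.S" using C.M_S C.S_T finite_T
        by (metis (no_types, lifting) card_mono rev_finite_subset subsetI)
      moreover have "card C.S \<le> card T" using C.S_T finite_T by (intro card_mono) auto
      moreover have "card N < card M" using psubset_card_mono[OF C.finite_M M] .
      ultimately have "card C.S - card M < card T - card N" by linarith
      then obtain x where "twisted_rep.primitive_idempotent scale AK C.S C.e (\<lambda>t. u t * C.e) x"
        using less.hyps C.stabilizer_rep by blast
      then show ?thesis using C.primitive_idempotent_lift by blast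
    qed
    obtain M0 r where M0: "normal_in M0 T" "N \<subset> M0" "card M0 = r * card N" "(\<exists>k. r = p ^ k) \<or> coprime p r"
      using step[OF NT False] by blast
    show ?thesis
    proof (cases "coprime p r")
      case True
      then show ?thesis using coprime_character[OF M0(1) _ M0(3)] lift[OF M0(2)] M0(2) by blast
    next
      case False
      \<comment> \<open>The section supplied by \<open>step\<close> need not be minimal. A smallest
        one of p-power index above \<open>N\<close> is minimal among all subgroups normal in
        \<open>T\<close>, since anything between has p-power index as well.\<close>
      define P where "P L \<longleftrightarrow> normal_in L T \<and> N \<subset> L \<and> (\<exists>k. card L = p ^ k * card N)" for L
      have "P M0" using M0 False by (auto simp: P_def)
      from ex_has_least_nat[of P, OF this, of card]
      obtain M where M: "P M" "\<And>L. P L \<Longrightarrow> card M \<le> card L" by blast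
      then obtain k where MT: "normal_in M T" and NMs: "N \<subset> M" and k: "card M = p ^ k * card N"
        by (auto simp: P_def)
      note sM = normal_inD(1)[OF MT] and M_sub_T = normal_inD(3)[OF MT] and M_conj = normal_inD(4)[OF MT]
      have finM: "finite M" using finite_subset[OF M_sub_T finite_T] .
      have nNM: "normal_in N M" using normal_in_mono[OF NT sM _ M_sub_T] NMs by blast
      have min: "L = M" if L: "normal_in L T" "N \<subset> L" "L \<subseteq> M" for L
      proof -
        have nNL: "normal_in N L"
          using normal_in_mono[OF NT normal_inD(1)[OF L(1)] _ normal_inD(3)[OF L(1)]] L by blast
        have "\<exists>k. x [^] (p ^ k :: nat) \<in> N" if "x \<in> L" for x
          using normal_in_pow_index[OF nNM finM k, of x] that L by blast
        then have "\<exists>k. card L = p ^ k * card N"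
          using card_p_power_index[OF nNL finite_subset[OF L(3) finM] prime_p] by blast
        then have "card M \<le> card L" using M(2) L by (simp add: P_def)
        then show ?thesis using card_seteq[OF finM L(3)] by blast
      qed
      have abel: "m \<otimes> h \<otimes> inv m \<otimes> inv h \<in> N" if "m \<in> M" "h \<in> M" for m h
        using minimal_p_section_abelian[OF finite_carrier prime_p NT MT NMs k min that] .
      \<comment> \<open>The radical of the commutator pairing. It is normal in \<open>T\<close>, so
        that minimality leaves \<open>Z = M\<close>, where the cocycle splits, or
        \<open>Z = N\<close>, where the pairing is nondegenerate.\<close>
      define Z where "Z = {m\<in>M. \<forall>h\<in>M. u m * u h = u h * u m}"
      have MT': "m \<in> T" if "m \<in> M" for m using M_sub_T that by blast
      have sZ: "subgroup Z G"
      proof (rule subgroupI)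
        show "Z \<subseteq> carrier G" using MT' T_carrier by (auto simp: Z_def)
        obtain c where c: "u \<one> = c *s f" using uN subgroup.one_closed[OF sN] by blast
        then have "\<one> \<in> Z" using subgroup.one_closed[OF sM] MT' by (auto simp: Z_def)
        then show "Z \<noteq> {}" by blast
        show "inv x \<in> Z" if "x \<in> Z" for x
          using that MT' subgroup.m_inv_closed[OF sM] subgroup.m_inv_closed[OF subgroup_commutant, of _ x]
          by (auto simp: Z_def)
        show "x \<otimes> y \<in> Z" if "x \<in> Z" "y \<in> Z" for x y
          using that MT' subgroup.m_closed[OF sM] subgroup.m_closed[OF subgroup_commutant, of _ x y]
          by (auto simp: Z_def)
      qed
      have NZ: "N \<subseteq> Z"
      proof
        fix n assume n: "n \<in> N"
        then obtain c where "u n = c *s f" using uN by blast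
        then show "n \<in> Z" using n NMs MT' by (auto simp: Z_def)
      qed
      have "t \<otimes> m \<otimes> inv t \<in> Z" if t: "t \<in> T" and m: "m \<in> Z" for t m
      proof -
        have mM: "m \<in> M" "m \<in> T" using m MT' by (auto simp: Z_def)
        have "inv t \<otimes> x \<otimes> t \<in> M" if "x \<in> M" for x
          using M_conj[of "inv t" x] T_carrier[OF t] t that by simp
        then have "u (t \<otimes> m \<otimes> inv t) * u x = u x * u (t \<otimes> m \<otimes> inv t)" if x: "x \<in> M" for x
          by (intro commutant_conj[OF t mM(2), of M]) (use m MT' x in \<open>auto simp: Z_def\<close>)
        then show ?thesis using M_conj[OF t mM(1)] by (simp add: Z_def)
      qed
      then have ZT: "normal_in Z T" using sZ sT M_sub_T by (auto simp: normal_in_def Z_def)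
      have ZM: "Z \<subseteq> M" by (auto simp: Z_def)
      show ?thesis
      proof (cases "Z = M")
        case True
        have comm: "u m * u h = u h * u m" if "m \<in> M" "h \<in> M" for m h
          using that True by (auto simp: Z_def)
        have "subspace {x. f * x = x}" by (auto simp: subspace_def distrib_left)
        moreover have "f \<in> {x. f * x = x}" by simp
        moreover have "u m * x \<in> {x. f * x = x}" if "m \<in> M" "x \<in> {x. f * x = x}" for m x
          using that MT' fuN by auto
        ultimately obtain l where "twisted_rep_char G scale p K AK \<tau> T N f u M l"
          using commuting_character[OF MT _ k comm, of "{x. f * x = x}" f] NMs f_nonzero by blast
        then show ?thesis using lift[OF NMs] by blast
      next
        case False
        then have ZN: "Z = N" using min[OF ZT _ ZM] NZ by blast
        interpret twisted_rep_pairing G scale p K AK \<tau> T N f u M k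
          using MT NMs k abel ZN by unfold_locales (auto simp: Z_def)
        obtain u' where u': "twisted_rep G scale p K AK \<tau> T M f u'"
          "\<And>e'. twisted_rep.primitive_idempotent scale AK T f u' e' \<Longrightarrow> \<exists>e. primitive_idempotent e"
          using pairing_reduction by blast
        have "card T - card M < card T - card N"
          using psubset_card_mono[OF finM NMs] card_mono[OF finite_T M_sub_T] by linarith
        then show ?thesis using less.hyps[OF _ u'(1)] u'(2) by blast
      qed
    qed
  qed
qed

end

section \<open>Characters from idempotents of the group algebra\<close>

text \<open>The group algebra is realized inside the linear operators on \<open>'a \<Rightarrow> complex\<close>, which form a ring type
  that does not depend on the group.\<close>

typedef 'a lop = "{F :: ('a \<Rightarrow> complex) \<Rightarrow> ('a \<Rightarrow> complex).
    (\<forall>x y. F (\<lambda>a. x a + y a) = (\<lambda>a. F x a + F y a)) \<and> (\<forall>c x. F (\<lambda>a. c * x a) = (\<lambda>a. c * F x a))}"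
  morphisms lop_apply Lop
  by (rule exI[of _ "\<lambda>x. x"]) auto

setup_lifting type_definition_lop

instantiation lop :: (type) ring
begin

lift_definition zero_lop :: "'a lop" is "\<lambda>_ _. 0" by simp
lift_definition plus_lop :: "'a lop \<Rightarrow> 'a lop \<Rightarrow> 'a lop" is "\<lambda>F H x a. F x a + H x a"
  by (simp add: algebra_simps)
lift_definition uminus_lop :: "'a lop \<Rightarrow> 'a lop" is "\<lambda>F x a. - F x a" by simp
lift_definition minus_lop :: "'a lop \<Rightarrow> 'a lop \<Rightarrow> 'a lop" is "\<lambda>F H x a. F x a - H x a"
  by (simp add: algebra_simps)
lift_definition times_lop :: "'a lop \<Rightarrow> 'a lop \<Rightarrow> 'a lop" is "\<lambda>F H x. F (H x)" by simp

instance by standard (transfer; simp add: fun_eq_iff)+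

end

lift_definition lscale :: "complex \<Rightarrow> 'a lop \<Rightarrow> 'a lop" is "\<lambda>c F x a. c * F x a"
  by (simp add: algebra_simps)

interpretation lop: vector_space "lscale :: complex \<Rightarrow> 'a lop \<Rightarrow> 'a lop"
  by unfold_locales (transfer; simp add: fun_eq_iff algebra_simps)+

lemma lscale_mult_left [simp]: "lscale c x * y = lscale c (x * y)"
  by transfer simp

lemma lscale_mult_right [simp]: "x * lscale c y = lscale c (x * y)"
  by transfer simp

locale finite_group = group G for G (structure) +
  assumes finite_G: "finite (carrier G)"
begin

text \<open>Left translation, cut off outside the carrier. Consequently \<open>L \<one>\<close> is
  the projection to the functions supported on the group and not the identity operator.\<close>

lift_definition L :: "'a \<Rightarrow> 'a lop" is "\<lambda>g x y. if y \<in> carrier G then x (inv g \<otimes> y) else 0"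
  by (auto simp: fun_eq_iff)

text \<open>An element of the group algebra, applied to the delta function at \<open>\<one>\<close>,
  returns the function of its own coefficients.\<close>

lift_definition coef :: "'a \<Rightarrow> 'a lop \<Rightarrow> complex" is "\<lambda>g F. F (\<lambda>a. if a = \<one> then 1 else 0) g" .

lemma coef_add: "coef g (x + y) = coef g x + coef g y" by transfer simp
lemma coef_scale: "coef g (lscale c x) = c * coef g x" by transfer simp
lemma coef_zero: "coef g 0 = 0" by transfer simp
lemma coef_sum: "coef g (sum F I) = (\<Sum>i\<in>I. coef g (F i))"
  by (induction I rule: infinite_finite_induct) (auto simp: coef_add coef_zero)

lemma L_mult: "g \<in> carrier G \<Longrightarrow> h \<in> carrier G \<Longrightarrow> L g * L h = L (g \<otimes> h)"
proof transfer
  fix g h assume gh: "g \<in> carrier G" "h \<in> carrier G"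
  have "inv h \<otimes> (inv g \<otimes> y) = inv (g \<otimes> h) \<otimes> y" if "y \<in> carrier G" for y
    using gh that by (simp add: inv_mult_group m_assoc)
  then show "(\<lambda>x. (\<lambda>x y. if y \<in> carrier G then x (inv g \<otimes> y) else 0)
      ((\<lambda>x y. if y \<in> carrier G then x (inv h \<otimes> y) else 0) x)) =
    (\<lambda>x y. if y \<in> carrier G then x (inv (g \<otimes> h) \<otimes> y) else 0)"
    using gh by (intro ext) simp
qed

lemma coef_L_mult: "g \<in> carrier G \<Longrightarrow> h \<in> carrier G \<Longrightarrow> coef h (L g * x) = coef (inv g \<otimes> h) x"
  by transfer simp

lemma coef_L:
  assumes "g \<in> carrier G" "h \<in> carrier G"
  shows "coef h (L g) = (if h = g then 1 else 0)"
proof -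
  have "inv g \<otimes> h = \<one> \<longleftrightarrow> h = g"
    using assms by (metis inv_closed inv_inv l_inv inv_equality)
  then show ?thesis using assms by transfer simp
qed

abbreviation "CG \<equiv> lop.span (L ` carrier G)"

lemma L_CG: "g \<in> carrier G \<Longrightarrow> L g \<in> CG" by (simp add: lop.span_base)

lemma CG_expand:
  assumes "x \<in> CG"
  shows "x = (\<Sum>g\<in>carrier G. lscale (coef g x) (L g))"
  using assms
proof (induction rule: lop.span_induct_alt)
  case base
  then show ?case by (simp add: coef_zero)
next
  case (step c a y)
  then obtain h where h: "h \<in> carrier G" "a = L h" by blast
  have "(\<Sum>g\<in>carrier G. lscale (coef g a) (L g)) = (\<Sum>g\<in>carrier G. if g = h then L h else 0)"
    by (rule sum.cong) (auto simp: h coef_L)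
  then have a: "(\<Sum>g\<in>carrier G. lscale (coef g a) (L g)) = a" using h finite_G by simp
  have "(\<Sum>g\<in>carrier G. lscale (coef g (lscale c a + y)) (L g)) =
     lscale c (\<Sum>g\<in>carrier G. lscale (coef g a) (L g)) + (\<Sum>g\<in>carrier G. lscale (coef g y) (L g))"
    by (simp add: coef_add coef_scale lop.scale_left_distrib sum.distrib lop.scale_sum_right)
  then show ?case using a step.IH by simp
qed

lemma CG_mult: "x \<in> CG \<Longrightarrow> y \<in> CG \<Longrightarrow> x * y \<in> CG"
proof (induction rule: lop.span_induct_alt)
  case base
  then show ?case by (simp add: lop.span_zero)
next
  case (step c a z)
  then obtain g where g: "g \<in> carrier G" "a = L g" by blast
  have "L g * y \<in> CG" using step.prems
  proof (induction rule: lop.span_induct_alt)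
    case base
    then show ?case by (simp add: lop.span_zero)
  next
    case (step c b z')
    then show ?case using g
      by (auto simp: distrib_left L_mult intro!: lop.span_add lop.span_scale L_CG)
  qed
  then show ?case using step g by (simp add: distrib_right lop.span_add lop.span_scale)
qed

lemma L_one: assumes "x \<in> CG" shows "L \<one> * x = x"
proof -
  have "L \<one> * (\<Sum>g\<in>carrier G. lscale (coef g x) (L g)) = (\<Sum>g\<in>carrier G. lscale (coef g x) (L g))"
    by (simp add: sum_distrib_left L_mult)
  then show ?thesis using CG_expand[OF assms] by simp
qed

lemma coef_mult:
  assumes x: "x \<in> CG" and k: "k \<in> carrier G"
  shows "coef k (x * y) = (\<Sum>g\<in>carrier G. coef g x * coef (inv g \<otimes> k) y)"
proof -
  have "coef k (x * y) = coef k ((\<Sum>g\<in>carrier G. lscale (coef g x) (L g)) * y)"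
    using CG_expand[OF x] by simp
  also have "\<dots> = (\<Sum>g\<in>carrier G. coef g x * coef (inv g \<otimes> k) y)"
    using k by (simp add: sum_distrib_right coef_sum coef_scale coef_L_mult)
  finally show ?thesis .
qed

definition KG :: "complex set \<Rightarrow> 'a lop set" where
  "KG K = {x\<in>CG. \<forall>g\<in>carrier G. coef g x \<in> K}"

definition star :: "'a lop \<Rightarrow> 'a lop" where
  "star x = (\<Sum>g\<in>carrier G. lscale (cnj (coef g x)) (L (inv g)))"

lemma star_CG: "star x \<in> CG"
  unfolding star_def by (intro lop.span_sum lop.span_scale L_CG) auto

lemma coef_star:
  assumes k: "k \<in> carrier G"
  shows "coef k (star x) = cnj (coef (inv k) x)"
proof -
  have "coef k (star x) = (\<Sum>g\<in>carrier G. if g = inv k then cnj (coef (inv k) x) else 0)"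
    unfolding star_def coef_sum coef_scale using k
    by (intro sum.cong) (auto simp: coef_L)
  then show ?thesis using k finite_G by simp
qed

lemma coef_star_mult:
  assumes x: "x \<in> CG" and k: "k \<in> carrier G"
  shows "coef k (star x * x) = (\<Sum>h\<in>carrier G. cnj (coef h x) * coef (h \<otimes> k) x)"
proof -
  have "coef k (star x * x) = (\<Sum>g\<in>carrier G. cnj (coef (inv g) x) * coef (inv g \<otimes> k) x)"
    using coef_mult[OF star_CG k] by (simp add: coef_star)
  also have "\<dots> = (\<Sum>h\<in>carrier G. cnj (coef h x) * coef (h \<otimes> k) x)"
    by (rule sum.reindex_bij_witness[where i = "\<lambda>g. inv g" and j = "\<lambda>g. inv g"]) auto
  finally show ?thesis .
qed

lemma sum_cnj_zero:
  assumes "(\<Sum>h\<in>carrier G. cnj (z h) * z h) = 0" "g \<in> carrier G"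
  shows "z g = 0"
proof -
  have "cnj (z h) * z h = of_real ((cmod (z h))\<^sup>2)" for h
    using complex_norm_square[of "z h"] by (simp add: mult.commute)
  then have "(\<Sum>h\<in>carrier G. cnj (z h) * z h) = of_real (\<Sum>h\<in>carrier G. (cmod (z h))\<^sup>2)" by simp
  then have "of_real (\<Sum>h\<in>carrier G. (cmod (z h))\<^sup>2) = (0 :: complex)" using assms(1) by simp
  then have "(\<Sum>h\<in>carrier G. (cmod (z h))\<^sup>2) = 0" by (simp only: of_real_eq_0_iff)
  then have "(cmod (z g))\<^sup>2 = 0"
    using finite_G assms(2) by (simp add: sum_nonneg_eq_0_iff)
  then show ?thesis by simp
qed

text \<open>The group algebra is semiprime because of its positive definite involution.\<close>

lemma CG_semiprime:
  assumes x: "x \<in> CG" and z: "\<And>y. y \<in> CG \<Longrightarrow> x * y * x = 0"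
  shows "x = 0"
proof -
  define y where "y = star x * x"
  have yCG: "y \<in> CG" using CG_mult star_CG x by (simp add: y_def)
  have "x * star x * x = 0" using z star_CG by blast
  then have "y * y = 0" by (simp add: y_def mult.assoc)
  then have "0 = coef \<one> (y * y)" by (simp add: coef_zero)
  also have "\<dots> = (\<Sum>g\<in>carrier G. coef g y * coef (inv g) y)" using coef_mult[OF yCG] by simp
  \<comment> \<open>As \<open>y\<close> is fixed by \<open>star\<close>, its square has at
    \<open>\<one>\<close> the sum of the squared absolute values of its coefficients. The
    coefficient of \<open>y\<close> at \<open>\<one>\<close>, now known to be 0, is in turn such a
    sum for \<open>x\<close>.\<close>
  also have "\<dots> = (\<Sum>g\<in>carrier G. cnj (coef g y) * coef g y)"
  proof (rule sum.cong[OF refl])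
    fix g assume g: "g \<in> carrier G"
    have "coef (inv g) y = (\<Sum>h\<in>carrier G. cnj (coef h x) * coef (h \<otimes> inv g) x)"
      using coef_star_mult[OF x, of "inv g"] g by (simp add: y_def)
    also have "\<dots> = (\<Sum>h\<in>carrier G. cnj (coef (h \<otimes> g) x) * coef h x)"
      by (rule sum.reindex_bij_witness[where i = "\<lambda>h. h \<otimes> g" and j = "\<lambda>h. h \<otimes> inv g"])
         (use g in \<open>auto simp: m_assoc\<close>)
    also have "\<dots> = cnj (coef g y)"
      using coef_star_mult[OF x g] by (simp add: y_def mult.commute)
    finally show "coef g y * coef (inv g) y = cnj (coef g y) * coef g y" by simp
  qed
  finally have "(\<Sum>g\<in>carrier G. cnj (coef g y) * coef g y) = 0" by (rule sym)
  then have "coef \<one> y = 0" by (rule sum_cnj_zero) (rule one_closed)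
  moreover have "coef \<one> y = (\<Sum>h\<in>carrier G. cnj (coef h x) * coef (h \<otimes> \<one>) x)"
    unfolding y_def by (rule coef_star_mult[OF x one_closed])
  moreover have "\<dots> = (\<Sum>h\<in>carrier G. cnj (coef h x) * coef h x)"
    by (rule sum.cong) simp_all
  ultimately have "(\<Sum>h\<in>carrier G. cnj (coef h x) * coef h x) = 0" by metis
  then have "coef g x = 0" if "g \<in> carrier G" for g using that by (rule sum_cnj_zero)
  then have "(\<Sum>g\<in>carrier G. lscale (coef g x) (L g)) = 0" by simp
  then show ?thesis using CG_expand[OF x] by metis
qed

text \<open>The trace of \<open>g\<close> on the left ideal \<open>CG * e\<close> is the trace of \<open>x \<mapsto> g x e\<close> on \<open>CG\<close>.\<close>

definition ideal_character :: "'a lop \<Rightarrow> 'a \<Rightarrow> complex" where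
  "ideal_character e g = (\<Sum>h\<in>carrier G. coef h (L g * L h * e))"

definition minimal_idempotent :: "'a lop \<Rightarrow> bool" where
  "minimal_idempotent e \<longleftrightarrow> e \<in> CG \<and> e \<noteq> 0 \<and> e * e = e \<and> (\<forall>g\<in>carrier G. \<exists>c. e * L g * e = lscale c e)"

end

section \<open>The irreducible representation on a minimal left ideal\<close>

lemma module_vec_subspaceD:
  assumes "VectorSpace.subspace class_ring W (module_vec TYPE(complex) n)"
  shows "W \<subseteq> carrier_vec n" "0\<^sub>v n \<in> W" "\<And>v w. v \<in> W \<Longrightarrow> w \<in> W \<Longrightarrow> v + w \<in> W"
    "\<And>c v. v \<in> W \<Longrightarrow> c \<cdot>\<^sub>v v \<in> W"
proof -
  interpret submodule class_ring W "module_vec TYPE(complex) n"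
    using assms by (simp add: VectorSpace.subspace_def)
  show "W \<subseteq> carrier_vec n" using subset by (simp add: module_vec_simps)
  show "0\<^sub>v n \<in> W" using zero_closed by (simp add: module_vec_simps)
  show "v + w \<in> W" if "v \<in> W" "w \<in> W" for v w using m_closed that by (simp add: module_vec_simps)
  show "c \<cdot>\<^sub>v v \<in> W" if "v \<in> W" for c v
    using smult_closed[of c v] that by (simp add: module_vec_simps class_ring_simps)
qed

text \<open>\<open>b\<close> is a basis of the left ideal generated by \<open>e\<close>, chosen
  among the vectors \<open>L h * e\<close>; numbering it turns the ideal into a space of column
  vectors.\<close>

locale minimal_left_ideal = finite_group +
  fixes e :: "'a lop" and n :: nat and b :: "nat \<Rightarrow> 'a lop"
  assumes e: "minimal_idempotent e"
    and b_inj: "inj_on b {..<n}" and b_indep: "lop.independent (b ` {..<n})"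
    and b_sub: "b ` {..<n} \<subseteq> (\<lambda>h. L h * e) ` carrier G"
    and b_span: "(\<lambda>h. L h * e) ` carrier G \<subseteq> lop.span (b ` {..<n})"
begin

lemma e_CG: "e \<in> CG" and e_nonzero: "e \<noteq> 0" and ee: "e * e = e"
  using e by (auto simp: minimal_idempotent_def)

abbreviation "V \<equiv> lop.span (b ` {..<n})"

lemma V_eq: "V = lop.span ((\<lambda>h. L h * e) ` carrier G)"
  using b_sub b_span by (meson lop.span_minimal lop.span_mono lop.subspace_span subset_antisym)

lemma Le_V: "h \<in> carrier G \<Longrightarrow> L h * e \<in> V" using b_span by blast

lemma e_V: "e \<in> V" using Le_V[of \<one>] L_one[OF e_CG] by simp

lemma L_V:
  assumes g: "g \<in> carrier G" and x: "x \<in> V"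
  shows "L g * x \<in> V"
  using x unfolding V_eq
proof (induction rule: lop.span_induct_alt)
  case base
  then show ?case by (simp add: lop.span_zero)
next
  case (step c a y)
  then obtain h where h: "h \<in> carrier G" "a = L h * e" by blast
  have "L g * a = L (g \<otimes> h) * e" using h g by (simp add: L_mult mult.assoc[symmetric])
  then have "L g * a \<in> lop.span ((\<lambda>h. L h * e) ` carrier G)" using h g by (auto intro: lop.span_base)
  then show ?case using step.IH by (simp add: distrib_left lop.span_add lop.span_scale)
qed

lemma V_CG: assumes "x \<in> V" shows "x \<in> CG"
proof -
  have "(\<lambda>h. L h * e) ` carrier G \<subseteq> CG" using CG_mult L_CG e_CG by blast
  then show ?thesis using assms unfolding V_eq using lop.span_minimal lop.subspace_span by blast
qed

lemma V_e: assumes "x \<in> V" shows "x * e = x"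
  using assms unfolding V_eq
  by (induction rule: lop.span_induct_alt) (auto simp: distrib_right mult.assoc ee)

lemma b_V: "i < n \<Longrightarrow> b i \<in> V" by (auto intro: lop.span_base)

definition \<gamma> :: "nat \<Rightarrow> 'a lop \<Rightarrow> complex" where
  "\<gamma> i x = lop.representation (b ` {..<n}) x (b i)"

lemma \<gamma>_add: "x \<in> V \<Longrightarrow> y \<in> V \<Longrightarrow> \<gamma> i (x + y) = \<gamma> i x + \<gamma> i y"
  by (simp add: \<gamma>_def lop.representation_add b_indep)

lemma \<gamma>_scale: "x \<in> V \<Longrightarrow> \<gamma> i (lscale c x) = c * \<gamma> i x"
  by (simp add: \<gamma>_def lop.representation_scale b_indep)

lemma \<gamma>_zero: "\<gamma> i 0 = 0"
  by (simp add: \<gamma>_def lop.representation_zero)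

lemma \<gamma>_sum: "(\<And>k. k \<in> I \<Longrightarrow> F k \<in> V) \<Longrightarrow> \<gamma> i (sum F I) = (\<Sum>k\<in>I. \<gamma> i (F k))"
  by (simp add: \<gamma>_def lop.representation_sum b_indep)

lemma \<gamma>_b: "i < n \<Longrightarrow> j < n \<Longrightarrow> \<gamma> i (b j) = (if i = j then 1 else 0)"
  using lop.representation_basis[OF b_indep, of "b j"] inj_onD[OF b_inj, of i j]
  by (auto simp: \<gamma>_def)

lemma \<gamma>_expand: assumes "x \<in> V" shows "(\<Sum>i<n. lscale (\<gamma> i x) (b i)) = x"
proof -
  have "(\<Sum>y\<in>b ` {..<n}. lscale (lop.representation (b ` {..<n}) x y) y) = x"
    by (rule lop.sum_representation_eq[OF b_indep assms]) auto
  then show ?thesis by (simp add: sum.reindex[OF b_inj] \<gamma>_def)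
qed

lemma \<gamma>_matrix:
  assumes "g \<in> carrier G" "x \<in> V" "i < n"
  shows "\<gamma> i (L g * x) = (\<Sum>j<n. \<gamma> i (L g * b j) * \<gamma> j x)"
proof -
  have "\<gamma> i (L g * x) = \<gamma> i (\<Sum>j<n. lscale (\<gamma> j x) (L g * b j))"
    by (subst \<gamma>_expand[OF assms(2), symmetric]) (simp add: sum_distrib_left)
  also have "\<dots> = (\<Sum>j<n. \<gamma> i (lscale (\<gamma> j x) (L g * b j)))"
    using assms by (intro \<gamma>_sum lop.span_scale L_V b_V) auto
  also have "\<dots> = (\<Sum>j<n. \<gamma> i (L g * b j) * \<gamma> j x)"
    using assms by (intro sum.cong) (auto simp: \<gamma>_scale L_V b_V mult.commute)
  finally show ?thesis .
qed

definition \<rho> :: "'a \<Rightarrow> complex mat" where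
  "\<rho> g = mat n n (\<lambda>(i, j). \<gamma> i (L g * b j))"

lemma \<rho>_carrier: "\<rho> g \<in> carrier_mat n n" by (simp add: \<rho>_def)

lemma \<rho>_mult:
  assumes "g \<in> carrier G" "h \<in> carrier G"
  shows "\<rho> (g \<otimes> h) = \<rho> g * \<rho> h"
proof (rule eq_matI)
  fix i j assume "i < dim_row (\<rho> g * \<rho> h)" "j < dim_col (\<rho> g * \<rho> h)"
  then have ij: "i < n" "j < n" by (auto simp: \<rho>_def)
  have "\<gamma> i (L (g \<otimes> h) * b j) = \<gamma> i (L g * (L h * b j))"
    using assms by (simp add: L_mult[symmetric] mult.assoc)
  also have "\<dots> = (\<Sum>k<n. \<gamma> i (L g * b k) * \<gamma> k (L h * b j))"
    using assms ij by (intro \<gamma>_matrix L_V b_V)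
  finally show "\<rho> (g \<otimes> h) $$ (i, j) = (\<rho> g * \<rho> h) $$ (i, j)"
    using ij by (simp add: \<rho>_def scalar_prod_def lessThan_atLeast0)
qed (simp_all add: \<rho>_def)

lemma \<rho>_one: "\<rho> \<one> = 1\<^sub>m n"
  by (rule eq_matI) (simp_all add: \<rho>_def L_one[OF V_CG[OF b_V]] \<gamma>_b)

lemma \<rho>_representation: "representation G n \<rho>"
  unfolding representation_def
proof (rule homI)
  fix g assume g: "g \<in> carrier G"
  have "\<rho> g * \<rho> (inv g) = 1\<^sub>m n" "\<rho> (inv g) * \<rho> g = 1\<^sub>m n"
    using \<rho>_mult[of g "inv g"] \<rho>_mult[of "inv g" g] \<rho>_one g by simp_all
  then show "\<rho> g \<in> carrier (GL n)"
    using \<rho>_carrier by (auto simp: GL_def units_of_def Units_def ring_mat_simps)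
next
  fix g h assume "g \<in> carrier G" "h \<in> carrier G"
  then show "\<rho> (g \<otimes> h) = \<rho> g \<otimes>\<^bsub>GL n\<^esub> \<rho> h"
    by (simp add: \<rho>_mult GL_def units_of_def ring_mat_simps)
qed

definition \<gamma>vec :: "'a lop \<Rightarrow> complex vec" where "\<gamma>vec x = vec n (\<lambda>i. \<gamma> i x)"

lemma \<rho>_\<gamma>vec:
  assumes "g \<in> carrier G" "x \<in> V"
  shows "\<rho> g *\<^sub>v \<gamma>vec x = \<gamma>vec (L g * x)"
  by (rule eq_vecI)
     (use assms in \<open>simp_all add: \<gamma>vec_def \<rho>_def scalar_prod_def lessThan_atLeast0 \<gamma>_matrix\<close>)

lemma \<gamma>vec_surj:
  assumes "w \<in> carrier_vec n"
  shows "\<exists>x\<in>V. \<gamma>vec x = w"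
proof -
  define x where "x = (\<Sum>i<n. lscale (w $ i) (b i))"
  have xV: "x \<in> V" unfolding x_def by (intro lop.span_sum lop.span_scale b_V) auto
  have "\<gamma> i x = w $ i" if i: "i < n" for i
  proof -
    have "\<gamma> i x = (\<Sum>k<n. \<gamma> i (lscale (w $ k) (b k)))"
      unfolding x_def by (intro \<gamma>_sum lop.span_scale b_V) auto
    also have "\<dots> = (\<Sum>k<n. if k = i then w $ i else 0)"
      by (rule sum.cong) (auto simp: \<gamma>_scale b_V \<gamma>_b i)
    finally show ?thesis using i by simp
  qed
  then have "\<gamma>vec x = w" using assms by (intro eq_vecI) (auto simp: \<gamma>vec_def)
  then show ?thesis using xV by blast
qed

lemma e_CG_e: "y \<in> CG \<Longrightarrow> \<exists>c. e * y * e = lscale c e"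
proof (induction rule: lop.span_induct_alt)
  case base
  show ?case by (intro exI[of _ 0]) simp
next
  case (step c a y)
  then obtain d d' where "e * a * e = lscale d e" "e * y * e = lscale d' e"
    using e unfolding minimal_idempotent_def by blast
  then have "e * (lscale c a + y) * e = lscale (c * d + d') e"
    by (simp add: distrib_left distrib_right lop.scale_left_distrib)
  then show ?case by blast
qed

text \<open>Elements of the ideal satisfy \<open>x * e = x\<close>. If all
  \<open>e * L g * x\<close> vanished, then so would \<open>x * y * x\<close> for every
  \<open>y\<close>, contrary to semiprimeness.\<close>

lemma V_nondegenerate:
  assumes x: "x \<in> V" "x \<noteq> 0"
  shows "\<exists>g\<in>carrier G. e * L g * x \<noteq> 0"
proof (rule ccontr)
  assume a: "\<not> ?thesis"
  have "e * y * x = 0" if "y \<in> CG" for y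
    using that
  proof (induction rule: lop.span_induct_alt)
    case (step c a' y)
    then show ?case using a by (auto simp: distrib_left distrib_right)
  qed simp
  then have "x * y * x = 0" if "y \<in> CG" for y
    using V_e[OF x(1)] that by (metis mult.assoc mult_zero_right)
  then show False using CG_semiprime[OF V_CG[OF x(1)]] x(2) by blast
qed

text \<open>A nonzero invariant subspace contains some nonzero \<open>e * L g * x\<close>. This
  equals \<open>e * (L g * x) * e\<close>, a multiple of \<open>e\<close>; so the subspace contains
  \<open>e\<close> and the whole ideal.\<close>

lemma \<rho>_irreducible: "irreducible_representation G n \<rho>"
proof -
  have "n > 0"
  proof (rule ccontr)
    assume "\<not> n > 0"
    then have "b ` {..<n} = {}" by auto
    then have "e = 0" using e_V by simp
    then show False using e_nonzero by simp
  qed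
  moreover have "W = carrier_vec n" if W: "invariant_subspace G n \<rho> W" and ne: "W \<noteq> {0\<^sub>v n}" for W
  proof -
    have sub: "VectorSpace.subspace class_ring W (module_vec TYPE(complex) n)"
      and inv: "\<And>g w. g \<in> carrier G \<Longrightarrow> w \<in> W \<Longrightarrow> \<rho> g *\<^sub>v w \<in> W"
      using W by (auto simp: invariant_subspace_def)
    note Wsub = module_vec_subspaceD[OF sub]
    define X where "X = {x\<in>V. \<gamma>vec x \<in> W}"
    have X_sub: "lop.subspace X"
    proof (rule lop.subspaceI)
      have "\<gamma>vec 0 = 0\<^sub>v n" by (rule eq_vecI) (simp_all add: \<gamma>vec_def \<gamma>_zero)
      then show "0 \<in> X" using Wsub(2) by (simp add: X_def lop.span_zero)
      fix x y assume xy: "x \<in> X" "y \<in> X"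
      have "\<gamma>vec (x + y) = \<gamma>vec x + \<gamma>vec y"
        using xy by (intro eq_vecI) (simp_all add: \<gamma>vec_def X_def \<gamma>_add)
      then show "x + y \<in> X" using xy Wsub(3) by (simp add: X_def lop.span_add)
    next
      fix c x assume x: "x \<in> X"
      have "\<gamma>vec (lscale c x) = c \<cdot>\<^sub>v \<gamma>vec x"
        using x by (intro eq_vecI) (simp_all add: \<gamma>vec_def X_def \<gamma>_scale)
      then show "lscale c x \<in> X" using x Wsub(4) by (simp add: X_def lop.span_scale)
    qed
    have XL: "L g * x \<in> X" if "g \<in> carrier G" "x \<in> X" for g x
      using that inv[OF that(1), of "\<gamma>vec x"] by (auto simp: X_def L_V \<rho>_\<gamma>vec)
    obtain w where w: "w \<in> W" "w \<noteq> 0\<^sub>v n" using ne Wsub(2) by blast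
    obtain x where x: "x \<in> V" "\<gamma>vec x = w" using \<gamma>vec_surj Wsub(1) w(1) by blast
    have "x \<noteq> 0" using x w \<gamma>_zero by (auto simp: \<gamma>vec_def zero_vec_def)
    have xX: "x \<in> X" using x w by (simp add: X_def)
    obtain g where g: "g \<in> carrier G" "e * L g * x \<noteq> 0" using V_nondegenerate[OF x(1) \<open>x \<noteq> 0\<close>] by blast
    obtain c where c: "e * (L g * x) * e = lscale c e"
      using e_CG_e CG_mult L_CG V_CG g x by blast
    have eq: "e * L g * x = lscale c e" using c V_e[OF x(1)] by (simp add: mult.assoc)
    then have "c \<noteq> 0" using g by auto
    have "e * (L g * x) = (\<Sum>h\<in>carrier G. lscale (coef h e) (L h * (L g * x)))"
      by (subst CG_expand[OF e_CG]) (simp add: sum_distrib_right)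
    also have "\<dots> \<in> X" by (intro lop.subspace_sum[OF X_sub] lop.subspace_scale[OF X_sub] XL g xX)
    finally have "lscale c e \<in> X" using eq by (simp add: mult.assoc)
    then have "lscale (inverse c) (lscale c e) \<in> X" by (rule lop.subspace_scale[OF X_sub])
    then have "e \<in> X" using \<open>c \<noteq> 0\<close> by simp
    then have "(\<lambda>h. L h * e) ` carrier G \<subseteq> X" using XL by blast
    then have "V \<subseteq> X" unfolding V_eq using lop.span_minimal[OF _ X_sub] by blast
    then have "carrier_vec n \<subseteq> W" using \<gamma>vec_surj by (force simp: X_def)
    then show ?thesis using Wsub(1) by blast
  qed
  ultimately show ?thesis
    using \<rho>_representation unfolding irreducible_representation_def by blast
qed

text \<open>Expanding \<open>b i = b i * e\<close> over the group gives a double sum over basis and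
  group. Summed over the basis first, it collects the coordinates of \<open>L g * L h * e\<close>
  into its coefficient at \<open>h\<close>.\<close>

lemma \<rho>_trace:
  assumes g: "g \<in> carrier G"
  shows "mat_trace (\<rho> g) = ideal_character e g"
proof -
  have expand: "\<gamma> i (L g * b i) = (\<Sum>h\<in>carrier G. coef h (b i) * \<gamma> i (L g * L h * e))" if i: "i < n" for i
  proof -
    have "b i = b i * e" using V_e[OF b_V[OF i]] by simp
    also have "\<dots> = (\<Sum>h\<in>carrier G. lscale (coef h (b i)) (L h * e))"
      by (subst CG_expand[OF V_CG[OF b_V[OF i]]]) (simp add: sum_distrib_right)
    finally have "L g * b i = L g * (\<Sum>h\<in>carrier G. lscale (coef h (b i)) (L h * e))"
      by (rule arg_cong)
    also have "\<dots> = (\<Sum>h\<in>carrier G. lscale (coef h (b i)) (L g * L h * e))"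
      by (simp add: sum_distrib_left mult.assoc)
    finally have "L g * b i = (\<Sum>h\<in>carrier G. lscale (coef h (b i)) (L g * L h * e))" .
    moreover have "L g * L h * e \<in> V" if "h \<in> carrier G" for h
      using L_V[OF g Le_V[OF that]] by (simp add: mult.assoc)
    ultimately show ?thesis by (simp add: \<gamma>_sum \<gamma>_scale lop.span_scale)
  qed
  have "mat_trace (\<rho> g) = (\<Sum>i<n. \<gamma> i (L g * b i))" by (simp add: mat_trace_def \<rho>_def)
  also have "\<dots> = (\<Sum>i<n. \<Sum>h\<in>carrier G. coef h (b i) * \<gamma> i (L g * L h * e))"
    by (rule sum.cong) (auto simp: expand)
  also have "\<dots> = (\<Sum>h\<in>carrier G. \<Sum>i<n. coef h (b i) * \<gamma> i (L g * L h * e))" by (rule sum.swap)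
  also have "\<dots> = (\<Sum>h\<in>carrier G. coef h (L g * L h * e))"
  proof (rule sum.cong[OF refl])
    fix h assume h: "h \<in> carrier G"
    have "L g * L h * e \<in> V" using L_V[OF g Le_V[OF h]] by (simp add: mult.assoc)
    from \<gamma>_expand[OF this, symmetric]
    have "coef h (L g * L h * e) = coef h (\<Sum>i<n. lscale (\<gamma> i (L g * L h * e)) (b i))" by simp
    then show "(\<Sum>i<n. coef h (b i) * \<gamma> i (L g * L h * e)) = coef h (L g * L h * e)"
      by (simp add: coef_sum coef_scale mult.commute)
  qed
  finally show ?thesis by (simp add: ideal_character_def)
qed

end

context finite_group
begin

theorem ideal_character_Irr:
  assumes e: "minimal_idempotent e"
  shows "(\<lambda>g\<in>carrier G. ideal_character e g) \<in> Irr G" "ideal_character e \<one> \<noteq> 0"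
proof -
  let ?S = "(\<lambda>h. L h * e) ` carrier G"
  obtain B where B: "B \<subseteq> ?S" "lop.independent B" "?S \<subseteq> lop.span B"
    using lop.maximal_independent_subset[of ?S] by blast
  have "finite B" using B(1) finite_G finite_subset by blast
  then obtain b where b: "bij_betw b {..<card B} B"
    using ex_bij_betw_nat_finite[of B] by (metis lessThan_atLeast0)
  interpret minimal_left_ideal G e "card B" b
    using e b B by unfold_locales (auto simp: bij_betw_def)
  have "(\<lambda>g\<in>carrier G. ideal_character e g) = afforded_character G \<rho>"
    unfolding afforded_character_def by (rule restrict_ext) (simp add: \<rho>_trace)
  then show "(\<lambda>g\<in>carrier G. ideal_character e g) \<in> Irr G"
    unfolding Irr_def using \<rho>_irreducible by blast
  have "ideal_character e \<one> = of_nat (card B)"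
    using \<rho>_trace[of \<one>] \<rho>_one by (simp add: mat_trace_def)
  moreover have "card B \<noteq> 0" using \<rho>_irreducible by (simp add: irreducible_representation_def)
  ultimately show "ideal_character e \<one> \<noteq> 0" by simp
qed

end

section \<open>Chief factors and characters\<close>

lemma Qp_add: "a \<in> Qp p \<Longrightarrow> b \<in> Qp p \<Longrightarrow> a + b \<in> Qp p"
  unfolding Qp_def using generate_field.eng_add[of a class_ring _ b] by simp

lemma Qp_mult: "a \<in> Qp p \<Longrightarrow> b \<in> Qp p \<Longrightarrow> a * b \<in> Qp p"
  unfolding Qp_def using generate_field.eng_mult[of a class_ring _ b] by simp

lemma Qp_minus: "a \<in> Qp p \<Longrightarrow> - a \<in> Qp p"
  unfolding Qp_def using generate_field.a_inv[of a class_ring] by (simp add: class_ring_simps)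

lemma m_inv_class_ring:
  assumes "(x :: complex) \<noteq> 0" shows "m_inv class_ring x = inverse x"
  unfolding m_inv_def
  by (rule the1_equality, rule ex1I[of _ "inverse x"])
     (use assms in \<open>auto simp: field_simps inverse_eq_divide\<close>)

lemma Qp_inverse: assumes "a \<in> Qp p" shows "inverse a \<in> Qp p"
proof (cases "a = 0")
  case True
  then show ?thesis using assms by simp
next
  case False
  then show ?thesis
    using assms generate_field.m_inv[of a class_ring] unfolding Qp_def by (simp add: m_inv_class_ring)
qed

lemma Qp_p_roots: assumes "p > 0" shows "p_roots p \<subseteq> Qp p"
proof
  fix z assume "z \<in> p_roots p"
  then obtain a where "z ^ (p ^ a) = 1" by (auto simp: p_roots_def)
  \<comment> \<open>\<open>Qp\<close> asks for a positive exponent, whereas \<open>p_roots\<close>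
    allows 0.\<close>
  then have "z ^ (p ^ Suc a) = 1" by (simp add: power_mult mult.commute)
       (metis mult.commute power_mult power_one)
  then have "z \<in> \<rat> \<union> {z. \<exists>a>0. z ^ (p ^ a) = 1}" by blast
  then show "z \<in> Qp p" unfolding Qp_def by (rule generate_field.incl)
qed

section \<open>The idempotent attached to a chief factor\<close>

context finite_group
begin

definition sumL :: "'a set \<Rightarrow> 'a lop" where "sumL H = (\<Sum>h\<in>H. L h)"

lemma subgroup_mem_carrier: "subgroup H G \<Longrightarrow> h \<in> H \<Longrightarrow> h \<in> carrier G" by (rule subgroup.mem_carrier)

lemma subgroup_finite: "subgroup H G \<Longrightarrow> finite H"
  using finite_subset[OF subgroup.subset finite_G] .

lemma L_sumL:
  assumes H: "subgroup H G" and h: "h \<in> H"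
  shows "L h * sumL H = sumL H" "sumL H * L h = sumL H"
proof -
  have "L h * sumL H = (\<Sum>x\<in>H. L (h \<otimes> x))"
    unfolding sumL_def sum_distrib_left using subgroup_mem_carrier[OF H] h by (intro sum.cong) (auto simp: L_mult)
  also have "\<dots> = sumL H" unfolding sumL_def
    by (rule sum.reindex_bij_witness[where i = "\<lambda>x. inv h \<otimes> x" and j = "\<lambda>x. h \<otimes> x"])
       (use subgroup_mem_carrier[OF H] h subgroup.m_closed[OF H] subgroup.m_inv_closed[OF H] in \<open>auto simp: inv_cancel\<close>)
  finally show "L h * sumL H = sumL H" .
  have "sumL H * L h = (\<Sum>x\<in>H. L (x \<otimes> h))"
    unfolding sumL_def sum_distrib_right using subgroup_mem_carrier[OF H] h by (intro sum.cong) (auto simp: L_mult)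
  also have "\<dots> = sumL H" unfolding sumL_def
    by (rule sum.reindex_bij_witness[where i = "\<lambda>x. x \<otimes> inv h" and j = "\<lambda>x. x \<otimes> h"])
       (use subgroup_mem_carrier[OF H] h subgroup.m_closed[OF H] subgroup.m_inv_closed[OF H] in \<open>auto simp: m_assoc\<close>)
  finally show "sumL H * L h = sumL H" .
qed

lemma sumL_sumL:
  assumes H: "subgroup H G" and M: "subgroup M G" and HM: "H \<subseteq> M"
  shows "sumL H * sumL M = lscale (of_nat (card H)) (sumL M)" "sumL M * sumL H = lscale (of_nat (card H)) (sumL M)"
proof -
  have "sumL H * sumL M = (\<Sum>h\<in>H. L h * sumL M)" by (simp add: sumL_def sum_distrib_right)
  also have "\<dots> = (\<Sum>h\<in>H. sumL M)" using L_sumL(1)[OF M] HM by (intro sum.cong) auto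
  finally show "sumL H * sumL M = lscale (of_nat (card H)) (sumL M)"
    by (simp add: lop.sum_constant_scale del: sum_constant)
  have "sumL M * sumL H = (\<Sum>h\<in>H. sumL M * L h)" by (simp add: sumL_def sum_distrib_left)
  also have "\<dots> = (\<Sum>h\<in>H. sumL M)" using L_sumL(2)[OF M] HM by (intro sum.cong) auto
  finally show "sumL M * sumL H = lscale (of_nat (card H)) (sumL M)"
    by (simp add: lop.sum_constant_scale del: sum_constant)
qed

lemma sumL_normal:
  assumes H: "normal_in H (carrier G)" and g: "g \<in> carrier G"
  shows "L g * sumL H = sumL H * L g"
proof -
  note d = normal_inD[OF H]
  have c: "x \<in> carrier G" if "x \<in> H" for x using subgroup_mem_carrier[OF d(1) that] .
  have "L g * sumL H = (\<Sum>x\<in>H. L (g \<otimes> x))"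
    unfolding sumL_def sum_distrib_left using c g by (intro sum.cong) (auto simp: L_mult)
  also have "\<dots> = (\<Sum>x\<in>H. L (x \<otimes> g))"
  proof (rule sum.reindex_bij_witness[where i = "\<lambda>x. inv g \<otimes> x \<otimes> g" and j = "\<lambda>x. g \<otimes> x \<otimes> inv g"])
    show "inv g \<otimes> x \<otimes> g \<in> H" if "x \<in> H" for x using d(4)[of "inv g" x] g that by simp
    show "g \<otimes> x \<otimes> inv g \<in> H" if "x \<in> H" for x using d(4)[of g x] g that by simp
  qed (use c g in \<open>auto simp: m_assoc inv_cancel\<close>)
  also have "\<dots> = sumL H * L g"
    unfolding sumL_def sum_distrib_right using c g by (intro sum.cong) (auto simp: L_mult)
  finally show ?thesis .
qed

lemma coef_sumL:
  assumes H: "subgroup H G" and g: "g \<in> carrier G"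
  shows "coef g (sumL H) = (if g \<in> H then 1 else 0)"
proof -
  have "coef g (sumL H) = (\<Sum>h\<in>H. if g = h then 1 else 0)"
    unfolding sumL_def coef_sum using subgroup_mem_carrier[OF H] g by (intro sum.cong) (auto simp: coef_L)
  then show ?thesis using subgroup_finite[OF H] by simp
qed

lemma sumL_CG: "subgroup H G \<Longrightarrow> sumL H \<in> CG"
  unfolding sumL_def by (intro lop.span_sum L_CG) (rule subgroup_mem_carrier)

lemma twisted_algebra_CG:
  assumes p: "Factorial_Ring.prime p"
  shows "twisted_algebra G lscale p (Qp p) (KG (Qp p)) (coef \<one>)"
proof unfold_locales
  have p0: "p > 0" using p prime_gt_0_nat by blast
  show "finite (carrier G)" by (rule finite_G)
  show "Factorial_Ring.prime p" by (rule p)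
  show roots: "p_roots p \<subseteq> Qp p" using Qp_p_roots[OF p0] .
  have one: "1 \<in> Qp p" using roots by auto
  have zero: "0 \<in> Qp p" using Qp_add[OF one Qp_minus[OF one]] by simp
  have sum: "sum F I \<in> Qp p" if "\<And>i. i \<in> I \<Longrightarrow> F i \<in> Qp p" for F and I :: "'a set"
    using that by (induction I rule: infinite_finite_induct) (auto intro: zero Qp_add)
  show "x * y \<in> KG (Qp p)" if "x \<in> KG (Qp p)" "y \<in> KG (Qp p)" for x y
    using that by (auto simp: KG_def CG_mult coef_mult intro!: sum Qp_mult)
  show "0 \<in> KG (Qp p)" by (simp add: KG_def lop.span_zero coef_zero zero)
qed (auto simp: Qp_add Qp_mult Qp_minus Qp_inverse KG_def lop.span_add lop.span_scale coef_add coef_scale)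

lemma KG_sumL:
  assumes "1 \<in> K" "0 \<in> K" "subgroup H G" shows "sumL H \<in> KG K"
  using assms by (simp add: KG_def sumL_CG coef_sumL)

text \<open>The corner of \<open>f\<close>, the average over \<open>N\<close>, carries the group
  algebra of G / N with trivial cocycle. The induction is entered after one Clifford step with a
  nontrivial character of M / N. That \<open>sumL M\<close> kills \<open>e\<close> records that
  \<open>M\<close> is not in the kernel.\<close>

theorem chief_factor_idempotent:
  assumes p: "Factorial_Ring.prime p"
    and step: "\<And>T N. normal_in N T \<Longrightarrow> N \<noteq> T \<Longrightarrow> \<exists>M. normal_in M T \<and> N \<subset> M \<and>
      (\<exists>r. card M = r * card N \<and> ((\<exists>k. r = p ^ k) \<or> coprime p r))"
    and M: "normal_in M (carrier G)" and N: "normal_in N (carrier G)" and NM: "N \<subset> M"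
    and card: "card M = p ^ k * card N"
    and min: "\<And>J. normal_in J (carrier G) \<Longrightarrow> N \<subset> J \<Longrightarrow> J \<subseteq> M \<Longrightarrow> J = M"
  shows "\<exists>e\<in>KG (Qp p). minimal_idempotent e \<and> (\<forall>n\<in>N. L n * e = e) \<and> sumL M * e = 0"
proof -
  interpret TA: twisted_algebra G lscale p "Qp p" "KG (Qp p)" "coef \<one>"
    by (rule twisted_algebra_CG[OF p])
  note dM = normal_inD[OF M] and dN = normal_inD[OF N]
  have cN: "card N \<noteq> 0" using subgroup_finite[OF dN(1)] subgroup.one_closed[OF dN(1)] by auto
  have cM: "card M \<noteq> 0" using subgroup_finite[OF dM(1)] subgroup.one_closed[OF dM(1)] by auto
  have NsM: "N \<subseteq> M" using NM by blast
  define f where "f = lscale (inverse (of_nat (card N))) (sumL N)"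
  have ff: "f * f = f" using sumL_sumL(1)[OF dN(1) dN(1) subset_refl] cN by (simp add: f_def)
  have fAK: "f \<in> KG (Qp p)" unfolding f_def
    by (intro TA.AK_scale TA.K_inverse TA.K_of_nat KG_sumL TA.K_one TA.K_zero dN(1))
  have fM: "f * sumL M = sumL M" "sumL M * f = sumL M"
    using sumL_sumL[OF dN(1) dM(1) NsM] cN by (simp_all add: f_def)
  have fL: "f * L g = L g * f" if "g \<in> carrier G" for g
    using sumL_normal[OF N that] by (simp add: f_def)
  have LN: "L n * f = f" if "n \<in> N" for n using L_sumL(1)[OF dN(1) that] by (simp add: f_def)
  define u where "u g = L g * f" for g
  have fu: "f * u g = u g" if "g \<in> carrier G" for g
    using fL[OF that] ff by (simp add: u_def mult.assoc[symmetric]) (simp add: mult.assoc)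
  have uf: "u g * f = u g" for g using ff by (simp add: u_def mult.assoc)
  have uu: "u s * u t = u (s \<otimes> t)" if "s \<in> carrier G" "t \<in> carrier G" for s t
  proof -
    have "u s * u t = L s * (f * L t) * f" by (simp add: u_def mult.assoc)
    also have "\<dots> = L s * L t * (f * f)" using fL[OF that(2)] by (simp add: mult.assoc)
    finally show ?thesis using ff L_mult[OF that] by (simp add: u_def)
  qed
  have u_N: "u n = f" if "n \<in> N" for n using LN[OF that] by (simp add: u_def)
  have coef_f: "coef g f = (if g \<in> N then inverse (of_nat (card N)) else 0)" if "g \<in> carrier G" for g
    using coef_sumL[OF dN(1) that] by (simp add: f_def coef_scale)
  have LKG: "L g \<in> KG (Qp p)" if "g \<in> carrier G" for g
    using that TA.K_one TA.K_zero by (simp add: KG_def L_CG coef_L)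
  have rep: "twisted_rep G lscale p (Qp p) (KG (Qp p)) (coef \<one>) (carrier G) N f u"
  proof unfold_locales
    show "normal_in N (carrier G)" by (rule N)
    show "f * f = f" "f \<in> KG (Qp p)" by fact+
    show "coef \<one> f \<noteq> 0" using coef_f[of \<one>] subgroup.one_closed[OF dN(1)] cN by simp
    fix t assume t: "t \<in> carrier G"
    show "u t \<in> KG (Qp p)" unfolding u_def by (intro TA.AK_mult LKG t fAK)
    show "f * u t = u t" "u t * f = u t" using fu[OF t] uf by auto
    show "\<exists>z\<in>p_roots p. u s * u t = lscale z (u (s \<otimes> t))" if "s \<in> carrier G" for s
      using uu[OF that t] by (intro bexI[of _ 1]) auto
    show "coef \<one> (u t) = 0" if "t \<notin> N"
    proof -
      have "inv t \<notin> N" using that subgroup.m_inv_closed[OF dN(1), of "inv t"] t by auto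
      then show ?thesis using coef_L_mult[OF t one_closed, of f] coef_f[of "inv t"] t by (simp add: u_def)
    qed
  next
    show "\<exists>z\<in>p_roots p. u n = lscale z f" if "n \<in> N" for n
      using u_N[OF that] by (intro bexI[of _ 1]) auto
  qed
  interpret R: twisted_rep G lscale p "Qp p" "KG (Qp p)" "coef \<one>" "carrier G" N f u by (rule rep)
  have Mc: "m \<in> carrier G" if "m \<in> M" for m using subgroup_mem_carrier[OF dM(1) that] .
  have comm: "u m * u h = u h * u m" if mh: "m \<in> M" "h \<in> M" for m h
  proof -
    define n where "n = m \<otimes> h \<otimes> inv m \<otimes> inv h"
    have n: "n \<in> N" unfolding n_def
      by (rule minimal_p_section_abelian[OF finite_G p N M NM card min mh])
    have eq: "m \<otimes> h = n \<otimes> (h \<otimes> m)" using Mc mh by (simp add: n_def m_assoc inv_cancel)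
    have "u (m \<otimes> h) = u n * u (h \<otimes> m)" unfolding eq using uu[of n "h \<otimes> m"] Mc mh n subgroup_mem_carrier[OF dN(1)] by simp
    also have "\<dots> = u (h \<otimes> m)" using u_N[OF n] fu[of "h \<otimes> m"] Mc mh by simp
    finally show ?thesis using uu Mc mh by simp
  qed
  have su: "sumL M * u m = sumL M" if "m \<in> M" for m
    using L_sumL(2)[OF dM(1) that] fM by (simp add: u_def mult.assoc[symmetric])
  \<comment> \<open>On this subspace the sum over \<open>M\<close> acts as 0, so that an eigenvector
    found in it cannot belong to the trivial character.\<close>
  define W where "W = {x. f * x = x \<and> sumL M * x = 0}"
  have W1: "lop.subspace W" unfolding W_def lop.subspace_def by (auto simp: distrib_left)
  have W2: "u m * x \<in> W" if "m \<in> M" "x \<in> W" for m x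
    using that fu[OF Mc] su by (simp add: W_def mult.assoc[symmetric])
  have W3: "f * x = x" if "x \<in> W" for x using that by (simp add: W_def)
  \<comment> \<open>The difference of the averages over \<open>N\<close> and over \<open>M\<close>;
    it is not 0 because the two averages have different coefficients at
    \<open>\<one>\<close>.\<close>
  define x0 where "x0 = f - lscale (inverse (of_nat (card M))) (sumL M)"
  have "x0 \<in> W"
    using ff fM sumL_sumL(1)[OF dM(1) dM(1) subset_refl] cM
    by (simp add: W_def x0_def right_diff_distrib)
  moreover have "x0 \<noteq> 0"
  proof
    assume "x0 = 0"
    then have "f = lscale (inverse (of_nat (card M))) (sumL M)" by (simp add: x0_def)
    then have "coef \<one> f = coef \<one> (lscale (inverse (of_nat (card M))) (sumL M))" by simp
    then have "inverse (of_nat (card N)) = (inverse (of_nat (card M)) :: complex)"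
      using coef_f[of \<one>] coef_sumL[OF dM(1), of \<one>] subgroup.one_closed[OF dN(1)] subgroup.one_closed[OF dM(1)]
      by (simp add: coef_scale)
    then have "card N = card M" by simp
    then show False using psubset_card_mono[OF subgroup_finite[OF dM(1)] NM] by simp
  qed
  ultimately obtain l x where lx: "x \<in> W" "x \<noteq> 0"
    "twisted_rep_char G lscale p (Qp p) (KG (Qp p)) (coef \<one>) (carrier G) N f u M l"
    "\<forall>m\<in>M. lscale (l m) (u m) * x = x"
    using R.commuting_character[OF M NsM card comm W1 W2 W3] by blast
  interpret C: twisted_rep_char G lscale p "Qp p" "KG (Qp p)" "coef \<one>" "carrier G" N f u M l
    by (rule lx(3))
  \<comment> \<open>If all \<open>l m\<close> were 1, the sum over \<open>M\<close> would multiply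
    \<open>x\<close> by \<open>card M\<close> instead of killing it.\<close>
  obtain m0 where m0: "m0 \<in> M" "l m0 \<noteq> 1"
  proof (rule ccontr)
    assume a: "\<not> thesis"
    have l1: "l m = 1" if "m \<in> M" for m using a that \<open>\<And>m0. m0 \<in> M \<Longrightarrow> l m0 \<noteq> 1 \<Longrightarrow> thesis\<close> by blast
    have "0 = sumL M * x" using lx(1) by (simp add: W_def)
    also have "\<dots> = (sumL M * f) * x" using fM by simp
    also have "\<dots> = (\<Sum>m\<in>M. u m * x)" by (simp add: sumL_def u_def sum_distrib_right)
    also have "\<dots> = (\<Sum>m\<in>M. x)" using lx(4) l1 by (intro sum.cong) auto
    also have "\<dots> = lscale (of_nat (card M)) x" by (simp add: lop.sum_constant_scale del: sum_constant)
    finally show False using cM lx(2) by simp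
  qed
  have sCe: "sumL M * C.e = 0"
  proof -
    have "sumL M * C.e = sumL M * (C.v m0 * C.e)" using C.ve[OF m0(1)] by simp
    also have "\<dots> = lscale (l m0) ((sumL M * u m0) * C.e)" by (simp add: C.v_def mult.assoc)
    also have "\<dots> = lscale (l m0) (sumL M * C.e)" using su[OF m0(1)] by simp
    finally have "lscale (1 - l m0) (sumL M * C.e) = 0" by (simp add: lop.scale_left_diff_distrib)
    then show ?thesis using m0(2) by simp
  qed
  obtain e where "twisted_rep.primitive_idempotent lscale (KG (Qp p)) C.S C.e (\<lambda>t. u t * C.e) e"
    using TA.primitive_idempotent_exists[OF step C.stabilizer_rep] by blast
  then have ge: "R.primitive_idempotent e" "C.e * e = e" using C.primitive_idempotent_lift by auto
  then have e: "e \<in> KG (Qp p)" "e \<noteq> 0" "e * e = e" "f * e = e" "\<And>t. t \<in> carrier G \<Longrightarrow> \<exists>c. e * u t * e = lscale c e"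
    by (auto simp: R.primitive_idempotent_def)
  have ue: "u t * e = L t * e" for t using e(4) by (simp add: u_def mult.assoc)
  have "minimal_idempotent e"
    unfolding minimal_idempotent_def using e by (auto simp: KG_def mult.assoc ue)
  moreover have "L n * e = e" if "n \<in> N" for n using LN[OF that] e(4) by (metis mult.assoc)
  moreover have "sumL M * e = 0" using sCe ge(2) by (metis mult.assoc mult_zero_left)
  ultimately show ?thesis using e(1) by blast
qed

lemma ideal_character_in:
  assumes e: "e \<in> KG K" and g: "g \<in> carrier G"
    and K: "0 \<in> K" "\<And>a b. a \<in> K \<Longrightarrow> b \<in> K \<Longrightarrow> a + b \<in> K"
  shows "ideal_character e g \<in> K"
proof -
  have summand: "coef h (L g * L h * e) \<in> K" if h: "h \<in> carrier G" for h
  proof -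
    have "coef h (L g * L h * e) = coef (inv (g \<otimes> h) \<otimes> h) e"
      using g h by (simp add: L_mult coef_L_mult)
    then show ?thesis using e g h by (simp add: KG_def)
  qed
  have sum_K: "sum F I \<in> K" if "\<And>i. i \<in> I \<Longrightarrow> F i \<in> K" for F and I :: "'a set"
    using that by (induction I rule: infinite_finite_induct) (simp_all add: K)
  show ?thesis unfolding ideal_character_def by (rule sum_K) (rule summand)
qed

lemma ideal_character_trivial_on:
  assumes N: "normal_in N (carrier G)" and e: "e \<in> CG" "\<And>n. n \<in> N \<Longrightarrow> L n * e = e" and n: "n \<in> N"
  shows "ideal_character e n = ideal_character e \<one>"
proof -
  have nc: "n \<in> carrier G" using subgroup_mem_carrier[OF normal_inD(1)[OF N] n] .
  have "L n * L h * e = L \<one> * L h * e" if h: "h \<in> carrier G" for h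
  proof -
    define n' where "n' = inv h \<otimes> n \<otimes> h"
    have n': "n' \<in> N" using normal_inD(4)[OF N, of "inv h" n] h n by (simp add: n'_def)
    have "n \<otimes> h = h \<otimes> n'" using h nc by (simp add: n'_def m_assoc inv_cancel)
    then have "L n * L h * e = L h * (L n' * e)"
      using h nc subgroup_mem_carrier[OF normal_inD(1)[OF N] n'] by (simp add: L_mult mult.assoc[symmetric])
    then show ?thesis using e(2)[OF n'] h by (simp add: L_mult)
  qed
  then show ?thesis by (simp add: ideal_character_def)
qed

lemma ideal_character_sum_zero:
  assumes M: "normal_in M (carrier G)" and e: "sumL M * e = 0"
  shows "(\<Sum>m\<in>M. ideal_character e m) = 0"
proof -
  have "(\<Sum>m\<in>M. ideal_character e m) = (\<Sum>h\<in>carrier G. coef h (sumL M * L h * e))"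
    unfolding ideal_character_def sumL_def
    by (subst sum.swap) (simp add: sum_distrib_right coef_sum)
  also have "\<dots> = 0"
  proof (rule sum.neutral, rule ballI)
    fix h assume h: "h \<in> carrier G"
    have "sumL M * L h * e = L h * (sumL M * e)" using sumL_normal[OF M h] by (metis mult.assoc)
    then show "coef h (sumL M * L h * e) = 0" using e by (simp add: coef_zero)
  qed
  finally show ?thesis .
qed

end

section \<open>Minimal sections of solvable groups\<close>

context group begin

lemma conj_pow:
  assumes "g \<in> carrier G" "x \<in> carrier G"
  shows "(g \<otimes> x \<otimes> inv g) [^] (n::nat) = g \<otimes> x [^] n \<otimes> inv g"
proof (induction n)
  case 0
  then show ?case using assms by simp
next
  case (Suc n)
  then show ?case using conj_mult[of g "x [^] n" x] assms by simp
qed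

text \<open>The section is abelian by solvability and minimality. For a prime q dividing its order,
  the elements whose q-th power lies in \<open>N\<close> form a subgroup normal in \<open>T\<close>;
  it exceeds \<open>N\<close> by Cauchy's theorem and so equals \<open>M\<close>.\<close>

lemma solvable_minimal_section:
  assumes fin: "finite (carrier G)" and sol: "solvable G"
    and M: "normal_in M T" and N: "normal_in N T" and NM: "N \<subset> M"
    and min: "\<And>J. normal_in J T \<Longrightarrow> N \<subset> J \<Longrightarrow> J \<subseteq> M \<Longrightarrow> J = M"
  shows "\<exists>q k. Factorial_Ring.prime q \<and> card M = q ^ k * card N"
proof -
  note dM = normal_inD[OF M] and dN = normal_inD[OF N]
  obtain J where J: "normal_in J T" "N \<subset> J" "J \<subseteq> M" "\<forall>x\<in>J. \<forall>y\<in>J. x \<otimes> y \<otimes> inv x \<otimes> inv y \<in> N"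
    using solvable_abelian_section[OF sol M N NM] by blast
  have ab: "x \<otimes> y \<otimes> inv x \<otimes> inv y \<in> N" if "x \<in> M" "y \<in> M" for x y
    using J min[OF J(1,2,3)] that by blast
  have nNM: "normal_in N M" using normal_in_mono[OF N dM(1) _ dM(3)] NM by blast
  have finM: "finite M" using finite_subset[OF subgroup.subset[OF dM(1)] fin] .
  have Mc: "x \<in> carrier G" if "x \<in> M" for x using subgroup.mem_carrier[OF dM(1) that] .
  obtain r where r: "card M = r * card N"
    using normal_in_card_dvd[OF nNM finM] by (metis dvdE mult.commute)
  have "r \<noteq> 1" using r psubset_card_mono[OF finM NM] by auto
  then obtain q where q: "Factorial_Ring.prime q" "q dvd r" using prime_factor_nat by blast
  define P where "P = {x\<in>M. x [^] q \<in> N}"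
  interpret M': group "G\<lparr>carrier := M\<rparr>" by (rule subgroup_imp_group[OF dM(1)])
  interpret N': normal N "G\<lparr>carrier := M\<rparr>" using nNM normal_in_iff_normal by blast
  let ?Q = "G\<lparr>carrier := M\<rparr> Mod N"
  interpret Q: group ?Q by (rule N'.factorgroup_is_group)
  have mult: "(N #> x) \<otimes>\<^bsub>?Q\<^esub> (N #> y) = N #> (x \<otimes> y)" if "x \<in> M" "y \<in> M" for x y
    using N'.rcos_sum[of x y] that by (simp add: FactGroup_def r_coset_in_sub set_mult_def)
  have inQ: "N #> x \<in> carrier ?Q" if "x \<in> M" for x
    using that by (auto simp: FactGroup_def RCOSETS_def r_coset_def)
  have sP: "subgroup P G"
  proof (rule subgroupI)
    show "P \<subseteq> carrier G" using Mc by (auto simp: P_def)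
    have "\<one> \<in> P" using subgroup.one_closed[OF dM(1)] subgroup.one_closed[OF dN(1)] by (simp add: P_def)
    then show "P \<noteq> {}" by blast
    show "inv x \<in> P" if "x \<in> P" for x
      using that Mc subgroup.m_inv_closed[OF dM(1)] subgroup.m_inv_closed[OF dN(1)]
      by (simp add: P_def nat_pow_inv)
    show "x \<otimes> y \<in> P" if "x \<in> P" "y \<in> P" for x y
    proof -
      have xy: "x \<in> M" "y \<in> M" "x [^] q \<in> N" "y [^] q \<in> N" using that by (auto simp: P_def)
      have c: "x \<in> carrier G" "y \<in> carrier G" using xy Mc by auto
      have M1: "x \<otimes> y \<in> M" "y \<otimes> x \<in> M" using xy subgroup.m_closed[OF dM(1)] by auto
      have "(x \<otimes> y) \<otimes> inv (y \<otimes> x) \<in> N" using ab[OF xy(1,2)] c by (simp add: inv_mult_group m_assoc)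
      then have "N #> (x \<otimes> y) = N #> (y \<otimes> x)"
        using coset_mult_inv1[OF coset_join2[OF _ dN(1)]] c subgroup.subset[OF dN(1)] by simp
      then have com: "(N #> x) \<otimes>\<^bsub>?Q\<^esub> (N #> y) = (N #> y) \<otimes>\<^bsub>?Q\<^esub> (N #> x)"
        using mult xy by simp
      have "N #> ((x \<otimes> y) [^] q) = (N #> (x \<otimes> y)) [^]\<^bsub>?Q\<^esub> q"
        using normal_in_quot_pow[OF nNM M1(1)] by simp
      also have "\<dots> = (N #> x) [^]\<^bsub>?Q\<^esub> q \<otimes>\<^bsub>?Q\<^esub> (N #> y) [^]\<^bsub>?Q\<^esub> q"
        using Q.pow_mult_distrib[OF com inQ[OF xy(1)] inQ[OF xy(2)], of q] mult[OF xy(1,2)] by simp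
      also have "\<dots> = (N #> (x [^] q)) \<otimes>\<^bsub>?Q\<^esub> (N #> (y [^] q))"
        using normal_in_quot_pow[OF nNM xy(1)] normal_in_quot_pow[OF nNM xy(2)] by simp
      also have "N #> (x [^] q) = N" using coset_eq_self_iff[OF dN(1)] xy c by simp
      also have "N #> (y [^] q) = N" using coset_eq_self_iff[OF dN(1)] xy c by simp
      also have "N \<otimes>\<^bsub>?Q\<^esub> N = N" using Q.l_one[OF Q.one_closed] by (simp add: FactGroup_def)
      finally have "(x \<otimes> y) [^] q \<in> N" using coset_eq_self_iff[OF dN(1)] c by simp
      then show ?thesis using M1 by (simp add: P_def)
    qed
  qed
  have "normal_in P T"
  proof -
    have "t \<otimes> x \<otimes> inv t \<in> P" if t: "t \<in> T" and x: "x \<in> P" for t x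
    proof -
      have c: "t \<in> carrier G" "x \<in> carrier G" "x \<in> M" "x [^] q \<in> N"
        using subgroup.mem_carrier[OF dM(2) t] x Mc by (auto simp: P_def)
      then show ?thesis using conj_pow[OF c(1,2), of q] dM(4)[OF t c(3)] dN(4)[OF t c(4)]
        by (simp add: P_def)
    qed
    moreover have "P \<subseteq> T" using dM(3) by (auto simp: P_def)
    ultimately show ?thesis using sP dM(2) by (simp add: normal_in_def)
  qed
  moreover have "N \<subset> P"
  proof -
    have "q * card N dvd card M" using r q by (simp add: mult_dvd_mono)
    then obtain x where "x \<in> M" "x \<notin> N" "x [^] q \<in> N" using normal_in_cauchy[OF nNM finM q(1)] by blast
    moreover have "n [^] q \<in> N" if "n \<in> N" for n
      using subgroup_int_pow_closed[OF dN(1) that, of "int q"] by (simp add: int_pow_int)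
    ultimately show ?thesis using NM by (auto simp: P_def)
  qed
  ultimately have "P = M" using min by (auto simp: P_def)
  then have "\<exists>k. x [^] (q ^ k :: nat) \<in> N" if "x \<in> M" for x
    using that by (intro exI[of _ 1]) (auto simp: P_def)
  then show ?thesis using card_p_power_index[OF nNM finM q(1)] q(1) by blast
qed

text \<open>A smallest subgroup normal in \<open>T\<close> above \<open>N\<close> has prime power
  index, and a power of a prime q is either a power of p or prime to p.\<close>

lemma solvable_step:
  assumes fin: "finite (carrier G)" and p: "Factorial_Ring.prime p" and sol: "solvable G"
    and nm: "normal_in N T" and ne: "N \<noteq> T"
  shows "\<exists>M. normal_in M T \<and> N \<subset> M \<and> (\<exists>r. card M = r * card N \<and> ((\<exists>k. r = p ^ k) \<or> coprime p r))"
proof -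
  note d = normal_inD[OF nm]
  have "normal_in T T"
    using d subgroup.m_closed[OF d(2)] subgroup.m_inv_closed[OF d(2)] by (auto simp: normal_in_def)
  then have "normal_in T T \<and> N \<subset> T" using d ne by blast
  from ex_has_least_nat[of "\<lambda>M. normal_in M T \<and> N \<subset> M", OF this, of card]
  obtain M where M: "normal_in M T" "N \<subset> M" "\<And>J. normal_in J T \<Longrightarrow> N \<subset> J \<Longrightarrow> card M \<le> card J"
    by blast
  have finM: "finite M" using finite_subset[OF subgroup.subset[OF normal_inD(1)[OF M(1)]] fin] .
  obtain q k where q: "Factorial_Ring.prime q" "card M = q ^ k * card N"
    using solvable_minimal_section[OF fin sol M(1) nm M(2)] card_seteq[OF finM] M(3) by blast
  have "(\<exists>j. q ^ k = p ^ j) \<or> coprime p (q ^ k)"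
    using p q(1) by (cases "q = p") (auto simp: primes_coprime)
  then show ?thesis using M q by blast
qed

end

section \<open>Finiteness of the set of irreducible characters\<close>

lemma mat_trace_comm:
  assumes "A \<in> carrier_mat n n" "B \<in> carrier_mat n n"
  shows "mat_trace (A * B) = mat_trace (B * A)"
proof -
  have "mat_trace (A * B) = (\<Sum>i<n. \<Sum>j<n. A $$ (i, j) * B $$ (j, i))"
    using assms by (simp add: mat_trace_def scalar_prod_def lessThan_atLeast0)
  also have "\<dots> = (\<Sum>j<n. \<Sum>i<n. A $$ (i, j) * B $$ (j, i))" by (rule sum.swap)
  also have "\<dots> = mat_trace (B * A)"
    using assms by (simp add: mat_trace_def scalar_prod_def lessThan_atLeast0 mult.commute)
  finally show ?thesis .
qed

text \<open>A triangular form preserves the trace and has the eigenvalues on its diagonal;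
  evaluating the m-th power on an eigenvector shows that each is an m-th root of unity.\<close>

lemma mat_trace_finite_order:
  assumes A: "A \<in> carrier_mat n n" and m: "A ^\<^sub>m m = 1\<^sub>m n"
  shows "\<exists>es. length es = n \<and> (\<forall>x\<in>set es. x ^ m = 1) \<and> mat_trace A = sum_list es"
proof -
  obtain es where es: "char_poly A = (\<Prod>a\<leftarrow>es. [:- a, 1:])" "length es = n"
    using char_poly_factorized[OF A] by blast
  obtain B P Q where BPQ: "schur_decomposition A es = (B, P, Q)" by (metis prod_cases3)
  have sim: "similar_mat_wit A B P Q" "diag_mat B = es"
    using schur_decomposition[OF A es(1) BPQ] by auto
  note w = similar_mat_witD2[OF A sim(1)]
  have "mat_trace A = mat_trace (P * (B * Q))" using w by (simp add: assoc_mult_mat[of P n n B n Q n])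
  also have "\<dots> = mat_trace (B * Q * P)" using w by (intro mat_trace_comm) auto
  also have "B * Q * P = B" using w by (simp add: assoc_mult_mat[of B n n Q n P n])
  also have "mat_trace B = sum_list (diag_mat B)"
    using w(5) by (simp add: mat_trace_def diag_mat_def sum_list_sum_nth lessThan_atLeast0)
  finally have tr: "mat_trace A = sum_list es" using sim by simp
  have "x ^ m = 1" if x: "x \<in> set es" for x
  proof -
    have "poly (char_poly A) x = 0" unfolding es(1) using x by (induction es) auto
    then obtain v where v: "eigenvector A v x"
      using eigenvalue_root_char_poly[OF A] by (auto simp: eigenvalue_def)
    then have vc: "v \<in> carrier_vec n" "v \<noteq> 0\<^sub>v n" using A by (auto simp: eigenvector_def)
    have "x ^ m \<cdot>\<^sub>v v = v" using eigenvector_pow[OF A v, of m] m vc by simp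
    obtain i where i: "i < n" "v $ i \<noteq> 0" using vc by (metis eq_vecI carrier_vecD index_zero_vec)
    have "x ^ m * v $ i = v $ i"
      using arg_cong[OF \<open>x ^ m \<cdot>\<^sub>v v = v\<close>, of "\<lambda>w. w $ i"] i vc by simp
    then show ?thesis using i by simp
  qed
  then show ?thesis using es tr by blast
qed

context finite_group
begin

lemma representationD:
  assumes "representation G n \<rho>"
  shows "g \<in> carrier G \<Longrightarrow> \<rho> g \<in> carrier_mat n n"
    "g \<in> carrier G \<Longrightarrow> h \<in> carrier G \<Longrightarrow> \<rho> (g \<otimes> h) = \<rho> g * \<rho> h" "\<rho> \<one> = 1\<^sub>m n"
proof -
  have h: "\<rho> \<in> hom G (GL n)" using assms by (simp add: representation_def)
  have U: "\<rho> g \<in> Units (ring_mat TYPE(complex) n ())" if "g \<in> carrier G" for g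
    using hom_carrier[OF h] that by (auto simp: GL_def units_of_def)
  show c: "\<rho> g \<in> carrier_mat n n" if "g \<in> carrier G" for g
    using U[OF that] by (auto simp: Units_def ring_mat_simps)
  show m: "\<rho> (g \<otimes> h) = \<rho> g * \<rho> h" if "g \<in> carrier G" "h \<in> carrier G" for g h
    using hom_mult[OF h that] by (simp add: GL_def units_of_def ring_mat_simps)
  obtain X where X: "X \<in> carrier_mat n n" "X * \<rho> \<one> = 1\<^sub>m n"
    using U[OF one_closed] by (auto simp: Units_def ring_mat_simps)
  have "\<rho> \<one> = \<rho> \<one> * \<rho> \<one>" using m[of \<one> \<one>] by simp
  then have "X * \<rho> \<one> = X * \<rho> \<one> * \<rho> \<one>"
    using X c[OF one_closed] by (metis assoc_mult_mat one_closed)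
  then show "\<rho> \<one> = 1\<^sub>m n" using X c[OF one_closed] by simp
qed

lemma representation_pow:
  assumes "representation G n \<rho>" "g \<in> carrier G"
  shows "\<rho> (g [^] (k::nat)) = \<rho> g ^\<^sub>m k"
  by (induction k) (use representationD[OF assms(1)] assms(2) in auto)

text \<open>The orbit of a nonzero vector spans an invariant subspace, hence everything, and it has
  at most as many elements as the group.\<close>

lemma irreducible_dim_le:
  assumes irr: "irreducible_representation G n \<rho>"
  shows "n \<le> card (carrier G)"
proof -
  have rep: "representation G n \<rho>" and n0: "0 < n"
    and W: "\<And>W. invariant_subspace G n \<rho> W \<Longrightarrow> W = {0\<^sub>v n} \<or> W = carrier_vec n"
    using irr by (auto simp: irreducible_representation_def)
  note R = representationD[OF rep]
  interpret vec_space "TYPE(complex)" n .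
  define v :: "complex vec" where "v = unit_vec n 0"
  have v: "v \<in> carrier_vec n" "v \<noteq> 0\<^sub>v n" using n0 by (auto simp: v_def)
  define S where "S = (\<lambda>g. \<rho> g *\<^sub>v v) ` carrier G"
  have Sc: "S \<subseteq> carrier_vec n" using mult_mat_vec_carrier[OF R(1) v(1)] by (auto simp: S_def)
  have sub: "VectorSpace.subspace class_ring (span S) V" by (rule span_is_subspace) (use Sc in simp)
  note Wsub = module_vec_subspaceD[OF sub]
  have "\<rho> h *\<^sub>v w \<in> span S" if h: "h \<in> carrier G" and w: "w \<in> span S" for h w
  proof -
    define X where "X = {x\<in>carrier_vec n. \<rho> h *\<^sub>v x \<in> span S}"
    have "submodule class_ring X V"
    proof (unfold_locales)
      show "X \<subseteq> carrier V" by (auto simp: X_def)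
      show "x \<oplus>\<^bsub>V\<^esub> y \<in> X" if "x \<in> X" "y \<in> X" for x y
        using that Wsub(3) R(1)[OF h] by (auto simp: X_def mult_add_distrib_mat_vec module_vec_simps)
      have "\<rho> h *\<^sub>v 0\<^sub>v n = 0\<^sub>v n" using R(1)[OF h] by auto
      then show "\<zero>\<^bsub>V\<^esub> \<in> X" using Wsub(2) by (auto simp: X_def module_vec_simps)
      show "c \<odot>\<^bsub>V\<^esub> x \<in> X" if "c \<in> carrier class_ring" "x \<in> X" for c x
        using that Wsub(4) R(1)[OF h] by (auto simp: X_def mult_mat_vec module_vec_simps)
    qed
    moreover have "S \<subseteq> X"
    proof
      fix x assume "x \<in> S"
      then obtain g where g: "g \<in> carrier G" "x = \<rho> g *\<^sub>v v" by (auto simp: S_def)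
      have "\<rho> h *\<^sub>v x = \<rho> (h \<otimes> g) *\<^sub>v v" using g h R v by (simp add: assoc_mult_mat_vec[of _ n n _ n])
      then have "\<rho> h *\<^sub>v x \<in> S" using g h by (auto simp: S_def)
      then show "x \<in> X" using in_own_span[of S] Sc g mult_mat_vec_carrier[OF R(1) v(1)] by (auto simp: X_def)
    qed
    ultimately have "span S \<subseteq> X" using span_is_subset by blast
    then show ?thesis using w by (auto simp: X_def)
  qed
  then have "invariant_subspace G n \<rho> (span S)" using sub by (simp add: invariant_subspace_def)
  moreover have "v \<in> span S"
  proof -
    have "v = \<rho> \<one> *\<^sub>v v" using R(3) v by simp
    then have "v \<in> S" unfolding S_def by (metis imageI one_closed)
    then show ?thesis using in_own_span[of S] Sc by auto
  qed
  ultimately have "span S = carrier_vec n" using W v by blast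
  moreover have "finite S" using finite_G by (simp add: S_def)
  ultimately have "dim \<le> card S" using gen_ge_dim[of S] Sc by simp
  also have "\<dots> \<le> card (carrier G)" unfolding S_def by (rule card_image_le[OF finite_G])
  finally show ?thesis by (simp add: dim_is_n)
qed

text \<open>An infinite set has \<open>card\<close> 0, so the lower bound on the number of
  characters needs finiteness. All values are sums of boundedly many roots of unity of fixed
  order.\<close>

lemma finite_Irr: "finite (Irr G)"
proof -
  define m where "m = card (carrier G)"
  have m0: "m > 0" using finite_G one_closed by (auto simp: m_def card_gt_0_iff)
  define F where "F = sum_list ` {es. set es \<subseteq> {x::complex. x ^ m = 1} \<and> length es \<le> m}"
  have "finite F"
    unfolding F_def using finite_lists_length_le[OF finite_roots_unity[of m]] m0 by auto
  moreover have "Irr G \<subseteq> carrier G \<rightarrow>\<^sub>E F"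
  proof
    fix \<chi> assume "\<chi> \<in> Irr G"
    then obtain \<rho> n where \<rho>: "irreducible_representation G n \<rho>" "\<chi> = afforded_character G \<rho>"
      by (auto simp: Irr_def)
    have rep: "representation G n \<rho>" using \<rho> by (simp add: irreducible_representation_def)
    have "mat_trace (\<rho> g) \<in> F" if g: "g \<in> carrier G" for g
    proof -
      have "\<rho> g ^\<^sub>m m = 1\<^sub>m n"
        using representation_pow[OF rep g, of m] pow_order_eq_1[OF g] representationD(3)[OF rep]
        by (simp add: m_def Coset.order_def)
      then obtain es where "length es = n" "\<forall>x\<in>set es. x ^ m = 1" "mat_trace (\<rho> g) = sum_list es"
        using mat_trace_finite_order[OF representationD(1)[OF rep g]] by blast
      then show ?thesis using irreducible_dim_le[OF \<rho>(1)] unfolding F_def m_def by blast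
    qed
    then show "\<chi> \<in> carrier G \<rightarrow>\<^sub>E F" by (auto simp: \<rho>(2) afforded_character_def)
  qed
  ultimately show ?thesis using finite_PiE[OF finite_G] finite_subset by metis
qed

text \<open>The values of the i-th character on \<open>M i\<close> add up to 0. A later character is
  constant there, since \<open>M i\<close> lies in its kernel, with a nonzero value. The same sum
  excludes the principal character.\<close>

lemma distinct_characters:
  assumes M: "\<And>i. i \<in> I \<Longrightarrow> normal_in (M i) (carrier G)" and N: "\<And>i. i \<in> I \<Longrightarrow> normal_in (N i) (carrier G)"
    and e: "\<And>i. i \<in> I \<Longrightarrow> minimal_idempotent (e i)"
    and eN: "\<And>i n. i \<in> I \<Longrightarrow> n \<in> N i \<Longrightarrow> L n * e i = e i" and eM: "\<And>i. i \<in> I \<Longrightarrow> sumL (M i) * e i = 0"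
    and MN: "\<And>i j. i \<in> I \<Longrightarrow> j \<in> I \<Longrightarrow> i < j \<Longrightarrow> M i \<subseteq> N j"
  defines "\<chi> \<equiv> \<lambda>i::nat. (\<lambda>g\<in>carrier G. ideal_character (e i) g)"
  shows "inj_on \<chi> I" "\<And>i. i \<in> I \<Longrightarrow> \<chi> i \<in> Irr G" "\<And>i. i \<in> I \<Longrightarrow> \<chi> i \<noteq> principal_character G"
proof -
  show Irr: "\<chi> i \<in> Irr G" if "i \<in> I" for i
    unfolding \<chi>_def by (rule ideal_character_Irr(1)[OF e[OF that]])
  have Mc: "m \<in> carrier G" if "i \<in> I" "m \<in> M i" for i m
    using subgroup_mem_carrier[OF normal_inD(1)[OF M]] that by blast
  have M0: "card (M i) \<noteq> 0" if "i \<in> I" for i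
    using subgroup_finite[OF normal_inD(1)[OF M[OF that]]] subgroup.one_closed[OF normal_inD(1)[OF M[OF that]]]
    by auto
  have sum: "(\<Sum>m\<in>M i. \<chi> i m) = 0" if "i \<in> I" for i
    using ideal_character_sum_zero[OF M[OF that] eM[OF that]] Mc[OF that] by (simp add: \<chi>_def)
  have const: False if i: "i \<in> I" and c: "c \<noteq> 0" "\<And>m. m \<in> M i \<Longrightarrow> \<chi> i m = c" for i c
    using sum[OF i] c M0[OF i] by simp
  show "\<chi> i \<noteq> principal_character G" if i: "i \<in> I" for i
    using const[OF i, of 1] Mc[OF i] by (auto simp: principal_character_def)
  have neq: "\<chi> i \<noteq> \<chi> j" if ij: "i \<in> I" "j \<in> I" "i < j" for i j
  proof
    assume eq: "\<chi> i = \<chi> j"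
    have "\<chi> j m = ideal_character (e j) \<one>" if m: "m \<in> M i" for m
    proof -
      have "m \<in> N j" using MN[OF ij] m by blast
      moreover have "e j \<in> CG" using e[OF ij(2)] by (simp add: minimal_idempotent_def)
      ultimately have "ideal_character (e j) m = ideal_character (e j) \<one>"
        using ideal_character_trivial_on[OF N[OF ij(2)]] eN[OF ij(2)] by blast
      then show ?thesis using Mc[OF ij(1) m] by (simp add: \<chi>_def)
    qed
    then show False
      using const[OF ij(1) ideal_character_Irr(2)[OF e[OF ij(2)]]] eq by auto
  qed
  show "inj_on \<chi> I"
    by (rule inj_onI) (metis neq nat_neq_iff)
qed

text \<open>The prime \<open>q i\<close> may depend on the factor and \<open>Q\<close> is any
  property implied by the fields of values; the p-solvable case takes \<open>q\<close> constant, the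
  solvable case lets it vary.\<close>

lemma card_characters_ge:
  assumes fI: "finite I" and M: "\<And>i. i \<in> I \<Longrightarrow> normal_in (M i) (carrier G)" and N: "\<And>i. i \<in> I \<Longrightarrow> normal_in (N i) (carrier G)"
    and MN: "\<And>i j. i \<in> I \<Longrightarrow> j \<in> I \<Longrightarrow> i < j \<Longrightarrow> M i \<subseteq> N j"
    and ex: "\<And>i. i \<in> I \<Longrightarrow> \<exists>e\<in>KG (Qp (q i)). minimal_idempotent e \<and> (\<forall>n\<in>N i. L n * e = e) \<and> sumL (M i) * e = 0"
    and Q: "\<And>i \<chi>. i \<in> I \<Longrightarrow> Qp_valued G (q i) \<chi> \<Longrightarrow> Q \<chi>" and q: "\<And>i. i \<in> I \<Longrightarrow> q i > 0"
  shows "card (I :: nat set) \<le> card {\<chi> \<in> Irr G. \<chi> \<noteq> principal_character G \<and> Q \<chi>}"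
proof -
  obtain e where e: "\<And>i. i \<in> I \<Longrightarrow> e i \<in> KG (Qp (q i)) \<and> minimal_idempotent (e i) \<and>
      (\<forall>n\<in>N i. L n * e i = e i) \<and> sumL (M i) * e i = 0"
    using ex by metis
  define \<chi> where "\<chi> i = (\<lambda>g\<in>carrier G. ideal_character (e i) g)" for i
  have "minimal_idempotent (e i)" "\<And>n. n \<in> N i \<Longrightarrow> L n * e i = e i" "sumL (M i) * e i = 0" if "i \<in> I" for i
    using e[OF that] by auto
  note dist = distinct_characters[of I M N e, OF M N this(1) this(2) this(3) MN, folded \<chi>_def]
  have val: "Qp_valued G (q i) (\<chi> i)" if i: "i \<in> I" for i
  proof -
    have one: "1 \<in> Qp (q i)" by (rule subsetD[OF Qp_p_roots[OF q[OF i]] p_roots_one])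
    have "1 + - 1 \<in> Qp (q i)" by (rule Qp_add[OF one Qp_minus[OF one]])
    then have "0 \<in> Qp (q i)" by simp
    then show ?thesis unfolding Qp_valued_def \<chi>_def
      using ideal_character_in[of "e i" "Qp (q i)"] e[OF i] Qp_add by simp
  qed
  show ?thesis
  proof (rule card_inj_on_le[OF dist(1)])
    show "\<chi> ` I \<subseteq> {\<chi> \<in> Irr G. \<chi> \<noteq> principal_character G \<and> Q \<chi>}"
      by (simp add: image_subset_iff dist(2,3) Q[OF _ val])
    show "finite {\<chi> \<in> Irr G. \<chi> \<noteq> principal_character G \<and> Q \<chi>}" using finite_Irr by simp
  qed
qed

lemma chief_factorD:
  assumes "chief_factor G M N"
  shows "normal_in M (carrier G)" "normal_in N (carrier G)" "N \<subset> M"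
    "\<And>J. normal_in J (carrier G) \<Longrightarrow> N \<subset> J \<Longrightarrow> J \<subseteq> M \<Longrightarrow> J = M"
  using assms unfolding chief_factor_def normal_in_carrier_iff by blast+

lemma p_chief_factor_card:
  assumes "p_chief_factor p G M N"
  shows "\<exists>k. card M = p ^ k * card N"
proof -
  have c: "chief_factor G M N" and pg: "p_group p (factor_group G M N)"
    using assms by (auto simp: p_chief_factor_def)
  note d = chief_factorD[OF c]
  have sM: "subgroup M G" using normal_inD(1)[OF d(1)] .
  have nNM: "normal_in N M" using normal_in_mono[OF d(2) sM _ subgroup.subset[OF sM]] d(3) by blast
  obtain k where "Coset.order (factor_group G M N) = p ^ k" using pg by (auto simp: p_group_def)
  then have "card (rcosets\<^bsub>G\<lparr>carrier := M\<rparr>\<^esub> N) = p ^ k"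
    by (simp add: Coset.order_def factor_group_def FactGroup_def)
  then show ?thesis using card_rcosets_mult[OF nNM subgroup_finite[OF sM]] by metis
qed

lemma normal_series_mono:
  assumes "normal_series G Ns" "i \<le> j" "j < length Ns"
  shows "Ns ! i \<subseteq> Ns ! j"
  using assms(2,3)
proof (induction j rule: dec_induct)
  case (step j)
  then show ?case using assms(1) by (fastforce simp: normal_series_def)
qed simp

end

theorem theorem1p5:
  shows
    "(\<forall>(p::nat) (G :: ('a, 'b) monoid_scheme) Ns.
        Factorial_Ring.prime p \<and> group G \<and> finite (carrier G) \<and> p_solvable p G \<and> chief_series G Ns \<longrightarrow>
        num_p_chief_factors p G Ns
          \<le> card {\<chi> \<in> Irr G. \<chi> \<noteq> principal_character G \<and> Qp_valued G p \<chi>})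
     \<and>
     (\<forall>(G :: ('a, 'b) monoid_scheme) Ns.
        group G \<and> finite (carrier G) \<and> solvable G \<and> chief_series G Ns \<longrightarrow>
        num_chief_factors Ns
          \<le> card {\<chi> \<in> Irr G. \<chi> \<noteq> principal_character G \<and> Qpp_valued G \<chi>})"
proof (intro conjI allI impI; elim conjE)
  fix p and G :: "('a, 'b) monoid_scheme" and Ns
  assume p: "Factorial_Ring.prime p" and G: "group G" "finite (carrier G)" and ps: "p_solvable p G"
    and cs: "chief_series G Ns"
  interpret group G by (rule G)
  interpret finite_group G by unfold_locales (rule G)
  have ns: "normal_series G Ns" using cs by (simp add: chief_series_def)
  define I where "I = {i. Suc i < length Ns \<and> p_chief_factor p G (Ns ! Suc i) (Ns ! i)}"
  have cf: "chief_factor G (Ns ! Suc i) (Ns ! i)" if "i \<in> I" for i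
    using that by (simp add: I_def p_chief_factor_def)
  have "finite I" by (rule finite_subset[of _ "{..<length Ns}"]) (auto simp: I_def)
  moreover have "Ns ! Suc i \<subseteq> Ns ! j" if "i \<in> I" "j \<in> I" "i < j" for i j
    using that normal_series_mono[OF ns, of "Suc i" j] by (auto simp: I_def)
  moreover have "\<exists>e\<in>KG (Qp p). minimal_idempotent e \<and> (\<forall>n\<in>Ns ! i. L n * e = e) \<and> sumL (Ns ! Suc i) * e = 0"
    if i: "i \<in> I" for i
  proof -
    obtain k where k: "card (Ns ! Suc i) = p ^ k * card (Ns ! i)"
      using p_chief_factor_card[of p "Ns ! Suc i" "Ns ! i"] i by (auto simp: I_def)
    note d = chief_factorD[OF cf[OF i]]
    show ?thesis
      using chief_factor_idempotent[OF p p_solvable_step[OF G(2) p ps] d(1,2,3) k d(4)] .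
  qed
  ultimately have "card I \<le> card {\<chi> \<in> Irr G. \<chi> \<noteq> principal_character G \<and> Qp_valued G p \<chi>}"
    using chief_factorD(1,2)[OF cf] p prime_gt_0_nat
    by (intro card_characters_ge[where M = "\<lambda>i. Ns ! Suc i" and N = "\<lambda>i. Ns ! i" and q = "\<lambda>_. p"]) auto
  then show "num_p_chief_factors p G Ns \<le> card {\<chi> \<in> Irr G. \<chi> \<noteq> principal_character G \<and> Qp_valued G p \<chi>}"
    by (simp add: num_p_chief_factors_def I_def)
next
  fix G :: "('a, 'b) monoid_scheme" and Ns
  assume G: "group G" "finite (carrier G)" and sol: "solvable G" and cs: "chief_series G Ns"
  interpret group G by (rule G)
  interpret finite_group G by unfold_locales (rule G)
  have ns: "normal_series G Ns" using cs by (simp add: chief_series_def)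
  define I where "I = {i. Suc i < length Ns}"
  have cf: "chief_factor G (Ns ! Suc i) (Ns ! i)" if "i \<in> I" for i
    using that cs by (simp add: I_def chief_series_def)
  have "\<exists>q k. Factorial_Ring.prime q \<and> card (Ns ! Suc i) = q ^ k * card (Ns ! i)" if i: "i \<in> I" for i
    using solvable_minimal_section[OF G(2) sol chief_factorD[OF cf[OF i]]] .
  then obtain q k where qk: "\<And>i. i \<in> I \<Longrightarrow> Factorial_Ring.prime (q i) \<and> card (Ns ! Suc i) = q i ^ k i * card (Ns ! i)"
    by metis
  have "finite I" by (rule finite_subset[of _ "{..<length Ns}"]) (auto simp: I_def)
  moreover have "Ns ! Suc i \<subseteq> Ns ! j" if "i \<in> I" "j \<in> I" "i < j" for i j
    using that normal_series_mono[OF ns, of "Suc i" j] by (auto simp: I_def)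
  moreover have "\<exists>e\<in>KG (Qp (q i)). minimal_idempotent e \<and> (\<forall>n\<in>Ns ! i. L n * e = e) \<and> sumL (Ns ! Suc i) * e = 0"
    if i: "i \<in> I" for i
  proof -
    have q: "Factorial_Ring.prime (q i)" and k: "card (Ns ! Suc i) = q i ^ k i * card (Ns ! i)"
      using qk[OF i] by auto
    note d = chief_factorD[OF cf[OF i]]
    show ?thesis
      using chief_factor_idempotent[OF q solvable_step[OF G(2) q sol] d(1,2,3) k d(4)] .
  qed
  moreover have "Qpp_valued G \<chi>" if "i \<in> I" "Qp_valued G (q i) \<chi>" for i \<chi>
    using that qk by (auto simp: Qpp_valued_def)
  moreover have "q i > 0" if "i \<in> I" for i using qk[OF that] prime_gt_0_nat by blast
  ultimately have "card I \<le> card {\<chi> \<in> Irr G. \<chi> \<noteq> principal_character G \<and> Qpp_valued G \<chi>}"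
    using chief_factorD(1,2)[OF cf]
    by (intro card_characters_ge[where M = "\<lambda>i. Ns ! Suc i" and N = "\<lambda>i. Ns ! i" and q = q]) auto
  then show "num_chief_factors Ns \<le> card {\<chi> \<in> Irr G. \<chi> \<noteq> principal_character G \<and> Qpp_valued G \<chi>}"
    by (simp add: num_chief_factors_def I_def)
qed

end
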